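(* There is an algorithm that, given an instance $\psi$ of \textsc{3-Partitioned-3-SAT} on $N$ variables, runs in $2^{\mathcal{O}(\sqrt{N})}$ time and constructs an equivalent instance $(G,k)$ of \textsc{Geodetic Set} (i.e., $\psi$ is satisfiable if and only if $G$ has a geodetic set of size at most $k$) such that $\mathtt{vc}(G)+k=\mathcal{O}(\sqrt{N})$ and $|V(G)|=2^{\mathcal{O}(\sqrt{N})}$.
   Context: \textsc{3-Partitioned-3-SAT}: the input is a formula $\psi$ in 3-CNF together with a partition of its variable set into three disjoint sets $X^{\alpha},X^{\beta},X^{\gamma}$ with $|X^{\alpha}|=|X^{\beta}|=|X^{\gamma}|$, such that no clause contains more than one variable from each of $X^{\alpha},X^{\beta},X^{\gamma}$; the question is whether $\psi$ is satisfiable. \textsc{Geodetic Set}: given a graph $G$ and a positive integer $k$, decide whether there is $S\subseteq V(G)$ with $|S|\le k$ such that every vertex $u\in V(G)$ lies on some shortest path between two vertices $s_1,s_2\in S$ (such $S$ is a geodetic set). $\mathtt{vc}(G)$ is the minimum size of a vertex cover of $G$ (a set whose complement is independent). *)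

theory Defs
  imports
    Complex_Main
    "HOL-Library.Landau_Symbols"
    "Graph_Theory.Graph_Theory"
begin

section \<open>Machine model\<close>

text \<open>
  A random access machine in the style of Cook and Reckhow: countably many registers holding
  natural numbers, addition and truncated subtraction but no multiplication, indirect
  addressing, a read-only input stream and a write-only output stream. Every instruction
  and every test costs one unit, so running times agree with multitape Turing machine times up
  to a polynomial (in \<open>t\<close> steps, numbers grow by at most \<open>t\<close> bits
  beyond the largest number in the program and the input).
  Control flow is structured; a structured program translates into one with jumps with only a
  constant-factor overhead.
\<close>

datatype com =
    Skip
  | Const nat nat        \<comment> \<open>\<open>Const i n\<close>: \<open>R i := n\<close>\<close>
  | Add nat nat nat      \<comment> \<open>\<open>Add i j k\<close>: \<open>R i := R j + R k\<close>\<close>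
  | Sub nat nat nat      \<comment> \<open>\<open>Sub i j k\<close>: \<open>R i := R j - R k\<close>, truncated at 0\<close>
  | Load nat nat         \<comment> \<open>\<open>Load i j\<close>: \<open>R i := R (R j)\<close>\<close>
  | Store nat nat        \<comment> \<open>\<open>Store i j\<close>: \<open>R (R i) := R j\<close>\<close>
  | Read nat             \<comment> \<open>yields 0 once the input is exhausted\<close>
  | Write nat
  | Seq com com
  | Cond nat com com     \<comment> \<open>\<open>Cond i c d\<close>: run \<open>c\<close> if \<open>R i > 0\<close>, and \<open>d\<close> otherwise\<close>
  | While nat com        \<comment> \<open>\<open>While i c\<close>: repeat \<open>c\<close> as long as \<open>R i > 0\<close>\<close>

text \<open>A state consists of the registers, the unread input, and the output written so far.\<close>

type_synonym state = "(nat \<Rightarrow> nat) \<times> nat list \<times> nat list"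

inductive exec :: "com \<Rightarrow> state \<Rightarrow> nat \<Rightarrow> state \<Rightarrow> bool" where
  Skip: "exec Skip s 1 s"
| Const: "exec (Const i n) (R, inp, out) 1 (R(i := n), inp, out)"
| Add: "exec (Add i j k) (R, inp, out) 1 (R(i := R j + R k), inp, out)"
| Sub: "exec (Sub i j k) (R, inp, out) 1 (R(i := R j - R k), inp, out)"
| Load: "exec (Load i j) (R, inp, out) 1 (R(i := R (R j)), inp, out)"
| Store: "exec (Store i j) (R, inp, out) 1 (R(R i := R j), inp, out)"
| Read: "exec (Read i) (R, inp, out) 1 (R(i := (if inp = [] then 0 else hd inp)), tl inp, out)"
| Write: "exec (Write i) (R, inp, out) 1 (R, inp, out @ [R i])"
| Seq: "exec c s t s' \<Longrightarrow> exec d s' t' s'' \<Longrightarrow> exec (Seq c d) s (t + t') s''"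
| CondPos: "fst s i > 0 \<Longrightarrow> exec c s t s' \<Longrightarrow> exec (Cond i c d) s (t + 1) s'"
| CondZero: "fst s i = 0 \<Longrightarrow> exec d s t s' \<Longrightarrow> exec (Cond i c d) s (t + 1) s'"
| WhileZero: "fst s i = 0 \<Longrightarrow> exec (While i c) s 1 s"
| WhilePos: "fst s i > 0 \<Longrightarrow> exec c s t s' \<Longrightarrow> exec (While i c) s' t' s''
    \<Longrightarrow> exec (While i c) s (t + t' + 1) s''"

inductive_cases SkipE: "exec Skip s t s'"
inductive_cases ConstE: "exec (Const i n) s t s'"
inductive_cases AddE: "exec (Add i j k) s t s'"
inductive_cases SubE: "exec (Sub i j k) s t s'"
inductive_cases LoadE: "exec (Load i j) s t s'"
inductive_cases StoreE: "exec (Store i j) s t s'"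
inductive_cases ReadE: "exec (Read i) s t s'"
inductive_cases WriteE: "exec (Write i) s t s'"
inductive_cases SeqE: "exec (Seq c d) s t s'"
inductive_cases CondE: "exec (Cond i c d) s t s'"
inductive_cases WhileE: "exec (While i c) s t s'"

lemma exec_deterministic:
  "exec c s t s' \<Longrightarrow> exec c s u s'' \<Longrightarrow> t = u \<and> s' = s''"
proof (induction arbitrary: u s'' rule: exec.induct)
  case (Seq c s t s' d t' s1)
  from Seq.prems show ?case by (rule SeqE) (blast dest: Seq.IH)
next
  case (CondPos s i c t s' d)
  from CondPos.prems show ?case by (rule CondE) (use CondPos.hyps in \<open>auto dest: CondPos.IH\<close>)
next
  case (CondZero s i d t s' c)
  from CondZero.prems show ?case by (rule CondE) (use CondZero.hyps in \<open>auto dest: CondZero.IH\<close>)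
next
  case (WhileZero s i c)
  from WhileZero.prems show ?case by (rule WhileE) (use WhileZero.hyps in auto)
next
  case (WhilePos s i c t s' t' s1)
  from WhilePos.prems show ?case
    by (rule WhileE) (use WhilePos.hyps(1) in simp, metis WhilePos.IH Suc_eq_plus1)
qed (auto elim: SkipE ConstE AddE SubE LoadE StoreE ReadE WriteE)+

definition computes_in_time :: "com \<Rightarrow> nat list \<Rightarrow> nat \<Rightarrow> nat list \<Rightarrow> bool" where
  "computes_in_time c w t out \<longleftrightarrow> (\<exists>R inp. exec c (\<lambda>_. 0, w, []) t (R, inp, out))"


section \<open>3-Partitioned-3-SAT\<close>

datatype 'v literal = Pos (var: 'v) | Neg (var: 'v)

record 'v psat =
  clauses :: "'v literal set set"
  part_alpha :: "'v set"
  part_beta :: "'v set"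
  part_gamma :: "'v set"

definition variables :: "'v psat \<Rightarrow> 'v set" where
  "variables I = part_alpha I \<union> part_beta I \<union> part_gamma I"

text \<open>Clauses have at most three literals; not every variable needs to occur in a clause.\<close>

definition three_partitioned_3sat :: "'v psat \<Rightarrow> bool" where
  "three_partitioned_3sat I \<longleftrightarrow>
     finite (variables I) \<and>
     part_alpha I \<inter> part_beta I = {} \<and>
     part_alpha I \<inter> part_gamma I = {} \<and>
     part_beta I \<inter> part_gamma I = {} \<and>
     card (part_alpha I) = card (part_beta I) \<and>
     card (part_beta I) = card (part_gamma I) \<and>
     (\<forall>C\<in>clauses I. finite C \<and> card C \<le> 3 \<and> var ` C \<subseteq> variables I \<and>
        card (var ` C \<inter> part_alpha I) \<le> 1 \<and>
        card (var ` C \<inter> part_beta I) \<le> 1 \<and>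
        card (var ` C \<inter> part_gamma I) \<le> 1)"

fun lit_true :: "('v \<Rightarrow> bool) \<Rightarrow> 'v literal \<Rightarrow> bool" where
  "lit_true \<sigma> (Pos x) = \<sigma> x"
| "lit_true \<sigma> (Neg x) = (\<not> \<sigma> x)"

definition satisfiable :: "'v psat \<Rightarrow> bool" where
  "satisfiable I \<longleftrightarrow> (\<exists>\<sigma>. \<forall>C\<in>clauses I. \<exists>l\<in>C. lit_true \<sigma> l)"


section \<open>Geodetic Set and vertex cover\<close>

definition shortest_path :: "'a pair_pre_digraph \<Rightarrow> 'a \<Rightarrow> 'a list \<Rightarrow> 'a \<Rightarrow> bool" where
  "shortest_path G s p t \<longleftrightarrow>
     vpath p (with_proj G) \<and> hd p = s \<and> last p = t \<and>
     (\<forall>q. vpath q (with_proj G) \<and> hd q = s \<and> last q = t \<longrightarrow> vwalk_length p \<le> vwalk_length q)"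

text \<open>
  The two ends may coincide, so every vertex of \<open>S\<close> is covered by its own trivial path.
\<close>

definition geodetic_set :: "'a pair_pre_digraph \<Rightarrow> 'a set \<Rightarrow> bool" where
  "geodetic_set G S \<longleftrightarrow>
     S \<subseteq> pverts G \<and>
     (\<forall>u\<in>pverts G. \<exists>s\<^sub>1\<in>S. \<exists>s\<^sub>2\<in>S. \<exists>p. shortest_path G s\<^sub>1 p s\<^sub>2 \<and> u \<in> set p)"

definition independent_set :: "'a pair_pre_digraph \<Rightarrow> 'a set \<Rightarrow> bool" where
  "independent_set G I \<longleftrightarrow> I \<subseteq> pverts G \<and> (\<forall>u\<in>I. \<forall>v\<in>I. (u, v) \<notin> parcs G)"

definition vertex_cover :: "'a pair_pre_digraph \<Rightarrow> 'a set \<Rightarrow> bool" where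
  "vertex_cover G C \<longleftrightarrow> C \<subseteq> pverts G \<and> independent_set G (pverts G - C)"

definition vertex_cover_number :: "'a pair_pre_digraph \<Rightarrow> nat" where
  "vertex_cover_number G = (LEAST n. \<exists>C. vertex_cover G C \<and> card C = n)"


section \<open>Encodings\<close>

definition encode_list :: "('a \<Rightarrow> nat list) \<Rightarrow> 'a list \<Rightarrow> nat list" where
  "encode_list e xs = length xs # concat (map e xs)"

fun encode_literal :: "nat literal \<Rightarrow> nat list" where
  "encode_literal (Pos x) = [x, 1]"
| "encode_literal (Neg x) = [x, 0]"

text \<open>
  The variables are numbered \<open>0, \<dots>, N - 1\<close>. The three parts, the clauses, and the
  literals of each clause are listed without repetition, each in an arbitrary order; in
  particular, the length of the input is bounded by a polynomial in \<open>N\<close>.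
\<close>

definition encodes_psat :: "nat list \<Rightarrow> nat psat \<Rightarrow> bool" where
  "encodes_psat w I \<longleftrightarrow>
     variables I = {..<card (variables I)} \<and>
     (\<exists>xs ys zs Cs.
        distinct xs \<and> set xs = part_alpha I \<and>
        distinct ys \<and> set ys = part_beta I \<and>
        distinct zs \<and> set zs = part_gamma I \<and>
        (\<forall>C\<in>set Cs. distinct C) \<and> distinct (map set Cs) \<and> set (map set Cs) = clauses I \<and>
        w = encode_list (\<lambda>x. [x]) xs @ encode_list (\<lambda>x. [x]) ys @ encode_list (\<lambda>x. [x]) zs
          @ encode_list (encode_list encode_literal) Cs)"

text \<open>
  Output: the bound \<open>k\<close>, the number of vertices, and the adjacency matrix row by row, for a
  graph with vertices \<open>0, \<dots>, n - 1\<close>.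
\<close>

definition encodes_geodetic :: "nat list \<Rightarrow> nat pair_pre_digraph \<Rightarrow> nat \<Rightarrow> bool" where
  "encodes_geodetic out G k \<longleftrightarrow>
     (let n = card (pverts G) in
        pverts G = {..<n} \<and>
        out = k # n #
          concat (map (\<lambda>u. map (\<lambda>v. if (u, v) \<in> parcs G then 1 else 0) [0..<n]) [0..<n]))"

end

theory Submission
  imports Defs
begin

text \<open>
  Cut each of the three parts, of size \<open>n\<close>, into \<open>m\<close> blocks of at most \<open>m\<close> variables, where \<open>m\<close> is about
  the square root of \<open>n\<close>, and create a vertex for each of the \<open>2 ^ m\<close> assignments of each block.
  A geodetic set must contain all pendant vertices, and the budget leaves exactly one further
  vertex per block. An assignment vertex of a block is joined through the literals it makes true
  to the clauses containing them, and each clause to the hubs of the blocks of its variables; so a clause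
  vertex is covered iff a selected assignment satisfies one of its literals. A literal vertex is
  identified by its part and its position in a block only, which keeps the vertex cover small; it is
  here that a clause must not contain two variables of the same part.

  For the running time, the adjacency relation is written as a formula of bounded arithmetic over the
  input, with all quantifiers bounded by \<open>2 ^ (20 * m)\<close>, and such formulas are compiled to machine programs.
\<close>

section \<open>Blocks of variables\<close>

text \<open>What an assignment of a block does to a clause must be expressed by edges, yet both the
  exponentially many assignment vertices and the clause vertices have to stay outside a vertex cover
  of size O(m). So the two families can only communicate through O(m) vertices, and one vertex per
  literal of each variable would already be too many. Merging the literals over the blocks of a part
  leaves \<open>6 * m\<close> of them, at a price: a clause is joined to positions and, separately,
  to hubs, and its edges do not say which position goes with which hub. The part is coded in both,
  and within one part the clause offers only one variable, so position and hub of the same part stem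
  from the same variable.

  The cover has at most \<open>15 * m + 3\<close> vertices and the budget is
  \<open>6 * m + 3\<close>. For the running time any polynomial in \<open>2 ^ (20 * m)\<close> will
  do. Hence every adjacency may be decided by exhaustive search, and the cost of a formula has to be
  known only up to being polynomial in the bound.\<close>

lemma mixed_radix_unique:
  fixes a b a' b' m :: nat
  assumes "a * m + b = a' * m + b'" "b < m" "b' < m"
  shows "a = a' \<and> b = b'"
proof -
  have "(a * m + b) div m = a" "(a * m + b) mod m = b" using assms(2) by simp_all
  moreover have "(a' * m + b') div m = a'" "(a' * m + b') mod m = b'" using assms(3) by simp_all
  ultimately show ?thesis using assms(1) by metis
qed

lemma mixed_radix_less:
  fixes a b m :: nat
  assumes "a < k" "b < m" shows "a * m + b < k * m"
proof -
  have "a * m + b < Suc a * m" using assms by simp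
  also have "\<dots> \<le> k * m" using assms by (intro mult_right_mono) auto
  finally show ?thesis .
qed

definition bit_of :: "nat \<Rightarrow> nat \<Rightarrow> nat" where "bit_of a p = a div 2 ^ p mod 2"

lemma ex_bits: "\<exists>a<2 ^ m. \<forall>p<m. bit_of a p = (if b p then 1 else 0)"
proof (induction m)
  case (Suc m)
  then obtain a where a: "a < 2 ^ m" "\<And>p. p < m \<Longrightarrow> bit_of a p = (if b p then 1 else 0)" by auto
  let ?a = "a + (if b m then 2 ^ m else 0)"
  have "bit_of ?a p = (if b p then 1 else 0)" if "p < Suc m" for p
  proof (cases "p = m")
    case True
    then show ?thesis using a(1) by (simp add: bit_of_def)
  next
    case False
    with that have p: "p < m" by simp
    \<comment> \<open>The added \<open>2 ^ m\<close> is an even multiple of \<open>2 ^ p\<close>, so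
      bit \<open>p\<close> is left alone.\<close>
    then have "(2::nat) ^ m = 2 * 2 ^ (m - Suc p) * 2 ^ p"
      by (simp flip: power_add power_Suc)
    then have "bit_of ?a p = bit_of a p" by (simp add: bit_of_def)
    with a(2)[OF p] show ?thesis by simp
  qed
  moreover have "?a < 2 ^ Suc m" using a(1) by simp
  ultimately show ?case by blast
qed simp

text \<open>
  \<open>w\<close> is the input after its first number \<open>n\<close>, the size of a part. Each part is cut into \<open>m\<close>
  blocks of \<open>m\<close> variables; block \<open>i\<close> of part \<open>d\<close> has number \<open>d * m + i\<close>, and the literal with
  sign \<open>s\<close> of the \<open>p\<close>-th variable of some block of part \<open>d\<close> is represented by \<open>s * (3 * m) + d * m + p\<close>.
\<close>

definition clause_pos :: "(nat \<Rightarrow> nat) \<Rightarrow> nat \<Rightarrow> nat \<Rightarrow> nat" where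
  "clause_pos w n c = ((\<lambda>y. y + 1 + 2 * w y) ^^ c) (3 * n + 3)"

text \<open>Once the leading \<open>n\<close> is dropped, part \<open>d\<close> starts at
  \<open>d * (n + 1)\<close>, since each later part is preceded by its own length, and the clauses
  start at \<open>3 * n + 3\<close>. A clause is its length followed by pairs of variable and sign,
  whence \<open>1 + 2 * r\<close> here and \<open>2 + 2 * r\<close> for signs. The test
  \<open>i * m + p < n\<close> discards the empty slots when \<open>n < m * m\<close>.\<close>

definition occurs :: "(nat \<Rightarrow> nat) \<Rightarrow> nat \<Rightarrow> nat \<Rightarrow> nat \<Rightarrow> nat \<Rightarrow> nat \<Rightarrow> nat \<Rightarrow> nat \<Rightarrow> bool" where
  "occurs w n m c r d i p \<longleftrightarrow> r < w (clause_pos w n c) \<and> i * m + p < n \<and>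
     w (clause_pos w n c + 1 + 2 * r) = w (d * (n + 1) + (i * m + p))"

definition clause_block :: "(nat \<Rightarrow> nat) \<Rightarrow> nat \<Rightarrow> nat \<Rightarrow> nat \<Rightarrow> nat \<Rightarrow> bool" where
  "clause_block w n m c j \<longleftrightarrow> (\<exists>d<3. \<exists>i<m. \<exists>p<m. \<exists>r<3. j = d * m + i \<and> occurs w n m c r d i p)"

text \<open>The block index \<open>i\<close> does not enter \<open>l\<close>: literals of equal sign
  at the same position in different blocks of a part share a number.\<close>

definition clause_lit :: "(nat \<Rightarrow> nat) \<Rightarrow> nat \<Rightarrow> nat \<Rightarrow> nat \<Rightarrow> nat \<Rightarrow> bool" where
  "clause_lit w n m c l \<longleftrightarrow> (\<exists>d<3. \<exists>i<m. \<exists>p<m. \<exists>r<3. \<exists>s<2. occurs w n m c r d i p \<and>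
     s = w (clause_pos w n c + 2 + 2 * r) \<and> l = s * (3 * m) + (d * m + p))"

text \<open>Slots beyond the end of a part are not excluded, so that even a block without variables
  has a true literal under each assignment, as the graph requires.\<close>

definition block_lit :: "nat \<Rightarrow> nat \<Rightarrow> nat \<Rightarrow> nat \<Rightarrow> bool" where
  "block_lit m j a l \<longleftrightarrow> (\<exists>d<3. \<exists>i<m. \<exists>p<m. \<exists>s<2. j = d * m + i \<and>
     l = s * (3 * m) + (d * m + p) \<and> bit_of a p = s)"

lemma block_lit_ex_lit:
  assumes "j < 3 * m"
  shows "\<exists>l<2 * (3 * m). block_lit m j a l"
proof -
  have m: "0 < m" using assms by (cases m) auto
  have d: "j div m < 3" using assms by (simp add: less_mult_imp_div_less)
  let ?l = "bit_of a 0 * (3 * m) + (j div m * m + 0)"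
  have "?l < 2 * (3 * m)"
    by (intro mixed_radix_less d m) (simp add: bit_of_def)
  moreover have "block_lit m j a ?l"
    unfolding block_lit_def
    by (rule exI[of _ "j div m"], rule conjI[OF d], rule exI[of _ "j mod m"], rule conjI, simp add: m,
        rule exI[of _ 0], rule conjI[OF m], rule exI[of _ "bit_of a 0"]) (simp add: bit_of_def)
  ultimately show ?thesis by blast
qed

text \<open>The witness is the first block of the part coded in \<open>l\<close>, with all bits
  equal to the sign coded in \<open>l\<close>.\<close>

lemma block_lit_ex_assignment:
  assumes "l < 2 * (3 * m)"
  shows "\<exists>j<3 * m. \<exists>a<2 ^ m. block_lit m j a l"
proof -
  have m: "0 < m" using assms by (cases m) auto
  define s where "s = l div (3 * m)"
  define d where "d = l mod (3 * m) div m"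
  define p where "p = l mod (3 * m) mod m"
  have s: "s < 2" unfolding s_def using assms by (simp add: less_mult_imp_div_less)
  have d: "d < 3" unfolding d_def using m by (simp add: less_mult_imp_div_less)
  have p: "p < m" unfolding p_def using m by simp
  have l: "l = s * (3 * m) + (d * m + p)"
    unfolding s_def d_def p_def by (metis div_mult_mod_eq)
  obtain a where a: "a < 2 ^ m" "\<And>p. p < m \<Longrightarrow> bit_of a p = (if s = 1 then 1 else 0)"
    using ex_bits[of m "\<lambda>_. s = 1"] by blast
  have "bit_of a p = s" using a(2)[OF p] s by auto
  then have "block_lit m (d * m + 0) a l"
    unfolding block_lit_def using l d p s m by blast
  moreover have "d * m + 0 < 3 * m" using d m by (intro mixed_radix_less) auto
  ultimately show ?thesis using a(1) by blast
qed

section \<open>Decoding an instance\<close>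

definition encode_clause :: "nat literal list \<Rightarrow> nat list" where
  "encode_clause = encode_list encode_literal"

lemma nth_concat_map_take:
  assumes "i < length xs" "k < length (f (xs ! i))"
  shows "concat (map f xs) ! (length (concat (map f (take i xs))) + k) = f (xs ! i) ! k"
proof -
  have "concat (map f xs) = concat (map f (take i xs)) @ f (xs ! i) @ concat (map f (drop (Suc i) xs))"
    using assms(1) by (subst id_take_nth_drop) auto
  then show ?thesis using assms(2) by (simp add: nth_append)
qed

definition sign_of :: "nat literal \<Rightarrow> nat" where
  "sign_of l = (case l of Pos x \<Rightarrow> 1 | Neg x \<Rightarrow> 0)"

lemma encode_literal_eq: "encode_literal l = [var l, sign_of l]"
  by (cases l) (auto simp: sign_of_def)

lemma lit_true_iff: "lit_true \<sigma> l \<longleftrightarrow> \<sigma> (var l) = (sign_of l = 1)"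
  by (cases l) (auto simp: sign_of_def)

lemma sign_of_less: "sign_of l < 2"
  by (cases l) (auto simp: sign_of_def)

lemma length_concat_encode_literal [simp]: "length (concat (map encode_literal C)) = 2 * length C"
  by (induction C) (auto simp: encode_literal_eq)

lemma length_encode_clause: "length (encode_clause C) = 1 + 2 * length C"
  by (simp add: encode_clause_def encode_list_def)

lemma encode_clause_nth_0: "encode_clause C ! 0 = length C"
  by (simp add: encode_clause_def encode_list_def)

lemma encode_clause_nth:
  assumes "r < length C"
  shows "encode_clause C ! (1 + 2 * r) = var (C ! r)" "encode_clause C ! (2 + 2 * r) = sign_of (C ! r)"
proof -
  have *: "concat (map encode_literal C) ! (2 * r + k) = encode_literal (C ! r) ! k" if "k < 2" for k
    using nth_concat_map_take[of r C k encode_literal] assms that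
    by (simp add: encode_literal_eq min_def)
  show "encode_clause C ! (1 + 2 * r) = var (C ! r)" "encode_clause C ! (2 + 2 * r) = sign_of (C ! r)"
    using *[of 0] *[of 1] by (simp_all add: encode_clause_def encode_list_def encode_literal_eq)
qed

text \<open>\<open>w\<close> is continued by zeros past the end of the input, in agreement with what
  \<open>Read\<close> yields there.\<close>

locale instance_word =
  fixes I :: "nat psat" and xs ys zs :: "nat list" and Cs :: "nat literal list list"
    and w :: "nat \<Rightarrow> nat" and n m :: nat
  assumes psat: "three_partitioned_3sat I"
    and parts: "distinct xs" "set xs = part_alpha I" "distinct ys" "set ys = part_beta I"
      "distinct zs" "set zs = part_gamma I"
    and Cs: "\<And>C. C \<in> set Cs \<Longrightarrow> distinct C" "distinct (map set Cs)" "set (map set Cs) = clauses I"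
    and n: "n = card (part_alpha I)"
    and w: "w = (\<lambda>i. let v = xs @ encode_list (\<lambda>x. [x]) ys @ encode_list (\<lambda>x. [x]) zs
          @ encode_list encode_clause Cs in if i < length v then v ! i else 0)"
    and m: "n \<le> m * m" "0 < m"
begin

definition part :: "nat \<Rightarrow> nat list" where "part d = [xs, ys, zs] ! d"

lemma lengths: "length xs = n" "length ys = n" "length zs = n"
  using psat parts n distinct_card[of xs] distinct_card[of ys] distinct_card[of zs]
  by (auto simp: three_partitioned_3sat_def)

lemma less_3_cases: "d < 3 \<Longrightarrow> (d = 0 \<Longrightarrow> Q) \<Longrightarrow> (d = 1 \<Longrightarrow> Q) \<Longrightarrow> (d = 2 \<Longrightarrow> Q) \<Longrightarrow> Q" for d :: nat
  by linarith

lemma part_props: "d < 3 \<Longrightarrow> length (part d) = n \<and> distinct (part d)"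
  by (erule less_3_cases) (auto simp: part_def lengths parts)

lemma part_disjoint: "d < 3 \<Longrightarrow> d' < 3 \<Longrightarrow> x \<in> set (part d) \<Longrightarrow> x \<in> set (part d') \<Longrightarrow> d = d'"
  using psat unfolding three_partitioned_3sat_def
  by (elim less_3_cases) (auto simp: part_def parts)

lemma variables_part: "x \<in> variables I \<longleftrightarrow> (\<exists>d<3. x \<in> set (part d))"
proof -
  have "(\<exists>d<3. x \<in> set (part d)) \<longleftrightarrow> x \<in> set (part 0) \<or> x \<in> set (part 1) \<or> x \<in> set (part 2)"
    by (simp add: numeral_3_eq_3 numeral_2_eq_2 less_Suc_eq ex_disj_distrib conj_disj_distribR disj_ac)
  then show ?thesis by (simp add: variables_def part_def parts)
qed

lemma clause_part_unique:
  assumes "C \<in> set Cs" "l \<in> set C" "l' \<in> set C" "d < 3" "var l \<in> set (part d)" "var l' \<in> set (part d)"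
  shows "var l = var l'"
proof -
  have "set C \<in> clauses I" using Cs(3) assms(1) by auto
  then have "card (var ` set C \<inter> part_alpha I) \<le> 1 \<and> card (var ` set C \<inter> part_beta I) \<le> 1
      \<and> card (var ` set C \<inter> part_gamma I) \<le> 1"
    using psat unfolding three_partitioned_3sat_def by blast
  with assms(4) have "card (var ` set C \<inter> set (part d)) \<le> 1"
    by (elim less_3_cases) (simp_all add: part_def parts)
  moreover have "finite (var ` set C \<inter> set (part d))" by simp
  moreover have "var l \<in> var ` set C \<inter> set (part d)" "var l' \<in> var ` set C \<inter> set (part d)"
    using assms by simp_all
  ultimately show ?thesis by (metis card_le_Suc0_iff_eq One_nat_def)
qed

lemma w_part: "d < 3 \<Longrightarrow> k < n \<Longrightarrow> w (d * (n + 1) + k) = part d ! k"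
  by (erule less_3_cases) (auto simp: w part_def encode_list_def nth_append lengths)

lemma w_clauses: "k < length (concat (map encode_clause Cs)) \<Longrightarrow> w (3 * n + 3 + k) = concat (map encode_clause Cs) ! k"
  by (simp add: w encode_list_def nth_append lengths)

lemma w_length: "w (3 * n + 2) = length Cs"
  by (simp add: w encode_list_def nth_append lengths)

lemma w_clause_start:
  assumes "c < length Cs" "k < length (encode_clause (Cs ! c))"
  shows "w (3 * n + 3 + length (concat (map encode_clause (take c Cs))) + k) = encode_clause (Cs ! c) ! k"
proof -
  let ?k = "length (concat (map encode_clause (take c Cs))) + k"
  have "concat (map encode_clause Cs) = concat (map encode_clause (take c Cs)) @ encode_clause (Cs ! c)
      @ concat (map encode_clause (drop (Suc c) Cs))"
    using assms(1) by (subst id_take_nth_drop) auto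
  then have "?k < length (concat (map encode_clause Cs))" using assms(2) by simp
  from w_clauses[OF this] show ?thesis
    using nth_concat_map_take[where f = encode_clause, OF assms] by (simp only: add.assoc)
qed

lemma clause_pos_eq:
  assumes "c \<le> length Cs"
  shows "clause_pos w n c = 3 * n + 3 + length (concat (map encode_clause (take c Cs)))"
  using assms
proof (induction c)
  case (Suc c)
  then have "w (clause_pos w n c) = length (Cs ! c)"
    using w_clause_start[of c 0] by (simp add: length_encode_clause encode_clause_nth_0)
  with Suc show ?case
    by (simp add: clause_pos_def take_Suc_conv_app_nth length_encode_clause)
qed (simp add: clause_pos_def)

lemma w_clause:
  assumes "c < length Cs"
  shows "w (clause_pos w n c) = length (Cs ! c)"
    and "r < length (Cs ! c) \<Longrightarrow> w (clause_pos w n c + 1 + 2 * r) = var (Cs ! c ! r)"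
    and "r < length (Cs ! c) \<Longrightarrow> w (clause_pos w n c + 2 + 2 * r) = sign_of (Cs ! c ! r)"
proof -
  have *: "w (clause_pos w n c + k) = encode_clause (Cs ! c) ! k" if "k < 1 + 2 * length (Cs ! c)" for k
    using w_clause_start[OF assms, of k] that assms by (simp only: clause_pos_eq length_encode_clause)
  show "w (clause_pos w n c) = length (Cs ! c)"
    using *[of 0] by (simp add: encode_clause_nth_0)
  show "w (clause_pos w n c + 1 + 2 * r) = var (Cs ! c ! r)" if "r < length (Cs ! c)"
    using *[of "1 + 2 * r"] that encode_clause_nth(1)[OF that] by (simp add: add.assoc)
  show "w (clause_pos w n c + 2 + 2 * r) = sign_of (Cs ! c ! r)" if "r < length (Cs ! c)"
    using *[of "2 + 2 * r"] that encode_clause_nth(2)[OF that] by (simp add: add.assoc)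
qed

lemma length_clause: "C \<in> set Cs \<Longrightarrow> length C \<le> 3"
proof -
  assume C: "C \<in> set Cs"
  then have "set C \<in> clauses I" using Cs(3) by auto
  then have "card (set C) \<le> 3" using psat unfolding three_partitioned_3sat_def by blast
  then show ?thesis using distinct_card[OF Cs(1)[OF C]] by simp
qed

lemma clause_variables:
  assumes "C \<in> clauses I" "l \<in> C" shows "var l \<in> variables I"
proof -
  have "var ` C \<subseteq> variables I"
    using psat assms(1) unfolding three_partitioned_3sat_def by blast
  with assms(2) show ?thesis by blast
qed

lemma occurs_iff:
  assumes "c < length Cs" "d < 3"
  shows "occurs w n m c r d i p \<longleftrightarrow> r < length (Cs ! c) \<and> i * m + p < n \<and> var (Cs ! c ! r) = part d ! (i * m + p)"
  using w_clause[OF assms(1)] w_part[OF assms(2)] by (auto simp: occurs_def)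

text \<open>Forwards, \<open>f j\<close> collects the bits of \<open>\<sigma>\<close> on block
  \<open>j\<close>. Backwards, the hub \<open>j\<close> and the position \<open>l\<close> that serve
  a clause may come from two different literals of it. Since \<open>block_lit\<close> puts both into
  the same part, these literals have the same variable, and \<open>f j\<close> makes the one that
  gave \<open>l\<close> true.\<close>

lemma satisfiable_iff_assignment:
  "satisfiable I \<longleftrightarrow> (\<exists>f. (\<forall>j<3 * m. f j < 2 ^ m) \<and>
     (\<forall>c<length Cs. \<exists>j<3 * m. \<exists>l<2 * (3 * m).
        clause_block w n m c j \<and> clause_lit w n m c l \<and> block_lit m j (f j) l))"
proof
  assume "satisfiable I"
  then obtain \<sigma> where \<sigma>: "\<And>C. C \<in> clauses I \<Longrightarrow> \<exists>l\<in>C. lit_true \<sigma> l"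
    by (auto simp: satisfiable_def)
  \<comment> \<open>For slots outside the part the list access has an unspecified value; these bits
    are not consulted below.\<close>
  have "\<exists>a<2 ^ m. \<forall>p<m. bit_of a p = (if \<sigma> (part (j div m) ! (j mod m * m + p)) then 1 else 0)" for j
    by (rule ex_bits)
  then obtain f where f: "\<And>j. f j < 2 ^ m"
    "\<And>j p. p < m \<Longrightarrow> bit_of (f j) p = (if \<sigma> (part (j div m) ! (j mod m * m + p)) then 1 else 0)"
    by metis
  have "\<exists>j<3 * m. \<exists>l<2 * (3 * m). clause_block w n m c j \<and> clause_lit w n m c l \<and> block_lit m j (f j) l"
    if c: "c < length Cs" for c
  proof -
    have mem: "Cs ! c \<in> set Cs" using c by simp
    with \<sigma> Cs(3) obtain r where r: "r < length (Cs ! c)" and true: "lit_true \<sigma> (Cs ! c ! r)"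
      by (metis image_eqI in_set_conv_nth list.set_map)
    let ?l = "Cs ! c ! r"
    have "var ?l \<in> variables I"
      using Cs(3) mem r by (intro clause_variables[of "set (Cs ! c)"]) auto
    then obtain d k where d: "d < 3" and k: "k < n" "part d ! k = var ?l"
      using part_props by (auto simp: variables_part in_set_conv_nth)
    define i where "i = k div m"
    define p where "p = k mod m"
    have ip: "i < m" "p < m" "k = i * m + p"
      using m k(1) by (auto simp: i_def p_def less_mult_imp_div_less)
    have occ: "occurs w n m c r d i p" using occurs_iff[OF c d] r k ip by simp
    have r3: "r < 3" using r length_clause[OF mem] by simp
    let ?j = "d * m + i" and ?L = "sign_of ?l * (3 * m) + (d * m + p)"
    have "?j < 3 * m" using d ip by (intro mixed_radix_less)
    moreover have "?L < 2 * (3 * m)" using d ip sign_of_less by (intro mixed_radix_less)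
    moreover have "clause_block w n m c ?j" unfolding clause_block_def using d ip r3 occ by blast
    moreover have "clause_lit w n m c ?L"
      unfolding clause_lit_def using d ip r3 occ w_clause(3)[OF c r] sign_of_less by metis
    moreover have "bit_of (f ?j) p = sign_of ?l"
      using f(2)[OF ip(2), of ?j] ip k true sign_of_less[of ?l] by (auto simp: lit_true_iff)
    then have "block_lit m ?j (f ?j) ?L"
      unfolding block_lit_def using d ip sign_of_less by blast
    ultimately show ?thesis by blast
  qed
  with f(1) show "\<exists>f. (\<forall>j<3 * m. f j < 2 ^ m) \<and>
     (\<forall>c<length Cs. \<exists>j<3 * m. \<exists>l<2 * (3 * m).
        clause_block w n m c j \<and> clause_lit w n m c l \<and> block_lit m j (f j) l)" by blast
next
  assume "\<exists>f. (\<forall>j<3 * m. f j < 2 ^ m) \<and>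
     (\<forall>c<length Cs. \<exists>j<3 * m. \<exists>l<2 * (3 * m).
        clause_block w n m c j \<and> clause_lit w n m c l \<and> block_lit m j (f j) l)"
  then obtain f where f: "\<And>c. c < length Cs \<Longrightarrow> \<exists>j<3 * m. \<exists>l<2 * (3 * m).
        clause_block w n m c j \<and> clause_lit w n m c l \<and> block_lit m j (f j) l" by blast
  define \<sigma> where "\<sigma> x \<longleftrightarrow> (\<exists>d<3. \<exists>i<m. \<exists>p<m. i * m + p < n \<and> x = part d ! (i * m + p) \<and>
     bit_of (f (d * m + i)) p = 1)" for x
  have \<sigma>: "\<sigma> (part d ! (i * m + p)) \<longleftrightarrow> bit_of (f (d * m + i)) p = 1"
    if d: "d < 3" "i < m" "p < m" "i * m + p < n" for d i p
  proof
    assume "\<sigma> (part d ! (i * m + p))"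
    then obtain d' i' p' where d': "d' < 3" "i' < m" "p' < m" "i' * m + p' < n"
      and eq: "part d ! (i * m + p) = part d' ! (i' * m + p')" and b: "bit_of (f (d' * m + i')) p' = 1"
      unfolding \<sigma>_def by blast
    have "part d ! (i * m + p) \<in> set (part d)" "part d' ! (i' * m + p') \<in> set (part d')"
      using part_props d d' by simp_all
    with part_disjoint[OF d(1) d'(1)] eq have "d = d'" by metis
    with eq have "i * m + p = i' * m + p'"
      using part_props[OF d(1)] d(4) d'(4) by (simp add: nth_eq_iff_index_eq)
    with mixed_radix_unique d d' have "i = i' \<and> p = p'" by blast
    with b \<open>d = d'\<close> show "bit_of (f (d * m + i)) p = 1" by simp
  qed (use d in \<open>unfold \<sigma>_def, blast\<close>)
  have "\<exists>l\<in>C. lit_true \<sigma> l" if "C \<in> clauses I" for C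
  proof -
    obtain c where c: "c < length Cs" and C: "C = set (Cs ! c)"
      using \<open>C \<in> clauses I\<close> Cs(3) by (metis image_iff in_set_conv_nth list.set_map)
    obtain j l where cb: "clause_block w n m c j" and ct: "clause_lit w n m c l" and bl: "block_lit m j (f j) l"
      using f[OF c] by blast
    obtain d i p r where 1: "d < 3" "i < m" "p < m" "j = d * m + i" "occurs w n m c r d i p"
      using cb unfolding clause_block_def by blast
    obtain d' i' p' r' where 2: "d' < 3" "i' < m" "p' < m" "occurs w n m c r' d' i' p'"
      "l = w (clause_pos w n c + 2 + 2 * r') * (3 * m) + (d' * m + p')"
      using ct unfolding clause_lit_def by blast
    obtain d'' i'' p'' s where 3: "d'' < 3" "i'' < m" "p'' < m" "s < 2" "j = d'' * m + i''"
      "l = s * (3 * m) + (d'' * m + p'')" "bit_of (f j) p'' = s"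
      using bl unfolding block_lit_def by blast
    \<comment> \<open>The number \<open>j\<close> identifies part and block of the literal that gave
      the hub; then \<open>l\<close> identifies part, position and sign of the literal that gave the
      position. So the two literals lie in the same part.\<close>
    have d: "d'' = d" "i'' = i" using mixed_radix_unique[of d'' m i'' d i] 1 3 by auto
    have "d' * m + p' < 3 * m" "d'' * m + p'' < 3 * m" using 2 3 by (simp_all add: mixed_radix_less)
    with 2(5) 3(6) have s: "s = w (clause_pos w n c + 2 + 2 * r')" and "d'' * m + p'' = d' * m + p'"
      using mixed_radix_unique[of s "3 * m" "d'' * m + p''"] by auto
    then have d': "d'' = d'" "p'' = p'" using mixed_radix_unique[of d'' m p'' d' p'] 2 3 by auto
    have o: "r < length (Cs ! c)" "i * m + p < n" "var (Cs ! c ! r) = part d ! (i * m + p)"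
      using 1(5) occurs_iff[OF c 1(1)] by auto
    have o': "r' < length (Cs ! c)" "i' * m + p' < n" "var (Cs ! c ! r') = part d ! (i' * m + p')"
      using 2(4) occurs_iff[OF c 2(1)] d d' by auto
    \<comment> \<open>Here the restriction on clauses closes the gap between the two
      literals.\<close>
    have "var (Cs ! c ! r) = var (Cs ! c ! r')"
      using c o o' 1(1) part_props[OF 1(1)] by (intro clause_part_unique[of "Cs ! c" _ _ d]) auto
    with o o' have "i * m + p = i' * m + p'"
      using part_props[OF 1(1)] by (simp add: nth_eq_iff_index_eq)
    then have ip: "i' = i" "p' = p" using mixed_radix_unique[of i m p i' p'] 1 2 by auto
    have "\<sigma> (var (Cs ! c ! r')) \<longleftrightarrow> bit_of (f j) p'' = 1"
      using \<sigma>[OF 1(1) 1(2) 1(3) o(2)] o' ip d d' 1(4) by simp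
    then have "lit_true \<sigma> (Cs ! c ! r')"
      using 3(7) s w_clause(3)[OF c o'(1)] by (simp add: lit_true_iff)
    then show ?thesis using o' C by (intro bexI[of _ "Cs ! c ! r'"]) auto
  qed
  then show "satisfiable I" unfolding satisfiable_def by blast
qed

text \<open>A clause occupies at most \<open>1 + 2 * 3 = 7\<close> numbers.\<close>

lemma length_input_le:
  "length (xs @ encode_list (\<lambda>x. [x]) ys @ encode_list (\<lambda>x. [x]) zs @ encode_list encode_clause Cs)
    \<le> 3 * n + 3 + 7 * length Cs"
proof -
  have "length (concat (map encode_clause Ds)) \<le> 7 * length Ds" if "set Ds \<subseteq> set Cs" for Ds
    using that
  proof (induction Ds)
    case (Cons D Ds)
    then have "length D \<le> 3" using length_clause by auto
    with Cons show ?case by (simp add: length_encode_clause)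
  qed simp
  from this[of Cs] show ?thesis by (simp add: encode_list_def lengths)
qed

text \<open>There are at most \<open>6 * n\<close> literals, and a clause is the set of a list of at
  most three of them; \<open>1 + u + u ^ 2 + u ^ 3\<close> is below \<open>(u + 1) ^ 3\<close>. As
  \<open>clauses\<close> is a set listed without repetition, this bounds the length of the input and
  the number of clause vertices.\<close>

lemma length_Cs_le: "length Cs \<le> (6 * n + 1) ^ 3"
proof -
  define U where "U = Pos ` variables I \<union> Neg ` variables I"
  have fin: "finite (variables I)" using psat by (simp add: three_partitioned_3sat_def)
  have "card (variables I) \<le> card (part_alpha I) + card (part_beta I) + card (part_gamma I)"
    unfolding variables_def by (intro order_trans[OF card_Un_le] add_mono card_Un_le le_refl)
  then have "card (variables I) \<le> 3 * n" using psat n by (auto simp: three_partitioned_3sat_def)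
  moreover have "card U \<le> 2 * card (variables I)"
    unfolding U_def using card_Un_le[of "Pos ` variables I" "Neg ` variables I"]
      card_image_le[OF fin, of Pos] card_image_le[OF fin, of Neg] by simp
  ultimately have U: "card U \<le> 6 * n" by simp
  have finU: "finite U" using fin by (simp add: U_def)
  have "clauses I \<subseteq> set ` {C. set C \<subseteq> U \<and> length C \<le> 3}"
  proof
    fix C assume C: "C \<in> clauses I"
    then obtain c where c: "c \<in> set Cs" "C = set c" using Cs(3) by auto
    moreover have "l \<in> U" if "l \<in> C" for l
    proof -
      have "var l \<in> variables I" using clause_variables C that by blast
      then show ?thesis by (cases l) (auto simp: U_def)
    qed
    ultimately show "C \<in> set ` {C. set C \<subseteq> U \<and> length C \<le> 3}" using length_clause by auto
  qed
  then have "card (clauses I) \<le> card {C. set C \<subseteq> U \<and> length C \<le> 3}"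
    using finite_lists_length_le[OF finU] by (meson card_image_le card_mono finite_imageI order_trans)
  also have "\<dots> = (\<Sum>i\<le>3. card U ^ i)" by (rule card_lists_length_le[OF finU])
  also have "\<dots> \<le> (card U + 1) ^ 3" by (simp add: eval_nat_numeral algebra_simps)
  also have "\<dots> \<le> (6 * n + 1) ^ 3" using U by (intro power_mono) auto
  finally show ?thesis using Cs(2,3) distinct_card[of "map set Cs"] by simp
qed

end

section \<open>Shortest paths\<close>

lemma vwalk_iff_successively:
  "vwalk p (with_proj G) \<longleftrightarrow>
     p \<noteq> [] \<and> set p \<subseteq> pverts G \<and> successively (\<lambda>u v. (u, v) \<in> parcs G) p"
proof -
  have "set (vwalk_arcs p) \<subseteq> parcs G \<longleftrightarrow> successively (\<lambda>u v. (u, v) \<in> parcs G) p"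
    by (induction p rule: vwalk_arcs.induct) auto
  then show ?thesis by (auto simp: vwalk_def)
qed

lemma length_vwalk_to_vpath_le: "length (vwalk_to_vpath p) \<le> length p"
proof (induction p rule: vwalk_to_vpath.induct)
  case (2 x xs)
  then show ?case
    using length_dropWhile_le[of "\<lambda>y. y \<noteq> x" xs] by (auto intro: le_SucI order_trans)
qed simp

lemma shortest_path_vwalk: "shortest_path G s p t \<Longrightarrow> vwalk p (with_proj G)"
  by (auto simp: shortest_path_def)

lemma shortest_path_distinct: "shortest_path G s p t \<Longrightarrow> distinct p"
  by (auto simp: shortest_path_def)

text \<open>The definition compares with paths only; cutting out closed parts of a walk extends the
  comparison to walks, which are easier to splice.\<close>

lemma shortest_path_length_le:
  assumes "shortest_path G s p t" "vwalk q (with_proj G)" "hd q = s" "last q = t"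
  shows "length p \<le> length q"
proof -
  let ?q = "vwalk_to_vpath q"
  have "vpath ?q (with_proj G) \<and> hd ?q = s \<and> last ?q = t"
    using assms vwalk_to_vpath_vpath by (auto simp: vwalk_to_vpath_hd vwalk_to_vpath_last)
  then have "length p - 1 \<le> length ?q - 1"
    using assms(1) by (auto simp: shortest_path_def)
  moreover have "q \<noteq> []" "p \<noteq> []"
    using assms(2) shortest_path_vwalk[OF assms(1)] by (auto simp: vwalk_def)
  ultimately show ?thesis
    using length_vwalk_to_vpath_le[of q] vwalk_to_vpath_nonempty[of q]
    by (cases p; cases ?q; cases q) auto
qed

lemma shortest_path_subwalk:
  assumes "shortest_path G s (p @ m @ q) t" "m \<noteq> []"
    and "vwalk m' (with_proj G)" "hd m' = hd m" "last m' = last m"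
  shows "length m \<le> length m'"
proof -
  have "vwalk (p @ m @ q) (with_proj G)" "hd (p @ m @ q) = s" "last (p @ m @ q) = t"
    using assms(1) by (auto simp: shortest_path_def)
  then have "vwalk (p @ m' @ q) (with_proj G)" "hd (p @ m' @ q) = s" "last (p @ m' @ q) = t"
    using assms(2-5) by (auto simp: vwalk_iff_successively successively_append_iff hd_append last_append
        split: if_splits)
  from shortest_path_length_le[OF assms(1) this] show ?thesis by simp
qed

lemma vwalk_potential:
  fixes \<phi> :: "'a \<Rightarrow> nat"
  assumes "vwalk p (with_proj G)" and "\<And>u v. (u, v) \<in> parcs G \<Longrightarrow> \<phi> v \<le> \<phi> u + 1"
  shows "\<phi> (last p) + 1 \<le> \<phi> (hd p) + length p"
  using assms(1)
proof (induction p rule: vwalk_arcs.induct)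
  case (3 x y xs)
  then have "vwalk (y # xs) (with_proj G)" and "(x, y) \<in> parcs G"
    by (auto simp: vwalk_iff_successively)
  with 3(1) assms(2)[of x y] show ?case by (simp split: if_splits)
qed (auto simp: vwalk_def)

text \<open>A potential that grows by at most 1 along each arc bounds the length of every walk from
  below by its gain, so a path that attains its gain is shortest. This replaces any computation of
  distances. \<open>length p\<close> counts vertices, hence the \<open>+ 1\<close>.\<close>

lemma shortest_pathI:
  fixes \<phi> :: "'a \<Rightarrow> nat"
  assumes "vwalk p (with_proj G)" "distinct p"
    and "\<And>u v. (u, v) \<in> parcs G \<Longrightarrow> \<phi> v \<le> \<phi> u + 1"
    and "\<phi> (hd p) + length p \<le> \<phi> (last p) + 1"
  shows "shortest_path G (hd p) p (last p)"
  unfolding shortest_path_def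
proof (intro conjI allI impI)
  show "vpath p (with_proj G)" using assms by auto
  fix q assume q: "vpath q (with_proj G) \<and> hd q = hd p \<and> last q = last p"
  with vwalk_potential[OF _ assms(3), of q] have "\<phi> (last p) + 1 \<le> \<phi> (hd p) + length q"
    by (auto simp: vpath_def)
  with assms(4) show "vwalk_length p \<le> vwalk_length q" by simp
qed auto

lemma vwalk_rev:
  assumes "sym (parcs G)" "vwalk p (with_proj G)" shows "vwalk (rev p) (with_proj G)"
proof -
  have "successively (\<lambda>u v. (v, u) \<in> parcs G) p"
    using assms unfolding vwalk_iff_successively
    by (auto elim!: successively_mono dest: symD)
  then show ?thesis using assms(2) by (simp add: vwalk_iff_successively successively_rev)
qed

lemma shortest_path_rev:
  assumes "sym (parcs G)" "shortest_path G s p t" shows "shortest_path G t (rev p) s"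
  unfolding shortest_path_def
proof (intro conjI allI impI)
  have p: "p \<noteq> []" using shortest_path_vwalk[OF assms(2)] by (auto simp: vwalk_def)
  show "vpath (rev p) (with_proj G)" "hd (rev p) = t" "last (rev p) = s"
    using assms vwalk_rev[OF assms(1), of p] p
    by (auto simp: shortest_path_def vpath_def hd_rev last_rev)
  fix q assume q: "vpath q (with_proj G) \<and> hd q = t \<and> last q = s"
  then have "vwalk (rev q) (with_proj G)" using vwalk_rev[OF assms(1)] by (auto simp: vpath_def)
  moreover have "q \<noteq> []" using q by (auto simp: vpath_def vwalk_def)
  ultimately show "vwalk_length (rev p) \<le> vwalk_length q"
    using shortest_path_length_le[OF assms(2), of "rev q"] q by (simp add: hd_rev last_rev)
qed

lemma shortest_path_interior:
  assumes "shortest_path G s p t" "u \<in> set p" "u \<noteq> s" "u \<noteq> t"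
  obtains p1 x y p2 where "p = p1 @ [x, u, y] @ p2" "x \<noteq> y" "(x, u) \<in> parcs G" "(u, y) \<in> parcs G"
proof -
  obtain q1 q2 where p: "p = q1 @ u # q2" using assms(2) by (auto simp: in_set_conv_decomp)
  have "q1 \<noteq> []" "q2 \<noteq> []" using assms p by (auto simp: shortest_path_def)
  then obtain p1 x y p2 where "q1 = p1 @ [x]" "q2 = y # p2"
    by (metis rev_exhaust list.exhaust)
  then have eq: "p = p1 @ [x, u, y] @ p2" using p by simp
  moreover have "successively (\<lambda>u v. (u, v) \<in> parcs G) p" "distinct p"
    using assms(1) by (auto simp: shortest_path_def vpath_def vwalk_iff_successively)
  ultimately show ?thesis
    by (intro that[OF eq]) (auto simp: successively_append_iff)
qed

lemma shortest_path_predecessor: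
  assumes "shortest_path G s (p @ u # q) t" "u \<noteq> s"
  obtains p' x where "p = p' @ [x]" "(x, u) \<in> parcs G"
proof -
  have "p \<noteq> []" using assms by (auto simp: shortest_path_def)
  then obtain p' x where p: "p = p' @ [x]" by (metis rev_exhaust)
  moreover have "(x, u) \<in> parcs G"
    using assms(1) p
    by (auto simp: shortest_path_def vpath_def vwalk_iff_successively successively_append_iff)
  ultimately show ?thesis using that by blast
qed

text \<open>An interior vertex of a path has two different neighbours, so a vertex with a single
  neighbour can only be an end.\<close>

lemma geodetic_set_pendant:
  assumes "geodetic_set G S" "sym (parcs G)" "u \<in> pverts G" and "\<And>x. (u, x) \<in> parcs G \<Longrightarrow> x = v"
  shows "u \<in> S"
proof (rule ccontr)
  assume "u \<notin> S"
  with assms(1,3) obtain s t p where sp: "shortest_path G s p t" "u \<in> set p" "u \<noteq> s" "u \<noteq> t"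
    unfolding geodetic_set_def by metis
  then show False
    by (rule shortest_path_interior) (metis assms(2,4) symD)
qed

section \<open>Transfer along an injective renaming of the vertices\<close>

definition map_graph :: "('a \<Rightarrow> 'b) \<Rightarrow> 'a pair_pre_digraph \<Rightarrow> 'b pair_pre_digraph" where
  "map_graph f G = \<lparr>pverts = f ` pverts G, parcs = map_prod f f ` parcs G\<rparr>"

lemma map_graph_simps [simp]:
  "pverts (map_graph f G) = f ` pverts G" "parcs (map_graph f G) = map_prod f f ` parcs G"
  by (simp_all add: map_graph_def)

lemma vwalk_map:
  "vwalk p (with_proj G) \<Longrightarrow> vwalk (map f p) (with_proj (map_graph f G))"
  by (auto simp: vwalk_iff_successively successively_map elim!: successively_mono)

lemma map_graph_inverse:
  assumes "pair_wf_digraph G" "inj_on f (pverts G)"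
  shows "map_graph (inv_into (pverts G) f) (map_graph f G) = G"
proof -
  interpret pair_wf_digraph G by fact
  have "map_prod (inv_into (pverts G) f) (inv_into (pverts G) f) (map_prod f f e) = e"
    if "e \<in> parcs G" for e
    using assms(2) that wellformed' by (cases e) auto
  then have "(\<lambda>e. map_prod (inv_into (pverts G) f) (inv_into (pverts G) f) (map_prod f f e)) ` parcs G
      = parcs G" by simp
  then show ?thesis using assms(2) by (simp add: map_graph_def image_image)
qed

lemma shortest_path_map:
  assumes "pair_wf_digraph G" "inj_on f (pverts G)" "shortest_path G s p t"
  shows "shortest_path (map_graph f G) (f s) (map f p) (f t)"
  unfolding shortest_path_def
proof (intro conjI allI impI)
  let ?g = "inv_into (pverts G) f"
  have p: "vwalk p (with_proj G)" "distinct p" "hd p = s" "last p = t" "p \<noteq> []" "set p \<subseteq> pverts G"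
    using assms(3) by (auto simp: shortest_path_def vpath_def vwalk_def)
  have "inj_on f (set p)" using assms(2) p(6) inj_on_subset by blast
  then show "vpath (map f p) (with_proj (map_graph f G))"
    using vwalk_map[OF p(1)] p(2) by (auto simp: vpath_def distinct_map)
  show "hd (map f p) = f s" "last (map f p) = f t" using p by (auto simp: hd_map last_map)
  fix q assume q: "vpath q (with_proj (map_graph f G)) \<and> hd q = f s \<and> last q = f t"
  then have "q \<noteq> []" by (auto simp: vpath_def vwalk_def)
  have "vwalk (map ?g q) (with_proj G)"
    using vwalk_map[of q "map_graph f G" ?g] q map_graph_inverse[OF assms(1,2)] by (auto simp: vpath_def)
  moreover have "s \<in> pverts G" "t \<in> pverts G" using p by auto
  ultimately show "vwalk_length (map f p) \<le> vwalk_length q"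
    using shortest_path_length_le[OF assms(3), of "map ?g q"] q \<open>q \<noteq> []\<close> assms(2)
    by (simp add: hd_map last_map)
qed

lemma geodetic_set_map:
  assumes "pair_wf_digraph G" "inj_on f (pverts G)" "geodetic_set G S"
  shows "geodetic_set (map_graph f G) (f ` S)"
  unfolding geodetic_set_def
proof (intro conjI ballI)
  show "f ` S \<subseteq> pverts (map_graph f G)" using assms(3) by (auto simp: geodetic_set_def)
  fix v assume "v \<in> pverts (map_graph f G)"
  then obtain u where u: "u \<in> pverts G" "v = f u" by auto
  with assms(3) obtain s t p where "s \<in> S" "t \<in> S" "shortest_path G s p t" "u \<in> set p"
    unfolding geodetic_set_def by metis
  with shortest_path_map[OF assms(1,2)] u
  show "\<exists>s\<^sub>1\<in>f ` S. \<exists>s\<^sub>2\<in>f ` S. \<exists>p. shortest_path (map_graph f G) s\<^sub>1 p s\<^sub>2 \<and> v \<in> set p"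
    by (intro bexI exI conjI) auto
qed

lemma pair_wf_digraph_map_graph: "pair_wf_digraph G \<Longrightarrow> pair_wf_digraph (map_graph f G)"
  by (auto simp: pair_wf_digraph_def)

lemma pair_graph_map_graph:
  assumes "pair_graph G" "inj_on f (pverts G)"
  shows "pair_graph (map_graph f G)"
proof -
  interpret pair_graph G by fact
  interpret m: pair_wf_digraph "map_graph f G" by (rule pair_wf_digraph_map_graph) unfold_locales
  have "symmetric (map_graph f G)"
    using arcs_symmetric by (fastforce simp: symmetric_def intro!: symI)
  moreover have "f u \<noteq> f v" if "(u, v) \<in> parcs G" for u v
    using that assms(2) wellformed' no_loops' by (metis inj_on_eq_iff)
  ultimately show ?thesis
    by unfold_locales (auto simp: pair_finite_verts pair_finite_arcs)
qed

text \<open>The graph is built on symbolic vertices, whereas the output numbers them. Both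
  directions come from \<open>geodetic_set_map\<close>, applied to \<open>f\<close> and to its
  inverse.\<close>

lemma geodetic_number_map_graph:
  assumes "pair_graph G" "inj_on f (pverts G)"
  shows "(\<exists>S. geodetic_set (map_graph f G) S \<and> card S \<le> k) \<longleftrightarrow> (\<exists>S. geodetic_set G S \<and> card S \<le> k)"
proof -
  interpret pair_graph G by fact
  have wf: "pair_wf_digraph G" ..
  have fin: "finite S" if "geodetic_set G S" for S
    using that finite_subset[OF _ pair_finite_verts] by (auto simp: geodetic_set_def)
  have fin': "finite S" if "geodetic_set (map_graph f G) S" for S
    using that pair_finite_verts finite_subset[of S "f ` pverts G"] by (auto simp: geodetic_set_def)
  have inj: "inj_on (inv_into (pverts G) f) (pverts (map_graph f G))"
    by (simp add: inj_on_inv_into)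
  have "geodetic_set G (inv_into (pverts G) f ` S)" if "geodetic_set (map_graph f G) S" for S
    using geodetic_set_map[OF pair_wf_digraph_map_graph[OF wf] inj that]
    by (simp add: map_graph_inverse[OF wf assms(2)])
  then have "\<exists>S. geodetic_set G S \<and> card S \<le> k"
    if "geodetic_set (map_graph f G) S" "card S \<le> k" for S
    using that card_image_le[OF fin'[OF that(1)], of "inv_into (pverts G) f"]
    by (intro exI[of _ "inv_into (pverts G) f ` S"]) auto
  moreover have "\<exists>S. geodetic_set (map_graph f G) S \<and> card S \<le> k"
    if "geodetic_set G S" "card S \<le> k" for S
    using that card_image_le[OF fin[OF that(1)], of f] geodetic_set_map[OF wf assms(2) that(1)]
    by (intro exI[of _ "f ` S"]) auto
  ultimately show ?thesis by blast
qed

lemma vertex_cover_number_le: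
  "vertex_cover G C \<Longrightarrow> vertex_cover_number G \<le> card C"
  unfolding vertex_cover_number_def by (auto intro: Least_le)

lemma vertex_cover_map_graph:
  assumes "pair_wf_digraph G" "inj_on f (pverts G)" "vertex_cover G C"
  shows "vertex_cover (map_graph f G) (f ` C)"
proof -
  interpret pair_wf_digraph G by fact
  have sub: "C \<subseteq> pverts G" and ind: "\<forall>u\<in>pverts G - C. \<forall>v\<in>pverts G - C. (u, v) \<notin> parcs G"
    using assms(3) by (simp_all add: vertex_cover_def independent_set_def)
  have "u \<in> C \<or> v \<in> C" if "(u, v) \<in> parcs G" for u v
    using that ind in_arcsD1[OF that] in_arcsD2[OF that] by blast
  then have "f u \<in> f ` C \<or> f v \<in> f ` C" if "(u, v) \<in> parcs G" for u v
    using that by blast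
  then have "(x, y) \<notin> parcs (map_graph f G)" if "x \<notin> f ` C" "y \<notin> f ` C" for x y
    using that by fastforce
  with sub show ?thesis
    by (simp add: vertex_cover_def independent_set_def image_mono)
qed

section \<open>Timed execution\<close>

text \<open>
  Registers are split modulo 3: variables of expressions, temporaries, and the stored input.
\<close>

definition vreg :: "nat \<Rightarrow> nat" where "vreg v = 3 * v"
definition treg :: "nat \<Rightarrow> nat" where "treg t = 3 * t + 1"
definition wreg :: "nat \<Rightarrow> nat" where "wreg i = 3 * i + 2"

lemma reg_eq_iff [simp]:
  "vreg v = vreg v' \<longleftrightarrow> v = v'" "treg t = treg t' \<longleftrightarrow> t = t'" "wreg i = wreg i' \<longleftrightarrow> i = i'"
  "vreg v \<noteq> treg t" "treg t \<noteq> vreg v" "vreg v \<noteq> wreg i" "wreg i \<noteq> vreg v"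
  "treg t \<noteq> wreg i" "wreg i \<noteq> treg t"
  by (simp_all add: vreg_def treg_def wreg_def) presburger+

text \<open>Total correctness with a time bound. The postcondition may itself be an
  \<open>ok\<close> statement, so programs are verified from left to right by nesting.\<close>

definition ok :: "com \<Rightarrow> state \<Rightarrow> nat \<Rightarrow> (state \<Rightarrow> bool) \<Rightarrow> bool" where
  "ok c s T Q \<longleftrightarrow> (\<exists>t s'. exec c s t s' \<and> t \<le> T \<and> Q s')"

lemma ok_Const: "Q (R(i := n), inp, out) \<Longrightarrow> ok (Const i n) (R, inp, out) 1 Q"
  and ok_Add: "Q (R(i := R j + R k), inp, out) \<Longrightarrow> ok (Add i j k) (R, inp, out) 1 Q"
  and ok_Sub: "Q (R(i := R j - R k), inp, out) \<Longrightarrow> ok (Sub i j k) (R, inp, out) 1 Q"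
  and ok_Load: "Q (R(i := R (R j)), inp, out) \<Longrightarrow> ok (Load i j) (R, inp, out) 1 Q"
  and ok_Store: "Q (R(R i := R j), inp, out) \<Longrightarrow> ok (Store i j) (R, inp, out) 1 Q"
  and ok_Read: "Q (R(i := (if inp = [] then 0 else hd inp)), tl inp, out) \<Longrightarrow> ok (Read i) (R, inp, out) 1 Q"
  and ok_Write: "Q (R, inp, out @ [R i]) \<Longrightarrow> ok (Write i) (R, inp, out) 1 Q"
  unfolding ok_def by (blast intro: exec.intros order_refl)+

lemma ok_mono: "ok c s T Q \<Longrightarrow> T \<le> T' \<Longrightarrow> (\<And>s. Q s \<Longrightarrow> Q' s) \<Longrightarrow> ok c s T' Q'"
  unfolding ok_def by (meson order_trans)

lemma ok_Seq: "ok c s T (\<lambda>s'. ok d s' T' Q) \<Longrightarrow> ok (Seq c d) s (T + T') Q"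
  unfolding ok_def by (meson exec.Seq add_mono)

lemma okI: "exec c s t s' \<Longrightarrow> t \<le> T \<Longrightarrow> Q s' \<Longrightarrow> ok c s T Q"
  unfolding ok_def by blast

lemma ok_Cond:
  assumes "fst s i > 0 \<Longrightarrow> ok c s T Q" and "fst s i = 0 \<Longrightarrow> ok d s T' Q"
  shows "ok (Cond i c d) s (T + T' + 1) Q"
proof (cases "fst s i = 0")
  case True
  with assms(2) obtain t s' where "exec d s t s'" "t \<le> T'" "Q s'" by (auto simp: ok_def)
  with True show ?thesis by (intro okI[of _ _ "t + 1" s'] exec.CondZero) auto
next
  case False
  with assms(1) obtain t s' where "exec c s t s'" "t \<le> T" "Q s'" by (auto simp: ok_def)
  with False show ?thesis by (intro okI[of _ _ "t + 1" s'] exec.CondPos) auto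
qed

text \<open>The register \<open>x\<close> is scratch space for the loop test, and \<open>treg 1\<close> must hold 1.\<close>
definition For :: "nat \<Rightarrow> nat \<Rightarrow> nat \<Rightarrow> com \<Rightarrow> com" where
  "For c l x b = Seq (Const c 0) (Seq (Sub x l c)
     (While x (Seq b (Seq (Add c c (treg 1)) (Sub x l c)))))"

lemma ok_While:
  assumes inv: "I 0 s"
    and zero: "\<And>s. I n s \<Longrightarrow> fst s x = 0"
    and pos: "\<And>k s. k < n \<Longrightarrow> I k s \<Longrightarrow> fst s x > 0"
    and step: "\<And>k s. k < n \<Longrightarrow> I k s \<Longrightarrow> ok b s T (I (Suc k))"
  shows "ok (While x b) s (n * (T + 1) + 1) (I n)"
proof -
  have "ok (While x b) s ((n - k) * (T + 1) + 1) (I n)" if "k \<le> n" "I k s" for k s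
    using that
  proof (induction "n - k" arbitrary: k s)
    case 0
    then show ?case using zero[of s] by (intro okI[of _ _ 1 s] exec.WhileZero) auto
  next
    case (Suc d)
    then have k: "k < n" "n - k = Suc (n - Suc k)" "d = n - Suc k" by auto
    obtain t s' where s': "exec b s t s'" "t \<le> T" "I (Suc k) s'"
      using step[OF k(1) Suc.prems(2)] by (auto simp: ok_def)
    obtain t' s'' where s'': "exec (While x b) s' t' s''" "t' \<le> (n - Suc k) * (T + 1) + 1" "I n s''"
      using Suc.hyps(1)[OF k(3) _ s'(3)] k by (auto simp: ok_def)
    have "exec (While x b) s (t + t' + 1) s''"
      using pos[OF k(1) Suc.prems(2)] s'(1) s''(1) by (rule exec.WhilePos)
    then show ?case using s'(2) s''(2,3) k(2)
      by (intro okI[of _ _ "t + t' + 1" s'']) auto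
  qed
  from this[of 0 s] inv show ?thesis by simp
qed

text \<open>A round costs the body plus three units for the increment, the subtraction and the test;
  the final 3 pays for the two initial instructions and the failing test. The \<open>frame\<close>
  premise allows the loop to overwrite its scratch register \<open>x\<close>.\<close>

lemma ok_For:
  assumes cx: "c \<noteq> x" "l \<noteq> c" "l \<noteq> x" "treg 1 \<noteq> c" "treg 1 \<noteq> x"
    and Rl: "R l = n" "R (treg 1) = 1"
    and init: "I 0 (R(c := 0), inp, out)"
    and frame: "\<And>k R inp out y. I k (R, inp, out) \<Longrightarrow> I k (R(x := y), inp, out)"
    and step: "\<And>k R inp out. k < n \<Longrightarrow> R c = k \<Longrightarrow> R l = n \<Longrightarrow> R (treg 1) = 1 \<Longrightarrow> I k (R, inp, out) \<Longrightarrow>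
      ok b (R, inp, out) T (\<lambda>(R', inp', out'). R' c = k \<and> R' l = n \<and> R' (treg 1) = 1 \<and>
        I (Suc k) (R'(c := Suc k), inp', out'))"
  shows "ok (For c l x b) (R, inp, out) (n * (T + 3) + 3) (\<lambda>(R, inp, out). R l = n \<and> R (treg 1) = 1 \<and> I n (R, inp, out))"
proof -
  let ?I = "\<lambda>k (R, inp, out). R c = k \<and> R l = n \<and> R (treg 1) = 1 \<and> R x = n - k \<and> I k (R, inp, out)"
  have "ok (Seq b (Seq (Add c c (treg 1)) (Sub x l c))) s (T + (1 + 1)) (?I (Suc k))"
    if "k < n" "?I k s" for k s
  proof -
    obtain R inp out where s: "s = (R, inp, out)" by (cases s) auto
    have "ok (Seq (Add c c (treg 1)) (Sub x l c)) (R', inp', out') (1 + 1) (?I (Suc k))"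
      if "R' c = k" "R' l = n" "R' (treg 1) = 1" "I (Suc k) (R'(c := Suc k), inp', out')" for R' inp' out'
      by (intro ok_Seq ok_Add ok_Sub) (use that cx frame in auto)
    moreover have "ok b (R, inp, out) T (\<lambda>(R', inp', out'). R' c = k \<and> R' l = n \<and> R' (treg 1) = 1 \<and>
        I (Suc k) (R'(c := Suc k), inp', out'))"
      using that by (intro step) (auto simp: s)
    ultimately show ?thesis
      unfolding s by (intro ok_Seq) (auto elim!: ok_mono)
  qed
  then have w: "ok (While x (Seq b (Seq (Add c c (treg 1)) (Sub x l c)))) s (n * ((T + (1 + 1)) + 1) + 1) (?I n)"
    if "?I 0 s" for s
    using that by (intro ok_While[of ?I]) (auto split: prod.splits)
  have "ok (For c l x b) (R, inp, out) (1 + (1 + (n * ((T + (1 + 1)) + 1) + 1))) (?I n)"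
    unfolding For_def
    by (intro ok_Seq ok_Const ok_Sub w) (use cx Rl init frame in auto)
  then show ?thesis by (rule ok_mono) (auto simp: distrib_left)
qed

section \<open>Bounded arithmetic expressions\<close>

text \<open>
  Iteration counts are capped at the bound \<open>M\<close>; hence the cost of an expression is a polynomial in \<open>M\<close>
  that does not depend on the values of the variables.
\<close>

datatype aexp = V nat | N nat | Bound | Plus aexp aexp | Minus aexp aexp | Inp aexp
  | If aexp aexp aexp | Iter nat aexp aexp aexp

primrec aval :: "nat \<Rightarrow> (nat \<Rightarrow> nat) \<Rightarrow> aexp \<Rightarrow> (nat \<Rightarrow> nat) \<Rightarrow> nat" where
  "aval M w (V x) \<rho> = \<rho> x"
| "aval M w (N n) \<rho> = n"
| "aval M w Bound \<rho> = M"
| "aval M w (Plus a b) \<rho> = aval M w a \<rho> + aval M w b \<rho>"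
| "aval M w (Minus a b) \<rho> = aval M w a \<rho> - aval M w b \<rho>"
| "aval M w (Inp a) \<rho> = w (aval M w a \<rho>)"
| "aval M w (If a b c) \<rho> = (if aval M w a \<rho> > 0 then aval M w b \<rho> else aval M w c \<rho>)"
| "aval M w (Iter x a b c) \<rho> = ((\<lambda>y. aval M w c (\<rho>(x := y))) ^^ min (aval M w a \<rho>) M) (aval M w b \<rho>)"

abbreviation Move :: "nat \<Rightarrow> nat \<Rightarrow> com" where "Move i j \<equiv> Add i j (treg 0)"

fun seqs :: "com list \<Rightarrow> com" where
  "seqs [] = Skip"
| "seqs [c] = c"
| "seqs (c # cs) = Seq c (seqs cs)"

text \<open>The registers \<open>treg 0\<close>, \<open>treg 1\<close> and \<open>treg 2\<close> hold 0, 1 and the bound.\<close>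
primrec compile :: "nat \<Rightarrow> aexp \<Rightarrow> com" where
  "compile t (V x) = Move (treg t) (vreg x)"
| "compile t (N n) = Const (treg t) n"
| "compile t Bound = Move (treg t) (treg 2)"
| "compile t (Plus a b) = seqs [compile t a, compile (Suc t) b, Add (treg t) (treg t) (treg (Suc t))]"
| "compile t (Minus a b) = seqs [compile t a, compile (Suc t) b, Sub (treg t) (treg t) (treg (Suc t))]"
| "compile t (Inp a) = seqs [compile t a, Add (treg (Suc t)) (treg t) (treg t),
     Add (treg t) (treg t) (treg (Suc t)), Add (treg t) (treg t) (treg 1), Add (treg t) (treg t) (treg 1),
     Load (treg t) (treg t)]"
| "compile t (If a b c) = Seq (compile t a) (Cond (treg t) (compile t b) (compile t c))"
| "compile t (Iter x a b c) = seqs [Move (treg t) (vreg x),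
     compile (t + 1) a, Sub (treg (t + 2)) (treg (t + 1)) (treg 2),
     Sub (treg (t + 1)) (treg (t + 1)) (treg (t + 2)),
     compile (t + 2) b, Move (vreg x) (treg (t + 2)),
     For (treg (t + 2)) (treg (t + 1)) (treg (t + 3)) (Seq (compile (t + 4) c) (Move (vreg x) (treg (t + 4)))),
     Move (treg (t + 1)) (vreg x), Move (vreg x) (treg t), Move (treg t) (treg (t + 1))]"

primrec cost :: "nat \<Rightarrow> aexp \<Rightarrow> nat" where
  "cost M (V x) = 1"
| "cost M (N n) = 1"
| "cost M Bound = 1"
| "cost M (Plus a b) = cost M a + cost M b + 1"
| "cost M (Minus a b) = cost M a + cost M b + 1"
| "cost M (Inp a) = cost M a + 5"
| "cost M (If a b c) = cost M a + (cost M b + cost M c + 1)"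
| "cost M (Iter x a b c) = cost M a + cost M b + M * (cost M c + 4) + 10"

definition polynomial :: "(nat \<Rightarrow> nat) \<Rightarrow> bool" where
  "polynomial f \<longleftrightarrow> (\<exists>C d. \<forall>M. f M \<le> C * (M + 1) ^ d)"

lemma polynomial_const: "polynomial (\<lambda>_. c)"
  unfolding polynomial_def by (rule exI[of _ c], rule exI[of _ 0]) simp

lemma polynomial_add:
  assumes "polynomial f" "polynomial g"
  shows "polynomial (\<lambda>M. f M + g M)"
proof -
  from assms obtain C d C' d' where *: "\<And>M. f M \<le> C * (M + 1) ^ d" "\<And>M. g M \<le> C' * (M + 1) ^ d'"
    unfolding polynomial_def by blast
  have "f M + g M \<le> (C + C') * (M + 1) ^ (d + d')" for M
  proof -
    have "C * (M + 1) ^ d \<le> C * (M + 1) ^ (d + d')" "C' * (M + 1) ^ d' \<le> C' * (M + 1) ^ (d + d')"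
      by (intro mult_left_mono power_increasing; simp)+
    with *[of M] have "f M + g M \<le> C * (M + 1) ^ (d + d') + C' * (M + 1) ^ (d + d')" by linarith
    then show ?thesis by (simp only: distrib_right)
  qed
  then show ?thesis unfolding polynomial_def by blast
qed

lemma polynomial_times:
  assumes "polynomial f"
  shows "polynomial (\<lambda>M. M * f M)"
proof -
  from assms obtain C d where "\<And>M. f M \<le> C * (M + 1) ^ d" unfolding polynomial_def by blast
  then have "M * f M \<le> (M + 1) * (C * (M + 1) ^ d)" for M
    by (intro mult_le_mono) auto
  then have "M * f M \<le> C * (M + 1) ^ Suc d" for M
    by (simp add: mult.left_commute)
  then show ?thesis unfolding polynomial_def by blast
qed

lemma polynomial_cost: "polynomial (\<lambda>M. cost M e)"
  by (induction e) (simp only: cost.simps, intro polynomial_add polynomial_const polynomial_times; assumption?)+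

section \<open>Correctness of the compiled expressions\<close>

definition std :: "nat \<Rightarrow> (nat \<Rightarrow> nat) \<Rightarrow> bool" where
  "std M R \<longleftrightarrow> R (treg 0) = 0 \<and> R (treg 1) = 1 \<and> R (treg 2) = M"

text \<open>The temporaries form a stack: evaluation at level \<open>t\<close> may use
  \<open>treg t\<close> and everything above it.\<close>

definition unchanged :: "nat \<Rightarrow> (nat \<Rightarrow> nat) \<Rightarrow> (nat \<Rightarrow> nat) \<Rightarrow> bool" where
  "unchanged t R R' \<longleftrightarrow> (\<forall>x. R' (vreg x) = R (vreg x)) \<and> (\<forall>i. R' (wreg i) = R (wreg i)) \<and>
     (\<forall>k<t. R' (treg k) = R (treg k))"

definition vars :: "(nat \<Rightarrow> nat) \<Rightarrow> nat \<Rightarrow> nat" where "vars R x = R (vreg x)"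
definition input :: "(nat \<Rightarrow> nat) \<Rightarrow> nat \<Rightarrow> nat" where "input R i = R (wreg i)"

lemma unchanged_std: "unchanged t R R' \<Longrightarrow> 3 \<le> t \<Longrightarrow> std M R \<Longrightarrow> std M R'"
  by (auto simp: unchanged_def std_def)

lemma unchanged_input: "unchanged t R R' \<Longrightarrow> input R' = input R"
  and unchanged_vars: "unchanged t R R' \<Longrightarrow> vars R' = vars R"
  by (auto simp: unchanged_def input_def vars_def)

lemma unchanged_mono: "unchanged t R R' \<Longrightarrow> s \<le> t \<Longrightarrow> unchanged s R R'"
  and unchanged_trans: "unchanged t R R' \<Longrightarrow> unchanged t R' R'' \<Longrightarrow> unchanged t R R''"
  and unchanged_refl [simp]: "unchanged t R R"
  and unchanged_upd: "unchanged t R R' \<Longrightarrow> t \<le> k \<Longrightarrow> unchanged t R (R'(treg k := y))"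
  by (auto simp: unchanged_def)

lemma ok_le: "ok c s T Q \<Longrightarrow> T \<le> T' \<Longrightarrow> ok c s T' Q"
  by (rule ok_mono)

lemma vars_upd_vreg [simp]: "vars (R(vreg x := y)) = (vars R)(x := y)"
  and vars_upd_treg [simp]: "vars (R(treg t := y)) = vars R"
  and input_upd_vreg [simp]: "input (R(vreg x := y)) = input R"
  and input_upd_treg [simp]: "input (R(treg t := y)) = input R"
  by (auto simp: vars_def input_def)

lemma std_upd [simp]: "std M (R(vreg x := y)) \<longleftrightarrow> std M R" "3 \<le> t \<Longrightarrow> std M (R(treg t := y)) \<longleftrightarrow> std M R"
  by (auto simp: std_def)

text \<open>Induction over the expression, with \<open>t\<close> as the stack level of the result.
  In the case \<open>Iter\<close> the bound variable lives in its own register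
  \<open>vreg x\<close>: its old value is saved in \<open>treg t\<close>, the rounds overwrite it,
  and it is restored at the end, so that variables appear untouched from outside.\<close>

lemma compile_correct:
  assumes "3 \<le> t" "std M R"
    and "\<And>R'. unchanged t R R' \<Longrightarrow> R' (treg t) = aval M (input R) e (vars R) \<Longrightarrow> Q (R', inp, out)"
  shows "ok (compile t e) (R, inp, out) (cost M e) Q"
  using assms
proof (induction e arbitrary: t R Q)
  case (V x)
  show ?case using V(2)
    by (auto simp: std_def vars_def intro!: ok_Add[simplified] V(3) unchanged_upd)
next
  case (N n)
  show ?case by (auto intro!: ok_Const[simplified] N(3) unchanged_upd)
next
  case Bound
  show ?case using Bound(2)
    by (auto simp: std_def intro!: ok_Add[simplified] Bound(3) unchanged_upd)
next
  case (Plus a b)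
  have "ok (compile t (Plus a b)) (R, inp, out) (cost M a + (cost M b + 1)) Q"
    unfolding compile.simps seqs.simps
  proof (intro ok_Seq Plus.IH(1)[OF Plus.prems(1,2)])
    fix R' assume 1: "unchanged t R R'" "R' (treg t) = aval M (input R) a (vars R)"
    show "ok (compile (Suc t) b) (R', inp, out) (cost M b)
       (\<lambda>s'. ok (Add (treg t) (treg t) (treg (Suc t))) s' 1 Q)"
    proof (rule Plus.IH(2))
      show "3 \<le> Suc t" "std M R'" using Plus.prems(1,2) unchanged_std[OF 1(1)] by auto
      fix R'' assume 2: "unchanged (Suc t) R' R''" "R'' (treg (Suc t)) = aval M (input R') b (vars R')"
      have "R'' (treg t) = R' (treg t)" using 2(1) by (simp add: unchanged_def)
      moreover have "unchanged t R R''" using 1(1) 2(1) by (simp add: unchanged_def)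
      ultimately show "ok (Add (treg t) (treg t) (treg (Suc t))) (R'', inp, out) 1 Q"
        by (intro ok_Add Plus.prems(3) unchanged_upd)
          (use 1 2 in \<open>auto simp: unchanged_input[OF 1(1)] unchanged_vars[OF 1(1)]\<close>)
    qed
  qed
  then show ?case by (rule ok_le) simp
next
  case (Minus a b)
  have "ok (compile t (Minus a b)) (R, inp, out) (cost M a + (cost M b + 1)) Q"
    unfolding compile.simps seqs.simps
  proof (intro ok_Seq Minus.IH(1)[OF Minus.prems(1,2)])
    fix R' assume 1: "unchanged t R R'" "R' (treg t) = aval M (input R) a (vars R)"
    show "ok (compile (Suc t) b) (R', inp, out) (cost M b)
       (\<lambda>s'. ok (Sub (treg t) (treg t) (treg (Suc t))) s' 1 Q)"
    proof (rule Minus.IH(2))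
      show "3 \<le> Suc t" "std M R'" using Minus.prems(1,2) unchanged_std[OF 1(1)] by auto
      fix R'' assume 2: "unchanged (Suc t) R' R''" "R'' (treg (Suc t)) = aval M (input R') b (vars R')"
      have "R'' (treg t) = R' (treg t)" using 2(1) by (simp add: unchanged_def)
      moreover have "unchanged t R R''" using 1(1) 2(1) by (simp add: unchanged_def)
      ultimately show "ok (Sub (treg t) (treg t) (treg (Suc t))) (R'', inp, out) 1 Q"
        by (intro ok_Sub Minus.prems(3) unchanged_upd)
          (use 1 2 in \<open>auto simp: unchanged_input[OF 1(1)] unchanged_vars[OF 1(1)]\<close>)
    qed
  qed
  then show ?case by (rule ok_le) simp
next
  case (Inp a)
  have "ok (compile t (Inp a)) (R, inp, out) (cost M a + (1 + (1 + (1 + (1 + 1))))) Q"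
    unfolding compile.simps seqs.simps
  proof (rule ok_Seq, rule Inp.IH[OF Inp.prems(1,2)])
    fix R' assume 1: "unchanged t R R'" "R' (treg t) = aval M (input R) a (vars R)"
    define v where "v = aval M (input R) a (vars R)"
    have v: "R' (treg t) = v" using 1(2) by (simp add: v_def)
    have one: "R' (treg (Suc 0)) = 1" using 1(1) Inp.prems(1,2) by (auto simp: unchanged_def std_def)
    \<comment> \<open>The address \<open>3 * v + 2\<close> of the stored input is assembled by
      additions, as the machine cannot multiply.\<close>
    have idx: "Suc (Suc (v + (v + v))) = wreg v" by (simp add: wreg_def)
    have inp: "R' (wreg i) = input R i" for i using 1(1) by (simp add: unchanged_def input_def)
    have t: "t \<noteq> 0" "t \<noteq> Suc 0" using Inp.prems(1) by simp_all
    have "Q (R'(treg (Suc t) := v + v, treg t := input R v), inp, out)"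
      by (intro Inp.prems(3) unchanged_upd 1(1)) (simp_all add: v_def)
    then show "ok (Seq (Add (treg (Suc t)) (treg t) (treg t)) (Seq (Add (treg t) (treg t) (treg (Suc t)))
       (Seq (Add (treg t) (treg t) (treg 1)) (Seq (Add (treg t) (treg t) (treg 1)) (Load (treg t) (treg t))))))
       (R', inp, out) (1 + (1 + (1 + (1 + 1)))) Q"
      by (intro ok_Seq ok_Add ok_Load) (simp add: v one idx inp t t(2)[symmetric])
  qed
  then show ?case by (rule ok_le) simp
next
  case (If a b c)
  show ?case
    unfolding compile.simps cost.simps
  proof (intro ok_Seq If.IH(1)[OF If.prems(1,2)] ok_Cond)
    fix R' assume 1: "unchanged t R R'" "R' (treg t) = aval M (input R) a (vars R)"
    note eqs = unchanged_input[OF 1(1)] unchanged_vars[OF 1(1)]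
    show "ok (compile t b) (R', inp, out) (cost M b) Q" if "fst (R', inp, out) (treg t) > 0"
      using 1 that If.prems(1) unchanged_std[OF 1(1) If.prems(1,2)]
      by (intro If.IH(2) If.prems(3)) (auto simp: eqs intro: unchanged_trans)
    show "ok (compile t c) (R', inp, out) (cost M c) Q" if "fst (R', inp, out) (treg t) = 0"
      using 1 that If.prems(1) unchanged_std[OF 1(1) If.prems(1,2)]
      by (intro If.IH(3) If.prems(3)) (auto simp: eqs intro: unchanged_trans)
  qed
next
  case (Iter x a b c)
  let ?v = "aval M (input R) a (vars R)" and ?z = "aval M (input R) b (vars R)"
  let ?f = "\<lambda>y. aval M (input R) c ((vars R)(x := y))"
  define n where "n = min ?v M"
  \<comment> \<open>After \<open>k\<close> rounds the registers agree with the initial ones up to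
    level \<open>t\<close>, except for the saved value in \<open>treg t\<close> and the
    \<open>k\<close>-th iterate in \<open>vreg x\<close>; the temporaries above are free.\<close>
  define I where "I = (\<lambda>k (R', inp', out'). inp' = inp \<and> out' = out \<and>
     unchanged (t + 1) (R(treg t := R (vreg x), vreg x := (?f ^^ k) ?z)) R')"
  let ?R1 = "R(treg t := R (vreg x))"
  have "ok (compile t (Iter x a b c)) (R, inp, out)
    (1 + (cost M a + (1 + (1 + (cost M b + (1 + ((n * ((cost M c + 1) + 3) + 3) + (1 + (1 + 1))))))))) Q"
    unfolding compile.simps seqs.simps
  proof (rule ok_Seq, rule ok_Add, rule ok_Seq, rule Iter.IH(1))
    have R1: "R(treg t := R (vreg x) + R (treg 0)) = ?R1" using Iter.prems(2) by (simp add: std_def)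
    show "3 \<le> t + 1" "std M (R(treg t := R (vreg x) + R (treg 0)))"
      using Iter.prems by auto
    fix R2 assume 2: "unchanged (t + 1) (R(treg t := R (vreg x) + R (treg 0))) R2"
      and v: "R2 (treg (t + 1)) = aval M (input (R(treg t := R (vreg x) + R (treg 0)))) a (vars (R(treg t := R (vreg x) + R (treg 0))))"
    have v': "R2 (treg (t + 1)) = ?v" using v by simp
    have std2: "std M R2" using unchanged_std[OF 2] Iter.prems by simp
    \<comment> \<open>With truncated subtraction this is the minimum of \<open>?v\<close> and
      \<open>M\<close>, which caps the number of rounds.\<close>
    have n: "?v - (?v - M) = n" unfolding n_def by simp
    define R3 where "R3 = R2(treg (t + 2) := ?v - M, treg (t + 1) := n)"
    have R3: "unchanged (t + 1) ?R1 R3" "R3 (treg (t + 1)) = n" "std M R3"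
      using 2 std2 Iter.prems(1) by (auto simp: R3_def R1 intro!: unchanged_upd)
    have R3': "(R2(treg (t + 2) := R2 (treg (t + 1)) - R2 (treg 2)))
       (treg (t + 1) := (R2(treg (t + 2) := R2 (treg (t + 1)) - R2 (treg 2))) (treg (t + 1)) -
         (R2(treg (t + 2) := R2 (treg (t + 1)) - R2 (treg 2))) (treg (t + 2))) = R3"
      using std2 n by (simp add: R3_def v'[simplified] std_def)
    show "ok (Seq (Sub (treg (t + 2)) (treg (t + 1)) (treg 2))
          (Seq (Sub (treg (t + 1)) (treg (t + 1)) (treg (t + 2)))
          (Seq (compile (t + 2) b)
          (Seq (Move (vreg x) (treg (t + 2)))
          (Seq (For (treg (t + 2)) (treg (t + 1)) (treg (t + 3)) (Seq (compile (t + 4) c) (Move (vreg x) (treg (t + 4)))))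
          (Seq (Move (treg (t + 1)) (vreg x))
          (Seq (Move (vreg x) (treg t)) (Move (treg t) (treg (t + 1))))))))))
          (R2, inp, out) (1 + (1 + (cost M b + (1 + ((n * ((cost M c + 1) + 3) + 3) + (1 + (1 + 1))))))) Q"
    proof (rule ok_Seq, rule ok_Sub, rule ok_Seq, rule ok_Sub, rule ok_Seq, unfold R3', rule Iter.IH(2))
      show "3 \<le> t + 2" "std M R3" using Iter.prems R3 by auto
      fix R4 assume 4: "unchanged (t + 2) R3 R4" and z: "R4 (treg (t + 2)) = aval M (input R3) b (vars R3)"
      have z': "R4 (treg (t + 2)) = ?z"
        using z unchanged_input[OF R3(1)] unchanged_vars[OF R3(1)] by simp
      have std4: "std M R4" using unchanged_std[OF 4] R3(3) Iter.prems by simp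
      have un4: "unchanged (t + 1) ?R1 R4"
        using R3(1) unchanged_mono[OF 4, of "t + 1"] by (auto intro: unchanged_trans)
      have n4: "R4 (treg (t + 1)) = n" using 4 R3(2) by (simp add: unchanged_def)
      have I: "I k (R', i, o') \<longleftrightarrow> i = inp \<and> o' = out \<and> unchanged (t + 1) (?R1(vreg x := (?f ^^ k) ?z)) R'"
        for k R' i o' by (simp add: I_def)
      show "ok (Seq (Move (vreg x) (treg (t + 2)))
          (Seq (For (treg (t + 2)) (treg (t + 1)) (treg (t + 3)) (Seq (compile (t + 4) c) (Move (vreg x) (treg (t + 4)))))
          (Seq (Move (treg (t + 1)) (vreg x))
          (Seq (Move (vreg x) (treg t)) (Move (treg t) (treg (t + 1)))))))
          (R4, inp, out) (1 + ((n * ((cost M c + 1) + 3) + 3) + (1 + (1 + 1)))) Q"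
      proof (rule ok_Seq, rule ok_Add, rule ok_Seq, rule ok_mono[OF ok_For[where I = I and n = n] order_refl])
        show "I 0 ((R4(vreg x := R4 (treg (t + 2)) + R4 (treg 0)))(treg (t + 2) := 0), inp, out)"
          using un4 z' std4 by (auto simp: I std_def unchanged_def)
        show "I k (R'(treg (t + 3) := y), i, o')" if "I k (R', i, o')" for k R' i o' y
          using that by (auto simp: I intro!: unchanged_upd)
        show "ok (Seq (compile (t + 4) c) (Move (vreg x) (treg (t + 4)))) (R', i, o') (cost M c + 1)
          (\<lambda>(R'', inp', out'). R'' (treg (t + 2)) = k \<and> R'' (treg (t + 1)) = n \<and> R'' (treg 1) = 1 \<and>
             I (Suc k) (R''(treg (t + 2) := Suc k), inp', out'))"
          if "k < n" "R' (treg (t + 2)) = k" "R' (treg (t + 1)) = n" "R' (treg 1) = 1" "I k (R', i, o')"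
          for k R' i o'
        proof -
          have un: "unchanged (t + 1) (?R1(vreg x := (?f ^^ k) ?z)) R'" and io: "i = inp" "o' = out"
            using that(5) by (simp_all add: I)
          show ?thesis unfolding io
          proof (rule ok_Seq, rule Iter.IH(3))
            show "3 \<le> t + 4" using Iter.prems by simp
            show std': "std M R'" using unchanged_std[OF un] Iter.prems by simp
            fix R'' assume un': "unchanged (t + 4) R' R''" and "R'' (treg (t + 4)) = aval M (input R') c (vars R')"
            then have c: "R'' (treg (t + 4)) = (?f ^^ Suc k) ?z"
              using unchanged_input[OF un] unchanged_vars[OF un] by simp
            have "R'' (treg 0) = 0" "R'' (treg 1) = 1"
              using unchanged_std[OF un' _ std'] Iter.prems by (simp_all add: std_def)
            moreover have "R'' (treg (t + 2)) = k" "R'' (treg (t + 1)) = n"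
              using un' that by (simp_all add: unchanged_def)
            ultimately show "ok (Move (vreg x) (treg (t + 4))) (R'', inp, out) 1
              (\<lambda>(R'', inp', out'). R'' (treg (t + 2)) = k \<and> R'' (treg (t + 1)) = n \<and> R'' (treg 1) = 1 \<and>
                 I (Suc k) (R''(treg (t + 2) := Suc k), inp', out'))"
              using un un' c by (intro ok_Add) (auto simp: I unchanged_def)
          qed
        qed
        fix s assume "case s of (R', inp', out') \<Rightarrow> R' (treg (t + 1)) = n \<and> R' (treg 1) = 1 \<and> I n (R', inp', out')"
        then obtain R5 where s: "s = (R5, inp, out)" and R5: "unchanged (t + 1) (?R1(vreg x := (?f ^^ n) ?z)) R5"
          by (auto simp: I)
        have std5: "R5 (treg 0) = 0" using unchanged_std[OF R5] Iter.prems by (simp add: std_def)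
        have "R5 (vreg x) = (?f ^^ n) ?z" "R5 (treg t) = R (vreg x)"
          using R5 by (auto simp: unchanged_def)
        then show "ok (Seq (Move (treg (t + 1)) (vreg x))
          (Seq (Move (vreg x) (treg t)) (Move (treg t) (treg (t + 1))))) s (1 + (1 + 1)) Q"
          unfolding s using R5 std5 Iter.prems(1)
          by (intro ok_Seq ok_Add Iter.prems(3)) (auto simp: unchanged_def n_def)
      qed (use n4 std4 Iter.prems in \<open>auto simp: std_def\<close>)
    qed
  qed
  moreover have "n * (cost M c + 4) \<le> M * (cost M c + 4)" unfolding n_def by (intro mult_right_mono) auto
  then have "1 + (cost M a + (1 + (1 + (cost M b + (1 + ((n * ((cost M c + 1) + 3) + 3) + (1 + (1 + 1)))))))) \<le> cost M (Iter x a b c)"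
  proof -
    assume "n * (cost M c + 4) \<le> M * (cost M c + 4)"
    moreover have "cost M c + 1 + 3 = cost M c + 4" by simp
    ultimately show ?thesis by (simp only: cost.simps)
  qed
  ultimately show ?case by (rule ok_le)
qed

section \<open>The graph\<close>

text \<open>
  \<open>A j a\<close> is assignment \<open>a\<close> of block \<open>j\<close>, \<open>T l\<close> a literal position, \<open>CL c\<close> a clause, and \<open>D j\<close> a guard
  that forces a choice in block \<open>j\<close>. The pendant vertices \<open>SZ\<close>, \<open>YP e\<close> and \<open>S j\<close> belong to every
  geodetic set. All \<open>A j a\<close> have distance 4 from \<open>S j\<close>, while the \<open>Q i\<close> provide the shortcut of length 3
  from \<open>A i a\<close> to \<open>S j\<close> for \<open>i \<noteq> j\<close>; so a clause vertex lies on a shortest path to \<open>S j\<close> only if block \<open>j\<close>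
  contains one of its variables.
\<close>

datatype vertex =
    Z | SZ | Y bool | YP bool
  | B nat | S nat | Q nat | H nat | D nat
  | T nat
  | A nat nat
  | CL nat

text \<open>\<open>q\<close> blocks with \<open>P\<close> assignments each, \<open>K\<close> literal
  positions and \<open>L\<close> clauses; \<open>sat\<close> relates assignments to positions,
  \<open>cb\<close> and \<open>ct\<close> relate clauses to blocks and positions.
  \<open>q_ge_2\<close> provides, for each block \<open>j\<close>, assignment vertices of another
  block, which are adjacent to \<open>Q j\<close>.\<close>

locale gadget =
  fixes q P K L :: nat
    and sat :: "nat \<Rightarrow> nat \<Rightarrow> nat \<Rightarrow> bool"
    and cb ct :: "nat \<Rightarrow> nat \<Rightarrow> bool"
  assumes q_ge_2: "2 \<le> q"
    and ex_lit: "\<And>j a. j < q \<Longrightarrow> a < P \<Longrightarrow> \<exists>l<K. sat j a l"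
    and ex_assignment: "\<And>l. l < K \<Longrightarrow> \<exists>j<q. \<exists>a<P. sat j a l"
    and P_pos: "0 < P"
begin

primrec valid :: "vertex \<Rightarrow> bool" where
  "valid Z = True"
| "valid SZ = True"
| "valid (Y e) = True"
| "valid (YP e) = True"
| "valid (B j) = (j < q)"
| "valid (S j) = (j < q)"
| "valid (Q j) = (j < q)"
| "valid (H j) = (j < q)"
| "valid (D j) = (j < q)"
| "valid (T l) = (l < K)"
| "valid (A j a) = (j < q \<and> a < P)"
| "valid (CL i) = (i < L)"

text \<open>Each edge is listed from one end only. The two vertices \<open>Y e\<close> put every
  assignment vertex on a shortest path between the two \<open>YP e\<close>, so the unselected ones
  are covered for free, and they keep any two assignment vertices at distance at most 2.
  \<open>Z\<close> plays a similar role for hubs, guards, literals and clauses.\<close>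

primrec arc :: "vertex \<Rightarrow> vertex \<Rightarrow> bool" where
  "arc Z v = (v = SZ)"
| "arc SZ v = False"
| "arc (Y e) v = (v = YP e)"
| "arc (YP e) v = False"
| "arc (B j) v = (v = Z \<or> v = S j \<or> v = Q j \<or> v = D j \<or> (\<exists>i. i \<noteq> j \<and> v = B i))"
| "arc (S j) v = False"
| "arc (Q j) v = False"
| "arc (H j) v = False"
| "arc (D j) v = (v = Z \<or> v = H j)"
| "arc (T l) v = (v = Z)"
| "arc (A j a) v = ((\<exists>e. v = Y e) \<or> v = H j \<or> (\<exists>i. i \<noteq> j \<and> v = Q i) \<or> (\<exists>l. v = T l \<and> sat j a l))"
| "arc (CL c) v = (v = Z \<or> (\<exists>j. v = B j \<and> cb c j) \<or> (\<exists>l. v = T l \<and> ct c l))"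

definition adj :: "vertex \<Rightarrow> vertex \<Rightarrow> bool" where
  "adj u v \<longleftrightarrow> arc u v \<or> arc v u"

definition G :: "vertex pair_pre_digraph" where
  "G = \<lparr>pverts = Collect valid, parcs = {(u, v). valid u \<and> valid v \<and> adj u v}\<rparr>"

lemma pverts_G [simp]: "v \<in> pverts G \<longleftrightarrow> valid v"
  and parcs_G [simp]: "(u, v) \<in> parcs G \<longleftrightarrow> valid u \<and> valid v \<and> adj u v"
  by (simp_all add: G_def)

lemma sym_G: "sym (parcs G)"
  by (auto simp: adj_def intro: symI)

lemma adj_simps [simp]:
  "adj Z v \<longleftrightarrow> v = SZ \<or> (\<exists>j. v = B j) \<or> (\<exists>j. v = D j) \<or> (\<exists>l. v = T l) \<or> (\<exists>c. v = CL c)"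
  "adj SZ v \<longleftrightarrow> v = Z"
  "adj (Y e) v \<longleftrightarrow> v = YP e \<or> (\<exists>j a. v = A j a)"
  "adj (YP e) v \<longleftrightarrow> v = Y e"
  "adj (B j) v \<longleftrightarrow> v = Z \<or> v = S j \<or> v = Q j \<or> v = D j \<or> (\<exists>i. i \<noteq> j \<and> v = B i) \<or> (\<exists>c. v = CL c \<and> cb c j)"
  "adj (S j) v \<longleftrightarrow> v = B j"
  "adj (Q j) v \<longleftrightarrow> v = B j \<or> (\<exists>i a. v = A i a \<and> i \<noteq> j)"
  "adj (H j) v \<longleftrightarrow> v = D j \<or> (\<exists>a. v = A j a)"
  "adj (D j) v \<longleftrightarrow> v = Z \<or> v = H j \<or> v = B j"
  "adj (T l) v \<longleftrightarrow> v = Z \<or> (\<exists>j a. v = A j a \<and> sat j a l) \<or> (\<exists>c. v = CL c \<and> ct c l)"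
  "adj (A j a) v \<longleftrightarrow> (\<exists>e. v = Y e) \<or> v = H j \<or> (\<exists>i. i \<noteq> j \<and> v = Q i) \<or> (\<exists>l. v = T l \<and> sat j a l)"
  "adj (CL c) v \<longleftrightarrow> v = Z \<or> (\<exists>j. v = B j \<and> cb c j) \<or> (\<exists>l. v = T l \<and> ct c l)"
  by (cases v; auto simp: adj_def)+

lemma adj_sym: "adj u v \<longleftrightarrow> adj v u"
  by (auto simp: adj_def)

lemma vwalk_simps [simp]:
  "vwalk [] (with_proj G) \<longleftrightarrow> False"
  "vwalk [u] (with_proj G) \<longleftrightarrow> valid u"
  "vwalk (u # v # p) (with_proj G) \<longleftrightarrow> valid u \<and> adj u v \<and> vwalk (v # p) (with_proj G)"
  by (auto simp: vwalk_iff_successively)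

lemma finite_G: "finite (Collect valid)"
proof (rule finite_subset)
  show "Collect valid \<subseteq> {Z, SZ} \<union> range Y \<union> range YP
    \<union> B ` {..<q} \<union> S ` {..<q} \<union> Q ` {..<q} \<union> H ` {..<q} \<union> D ` {..<q} \<union> T ` {..<K}
    \<union> (\<Union>j<q. A j ` {..<P}) \<union> CL ` {..<L}"
  proof
    fix v assume "v \<in> Collect valid"
    then show "v \<in> {Z, SZ} \<union> range Y \<union> range YP
      \<union> B ` {..<q} \<union> S ` {..<q} \<union> Q ` {..<q} \<union> H ` {..<q} \<union> D ` {..<q} \<union> T ` {..<K}
      \<union> (\<Union>j<q. A j ` {..<P}) \<union> CL ` {..<L}"
      by (cases v) (simp_all add: image_iff)
  qed
qed simp

lemma pair_graph_G: "pair_graph G"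
proof unfold_locales
  show "finite (pverts G)"
    unfolding G_def pair_pre_digraph.simps by (rule finite_G)
  show "finite (parcs G)"
    by (rule finite_subset[OF _ finite_cartesian_product[OF finite_G finite_G]]) (auto simp: G_def)
  show "symmetric G" using sym_G by (simp add: symmetric_def)
  show "fst e \<noteq> snd e" if "e \<in> parcs G" for e
  proof -
    obtain u v where "e = (u, v)" by force
    with that show ?thesis by (cases u) auto
  qed
qed (auto simp: G_def)

text \<open>\<open>A\<close> and \<open>CL\<close>, the only families whose size is not linear in
  \<open>q\<close> or \<open>K\<close>, stay outside, together with the guards \<open>D j\<close>
  and the pendant vertices.\<close>

definition cover :: "vertex set" where
  "cover = {Z} \<union> range Y \<union> B ` {..<q} \<union> Q ` {..<q} \<union> H ` {..<q} \<union> T ` {..<K}"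

lemma vertex_cover_cover: "vertex_cover G cover"
proof -
  have "u \<in> cover \<or> v \<in> cover" if "valid u" "valid v" "adj u v" for u v
    using that by (cases u) (auto simp: cover_def)
  then show ?thesis
    by (auto simp: vertex_cover_def independent_set_def) (auto simp: cover_def)
qed

lemma card_cover: "card cover \<le> 3 + 3 * q + K"
proof -
  have le: "card (f ` {..<n}) \<le> n" for f :: "nat \<Rightarrow> vertex" and n
    using card_image_le[of "{..<n}" f] by simp
  have "card (range Y) \<le> 2" using card_image_le[of UNIV Y] by simp
  moreover have "card cover \<le> card {Z} + card (range Y) + card (B ` {..<q}) + card (Q ` {..<q})
      + card (H ` {..<q}) + card (T ` {..<K})"
    unfolding cover_def by (intro order_trans[OF card_Un_le] add_mono le_refl)
  ultimately show ?thesis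
    using le[of B q] le[of Q q] le[of H q] le[of T K] by simp
qed

section \<open>Shortest paths through guards and clauses\<close>

abbreviation block :: "nat \<Rightarrow> vertex set" where
  "block j \<equiv> {D j, H j} \<union> range (A j)"

lemma ex_other: "\<exists>i<q. i \<noteq> j"
  using q_ge_2 by (cases "j = 0") (auto intro: exI[of _ 1] exI[of _ 0])

lemma no_shortcut:
  assumes "shortest_path G s (p @ m @ r) t"
    and "vwalk m' (with_proj G)" "hd m' = hd m" "last m' = last m" "length m' < length m"
  shows False
  using shortest_path_subwalk[OF assms(1) _ assms(2-4)] assms(5) by fastforce

text \<open>A path from outside the block can enter \<open>H j\<close> only from some
  \<open>A j a\<close>, and this only from a vertex \<open>Y e\<close>, \<open>Q i\<close> or
  \<open>T l\<close>. From each of these, \<open>y\<close> is within three steps, while the way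
  through \<open>H j\<close> and \<open>D j\<close> takes four.\<close>

lemma guard_path:
  assumes "shortest_path G s (p @ [H j, D j, y] @ r) t" and s: "s \<notin> block j"
  shows False
proof -
  note sp = assms(1)
  have w: "vwalk (p @ [H j, D j, y] @ r) (with_proj G)" and d: "distinct (p @ [H j, D j, y] @ r)"
    using shortest_path_vwalk[OF sp] shortest_path_distinct[OF sp] by simp_all
  have y: "y = Z \<or> y = B j" and j: "j < q"
    using w d by (auto simp: vwalk_iff_successively successively_append_iff)
  have ne: "H j \<noteq> s" "A j a \<noteq> s" for a using s by auto
  have "shortest_path G s (p @ H j # [D j, y] @ r) t" using sp by simp
  from shortest_path_predecessor[OF this ne(1)]
  obtain p' x where p: "p = p' @ [x]" and x: "(x, H j) \<in> parcs G" by blast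
  have "x = D j \<or> (\<exists>a. x = A j a)" using x by (auto simp: adj_sym[of x])
  then obtain a where xa: "x = A j a" using d p by auto
  with x have a: "a < P" by simp
  have "shortest_path G s (p' @ A j a # [H j, D j, y] @ r) t" using sp p xa by simp
  from shortest_path_predecessor[OF this ne(2)]
  obtain p'' v where p': "p' = p'' @ [v]" and v: "(v, A j a) \<in> parcs G" by blast
  have sp': "shortest_path G s (p'' @ [v, A j a, H j, D j, y] @ r) t"
    using sp p p' xa by simp
  have "adj (A j a) v" and vv: "valid v" using v by (auto simp: adj_sym[of v])
  then consider e where "v = Y e" | i where "v = Q i" "i \<noteq> j" | l where "v = T l"
    using d p p' by auto
  then show False
  proof cases
    case 1
    obtain i where i: "i < q" "i \<noteq> j" using ex_other by auto
    obtain l where l: "l < K" "sat j a l" using ex_lit j a by blast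
    from y show False
    proof
      assume "y = Z"
      with 1 l j a show False by (intro no_shortcut[OF sp', of "[v, A j a, T l, Z]"]) auto
    next
      assume "y = B j"
      with 1 i j P_pos show False by (intro no_shortcut[OF sp', of "[v, A i 0, Q j, B j]"]) auto
    qed
  next
    case 2
    with y j vv show False by (intro no_shortcut[OF sp', of "[v, B i, y]"]) auto
  next
    case 3
    from y show False
    proof
      assume "y = Z"
      with 3 vv show False by (intro no_shortcut[OF sp', of "[v, Z]"]) auto
    next
      assume "y = B j"
      with 3 vv j show False by (intro no_shortcut[OF sp', of "[v, Z, B j]"]) auto
    qed
  qed
qed

text \<open>The neighbours of \<open>D j\<close> are \<open>Z\<close>, \<open>B j\<close> and
  \<open>H j\<close>, and the first two are adjacent. So a shortest path with \<open>D j\<close> in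
  its interior uses \<open>H j\<close> on one side, and \<open>guard_path\<close> applies to it or
  to its reverse.\<close>

lemma guard_covered:
  assumes sp: "shortest_path G s p t" and "D j \<in> set p"
  shows "s \<in> block j \<or> t \<in> block j"
proof (rule ccontr)
  assume *: "\<not> ?thesis"
  then have "D j \<noteq> s" "D j \<noteq> t" by auto
  with assms obtain p1 x y p2 where p: "p = p1 @ [x, D j, y] @ p2" and xy: "x \<noteq> y"
    and "(x, D j) \<in> parcs G" "(D j, y) \<in> parcs G"
    using shortest_path_interior[OF sp] by metis
  then have N: "x \<in> {Z, H j, B j}" "y \<in> {Z, H j, B j}" "j < q"
    by (auto simp: adj_sym[of x])
  have "x \<noteq> H j"
    using guard_path[of s p1 j y p2 t] sp p * by auto
  moreover have "y \<noteq> H j"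
  proof
    assume "y = H j"
    then have "shortest_path G t (rev p2 @ [H j, D j, x] @ rev p1) s"
      using shortest_path_rev[OF sym_G sp] p by simp
    then show False using guard_path * by blast
  qed
  ultimately have "x = Z \<and> y = B j \<or> x = B j \<and> y = Z" using N xy by auto
  with N show False
    using sp p by (intro no_shortcut[of s p1 "[x, D j, y]" p2 t "[x, y]"]) auto
qed

text \<open>The other neighbours of \<open>T l\<close> are excluded by shortcuts: \<open>Z\<close>
  is adjacent to \<open>CL c\<close> itself, and another clause vertex reaches \<open>y\<close>
  through \<open>Z\<close>.\<close>

lemma literal_predecessor:
  assumes sp: "shortest_path G s (p @ [T l, CL c, y] @ r) t" and "s \<noteq> T l"
    and "y = B i \<or> y = T l'"
  obtains p' j a where "p = p' @ [A j a]" "sat j a l" "j < q" "a < P"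
proof -
  have w: "vwalk (p @ [T l, CL c, y] @ r) (with_proj G)"
    by (rule shortest_path_vwalk[OF sp])
  have y: "valid y" "adj Z y" "c < L" "l < K"
    using w assms(3) by (auto simp: vwalk_iff_successively successively_append_iff)
  have "shortest_path G s (p @ T l # [CL c, y] @ r) t" using sp by simp
  from shortest_path_predecessor[OF this assms(2)[symmetric]]
  obtain p' x where p: "p = p' @ [x]" and x: "(x, T l) \<in> parcs G" by blast
  have sp': "shortest_path G s (p' @ [x, T l, CL c] @ (y # r)) t"
    and sp'': "shortest_path G s (p' @ [x, T l, CL c, y] @ r) t" using sp p by simp_all
  have "adj (T l) x" and vx: "valid x" using x by (auto simp: adj_sym[of x])
  then consider "x = Z" | c' where "x = CL c'" | j a where "x = A j a" "sat j a l" by auto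
  then show ?thesis
  proof cases
    case 1
    with y have False by (intro no_shortcut[OF sp', of "[Z, CL c]"]) auto
    then show ?thesis ..
  next
    case 2
    with y vx have False by (intro no_shortcut[OF sp'', of "[CL c', Z, y]"]) auto
    then show ?thesis ..
  next
    case 3
    with vx p that show ?thesis by auto
  qed
qed

text \<open>If \<open>y\<close> is a literal vertex, the path has assignment vertices on both sides,
  which are joined through \<open>Y True\<close> in two steps. If \<open>y = B i\<close>, then
  \<open>Q i\<close> is a shortcut from \<open>A j a\<close> unless \<open>i = j\<close>. In that
  case \<open>A j a\<close> is the first vertex, since each possible predecessor of it reaches
  \<open>B j\<close> within three steps instead of four.\<close>

lemma clause_path:
  assumes sp: "shortest_path G s (p @ [T l, CL c, y] @ r) t"
    and ends: "s \<noteq> T l" "y \<noteq> T l' \<or> t \<noteq> y" and y: "y = B i \<or> y = T l'"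
  obtains j a where "s = A j a" "sat j a l" "ct c l" "cb c j"
proof -
  have w: "vwalk (p @ [T l, CL c, y] @ r) (with_proj G)"
    by (rule shortest_path_vwalk[OF sp])
  have vy: "valid y" "adj (CL c) y" "adj Z y" "c < L" "l < K" "ct c l"
    using w y by (auto simp: vwalk_iff_successively successively_append_iff)
  obtain p' j a where p: "p = p' @ [A j a]" and ja: "sat j a l" "j < q" "a < P"
    using literal_predecessor[OF sp ends(1) y] by blast
  have sp1: "shortest_path G s (p' @ [A j a, T l, CL c, y] @ r) t" using sp p by simp
  show ?thesis
  proof (cases "y = T l'")
    case True
    have "shortest_path G t (rev r @ [T l', CL c, T l] @ rev p) s"
      using shortest_path_rev[OF sym_G sp] True by simp
    then obtain r' j' a' where r: "rev r = r' @ [A j' a']" and ja': "j' < q" "a' < P"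
      using literal_predecessor[of t "rev r" l' c "T l" "rev p" s] ends(2) True by metis
    then have "r = A j' a' # rev r'" by (metis rev.simps(2) rev_rev_ident rev_append append_Cons append_Nil rev_singleton_conv)
    then have "shortest_path G s (p' @ [A j a, T l, CL c, y, A j' a'] @ rev r') t"
      using sp1 by simp
    then have False
      using ja ja' by (rule_tac no_shortcut[of s p' "[A j a, T l, CL c, y, A j' a']" "rev r'" t "[A j a, Y True, A j' a']"]) auto
    then show ?thesis ..
  next
    case False
    with y have yi: "y = B i" by simp
    with vy have i: "i < q" "cb c i" by auto
    have ij: "i = j"
    proof (rule ccontr)
      assume "i \<noteq> j"
      with yi i ja show False by (intro no_shortcut[OF sp1, of "[A j a, Q i, B i]"]) auto
    qed
    have "s = A j a"
    proof (rule ccontr)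
      assume "s \<noteq> A j a"
      have "shortest_path G s (p' @ A j a # [T l, CL c, y] @ r) t" using sp1 by simp
      from shortest_path_predecessor[OF this \<open>s \<noteq> A j a\<close>[symmetric]]
      obtain p'' x where p': "p' = p'' @ [x]" and x: "(x, A j a) \<in> parcs G" by blast
      have sp2: "shortest_path G s (p'' @ [x, A j a, T l, CL c, y] @ r) t" using sp1 p' by simp
      have "adj (A j a) x" and vx: "valid x" using x by (auto simp: adj_sym[of x])
      then consider e where "x = Y e" | "x = H j" | k where "x = Q k" "k \<noteq> j" | l'' where "x = T l''"
        by auto
      then show False
      proof cases
        case 1
        obtain k where "k < q" "k \<noteq> j" using ex_other by auto
        with 1 yi ij i P_pos show False
          by (intro no_shortcut[OF sp2, of "[Y e, A k 0, Q j, B j]"]) auto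
      next
        case 2
        with yi ij i show False by (intro no_shortcut[OF sp2, of "[H j, D j, B j]"]) auto
      next
        case 3
        with vx yi ij i show False by (intro no_shortcut[OF sp2, of "[Q k, B k, B j]"]) auto
      next
        case 4
        with vx yi ij i show False by (intro no_shortcut[OF sp2, of "[T l'', Z, B j]"]) auto
      qed
    qed
    with ja i ij vy that show ?thesis by blast
  qed
qed

text \<open>The two neighbours of \<open>CL c\<close> on the path are not adjacent. As
  \<open>Z\<close> is adjacent to all others and any two hubs are adjacent, one of them is a literal
  vertex and the other a hub or a literal vertex.\<close>

lemma clause_covered:
  assumes sp: "shortest_path G s p t" and "CL c \<in> set p"
    and s: "s \<notin> range T \<union> range CL" and t: "t \<notin> range T \<union> range CL"
  obtains j a l where "A j a \<in> {s, t}" "sat j a l" "ct c l" "cb c j" "l < K"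
proof -
  have "CL c \<noteq> s" "CL c \<noteq> t" using s t by auto
  with assms obtain p1 x y p2 where p: "p = p1 @ [x, CL c, y] @ p2" and xy: "x \<noteq> y"
    and "(x, CL c) \<in> parcs G" "(CL c, y) \<in> parcs G"
    using shortest_path_interior[OF sp] by metis
  then have v: "valid x" "valid y" "c < L" "adj (CL c) x" "adj (CL c) y"
    by (auto simp: adj_sym[of x])
  have na: "\<not> adj x y"
  proof
    assume "adj x y"
    with v show False
      using sp p by (intro no_shortcut[of s p1 "[x, CL c, y]" p2 t "[x, y]"]) auto
  qed
  have "x \<noteq> Z" "y \<noteq> Z" using na v xy by auto
  then consider l where "x = T l" "(\<exists>i. y = B i) \<or> (\<exists>l'. y = T l')"
    | i l where "x = B i" "y = T l"
    using v na xy by auto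
  then show ?thesis
  proof cases
    case 1
    have "shortest_path G s (p1 @ [T l, CL c, y] @ p2) t" using sp p 1 by simp
    from 1(2) obtain i l' where "y = B i \<or> y = T l'" by auto
    moreover have "s \<noteq> T l" "y \<noteq> T l' \<or> t \<noteq> y" using s t by auto
    ultimately obtain j a where "s = A j a" "sat j a l" "ct c l" "cb c j"
      using clause_path[of s p1 l c y p2 t l' i] \<open>shortest_path G s (p1 @ [T l, CL c, y] @ p2) t\<close> by blast
    with that v 1 show ?thesis by auto
  next
    case 2
    have sp': "shortest_path G t (rev p2 @ [T l, CL c, B i] @ rev p1) s"
      using shortest_path_rev[OF sym_G sp] p 2 by simp
    \<comment> \<open>\<open>T 0\<close> is a dummy for the literal vertex \<open>T l'\<close>, as
      the other neighbour is a hub here.\<close>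
    have "t \<noteq> T l" "B i \<noteq> T 0 \<or> s \<noteq> B i" "B i = B i \<or> B i = T 0" using t by auto
    from clause_path[OF sp' this]
    obtain j a where "t = A j a" "sat j a l" "ct c l" "cb c j" by blast
    with that v 2 show ?thesis by auto
  qed
qed

section \<open>From a small geodetic set to a block assignment\<close>

definition forced :: "vertex set" where
  "forced = {SZ} \<union> range YP \<union> S ` {..<q}"

lemma card_forced: "card forced = q + 3"
proof -
  have "card (range YP) = 2" by (simp add: card_image inj_def)
  moreover have "card (S ` {..<q}) = q" by (simp add: card_image inj_on_def)
  moreover have "SZ \<notin> range YP \<union> S ` {..<q}" "range YP \<inter> S ` {..<q} = {}" by auto
  ultimately show ?thesis by (simp add: forced_def card_Un_disjoint)
qed

lemma forced_subset:
  assumes "geodetic_set G X" shows "forced \<subseteq> X"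
proof -
  have "SZ \<in> X" by (rule geodetic_set_pendant[OF assms sym_G, of _ Z]) auto
  moreover have "YP e \<in> X" for e by (rule geodetic_set_pendant[OF assms sym_G, of _ "Y e"]) auto
  moreover have "S j \<in> X" if "j < q" for j
    by (rule geodetic_set_pendant[OF assms sym_G, of _ "B j"]) (use that in auto)
  ultimately show ?thesis by (auto simp: forced_def)
qed

text \<open>The guard of each block requires a vertex of \<open>X\<close> in that block. The blocks
  are disjoint from each other and from the \<open>q + 3\<close> forced vertices, so a budget of
  \<open>2 * q + 3\<close> leaves exactly one vertex per block and no room for literal or clause
  vertices. Hence \<open>clause_covered\<close> applies to every pair of vertices in
  \<open>X\<close>.\<close>

lemma geodetic_imp_assignment:
  assumes geo: "geodetic_set G X" and card: "card X \<le> 2 * q + 3"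
  shows "\<exists>f. (\<forall>j<q. f j < P) \<and> (\<forall>c<L. \<exists>j<q. \<exists>l<K. cb c j \<and> ct c l \<and> sat j (f j) l)"
proof -
  have X: "X \<subseteq> Collect valid" using geo by (auto simp: geodetic_set_def)
  then have fin: "finite X" using finite_G finite_subset by blast
  have "\<exists>x. x \<in> X \<and> x \<in> block j" if j: "j < q" for j
  proof -
    obtain s t p where "s \<in> X" "t \<in> X" "shortest_path G s p t" "D j \<in> set p"
      using geo j unfolding geodetic_set_def by (metis pverts_G valid.simps(9))
    then show ?thesis using guard_covered[of s p t j] by auto
  qed
  then obtain g where g: "\<And>j. j < q \<Longrightarrow> g j \<in> X \<and> g j \<in> block j" by metis
  have inj: "inj_on g {..<q}"
  proof (rule inj_onI)
    fix i j assume "i \<in> {..<q}" "j \<in> {..<q}" "g i = g j"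
    then have "g i \<in> block i \<inter> block j" using g by fastforce
    then show "i = j" by auto
  qed
  have disj: "forced \<inter> g ` {..<q} = {}" using g by (fastforce simp: forced_def)
  have "card (forced \<union> g ` {..<q}) = 2 * q + 3"
    using disj inj card_forced by (subst card_Un_disjoint) (auto simp: card_image forced_def)
  moreover have "forced \<union> g ` {..<q} \<subseteq> X" using forced_subset[OF geo] g by auto
  ultimately have X_eq: "X = forced \<union> g ` {..<q}"
    using card card_seteq[OF fin] by (metis)
  \<comment> \<open>A block may have spent its vertex on \<open>D j\<close> or \<open>H j\<close>.
    It then gets the default assignment 0, which is harmless because every clause is covered through
    some \<open>A j a\<close> in \<open>X\<close>.\<close>
  define f where "f j = (if \<exists>a. g j = A j a then THE a. g j = A j a else 0)" for j
  have f: "f j = a" if "g j = A j a" for j a using that by (auto simp: f_def)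
  have "f j < P" if "j < q" for j
  proof (cases "\<exists>a. g j = A j a")
    case True
    then obtain a where a: "g j = A j a" by auto
    moreover have "valid (g j)" using g[OF that] X by auto
    ultimately show ?thesis using f[OF a] by simp
  next
    case False
    then show ?thesis by (simp add: f_def P_pos)
  qed
  moreover have "\<exists>j<q. \<exists>l<K. cb c j \<and> ct c l \<and> sat j (f j) l" if c: "c < L" for c
  proof -
    obtain s t p where st: "s \<in> X" "t \<in> X" "shortest_path G s p t" "CL c \<in> set p"
      using geo c unfolding geodetic_set_def by (metis pverts_G valid.simps(12))
    have "x \<notin> range T \<union> range CL" if "x \<in> X" for x
      using that g unfolding X_eq forced_def by fastforce
    with st obtain j a l where jal: "A j a \<in> {s, t}" "sat j a l" "ct c l" "cb c j" "l < K"
      using clause_covered[OF st(3,4)] by metis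
    then have "A j a \<in> X" using st by auto
    then obtain i where i: "i < q" "A j a = g i" unfolding X_eq forced_def by auto
    with g[OF i(1)] have "i = j" by auto
    with i jal f[of j a] show ?thesis by metis
  qed
  ultimately show ?thesis by blast
qed

section \<open>From a block assignment to a geodetic set\<close>

text \<open>
  Two potentials changing by at most 1 along each edge: the distance from \<open>YP True\<close> and a lower bound on
  the distance from \<open>S j\<close>.
\<close>

definition depth :: "vertex \<Rightarrow> nat" where
  "depth v = (case v of YP e \<Rightarrow> if e then 0 else 4 | Y e \<Rightarrow> if e then 1 else 3 | A j a \<Rightarrow> 2
     | Q j \<Rightarrow> 3 | T l \<Rightarrow> 3 | H j \<Rightarrow> 3 | S j \<Rightarrow> 5 | SZ \<Rightarrow> 5 | _ \<Rightarrow> 4)"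

definition height :: "nat \<Rightarrow> vertex \<Rightarrow> nat" where
  "height j v = (case v of S i \<Rightarrow> if i = j then 0 else 3 | B i \<Rightarrow> if i = j then 1 else 2
     | Z \<Rightarrow> 2 | Q i \<Rightarrow> if i = j then 2 else 3 | CL c \<Rightarrow> 2 | D i \<Rightarrow> 2 | A i a \<Rightarrow> if i = j then 4 else 3
     | Y e \<Rightarrow> 4 | YP e \<Rightarrow> 5 | _ \<Rightarrow> 3)"

lemma depth_adj: "(u, v) \<in> parcs G \<Longrightarrow> depth v \<le> depth u + 1"
  by (cases u) (auto simp: depth_def)

lemma height_adj: "(u, v) \<in> parcs G \<Longrightarrow> height j v \<le> height j u + 1"
  by (cases u) (auto simp: height_def)

lemma covered_by_depth:
  assumes "vwalk (YP True # p @ [t]) (with_proj G)" "distinct (YP True # p @ [t])"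
    and "length p + 1 \<le> depth t" "u \<in> set (YP True # p @ [t])" "YP True \<in> X" "t \<in> X"
  shows "\<exists>s\<in>X. \<exists>t\<in>X. \<exists>p. shortest_path G s p t \<and> u \<in> set p"
  using shortest_pathI[OF assms(1,2) depth_adj] assms(3-6) by (fastforce simp: depth_def)

lemma covered_by_height:
  assumes "vwalk (S j # p @ [t]) (with_proj G)" "distinct (S j # p @ [t])"
    and "length p + 1 \<le> height j t" "u \<in> set (S j # p @ [t])" "S j \<in> X" "t \<in> X"
  shows "\<exists>s\<in>X. \<exists>t\<in>X. \<exists>p. shortest_path G s p t \<and> u \<in> set p"
  using shortest_pathI[OF assms(1,2) height_adj[of _ _ j]] assms(3-6) by (fastforce simp: height_def)

text \<open>All vertices other than \<open>H j\<close>, \<open>D j\<close> and \<open>CL c\<close>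
  lie on shortest paths from \<open>YP True\<close> to other forced vertices, whatever
  \<open>f\<close> is. The remaining ones lie on paths of length 4 from \<open>S j\<close> to the
  selected \<open>A j (f j)\<close>, through the guard or through a satisfied clause.\<close>

lemma assignment_imp_geodetic:
  assumes fP: "\<And>j. j < q \<Longrightarrow> f j < P"
    and sat: "\<And>c. c < L \<Longrightarrow> \<exists>j<q. \<exists>l<K. cb c j \<and> ct c l \<and> sat j (f j) l"
  shows "geodetic_set G (forced \<union> (\<lambda>j. A j (f j)) ` {..<q})" (is "geodetic_set G ?X")
  unfolding geodetic_set_def
proof (intro conjI ballI)
  show "?X \<subseteq> pverts G" using fP by (auto simp: forced_def)
  fix u assume "u \<in> pverts G"
  then have u: "valid u" by simp
  have in_X: "SZ \<in> ?X" "YP e \<in> ?X" "j < q \<Longrightarrow> S j \<in> ?X" "j < q \<Longrightarrow> A j (f j) \<in> ?X" for e j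
    by (auto simp: forced_def)
  have Ya: "\<exists>s\<in>?X. \<exists>t\<in>?X. \<exists>p. shortest_path G s p t \<and> u \<in> set p"
    if "u \<in> {YP True, Y True, A j a, Y False, YP False}" "j < q" "a < P" for j a
    using that in_X by (intro covered_by_depth[of "[Y True, A j a, Y False]" "YP False"]) (auto simp: depth_def)
  have Qj: "\<exists>s\<in>?X. \<exists>t\<in>?X. \<exists>p. shortest_path G s p t \<and> u \<in> set p" if "u \<in> {Q j, B j, S j}" "j < q" for j
  proof -
    obtain i where "i < q" "i \<noteq> j" using ex_other by auto
    with that P_pos in_X show ?thesis
      by (intro covered_by_depth[of "[Y True, A i 0, Q j, B j]" "S j"]) (auto simp: depth_def)
  qed
  have Tl: "\<exists>s\<in>?X. \<exists>t\<in>?X. \<exists>p. shortest_path G s p t \<and> u \<in> set p" if ul: "u \<in> {T l, Z, SZ}" "l < K" for l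
  proof -
    obtain j a where "j < q" "a < P" "sat j a l" using ex_assignment ul by blast
    with ul in_X show ?thesis
      by (intro covered_by_depth[of "[Y True, A j a, T l, Z]" "SZ"]) (auto simp: depth_def)
  qed
  have Hj: "\<exists>s\<in>?X. \<exists>t\<in>?X. \<exists>p. shortest_path G s p t \<and> u \<in> set p" if "u \<in> {H j, D j}" "j < q" for j
    using that in_X fP by (intro covered_by_height[of j "[B j, D j, H j]" "A j (f j)"]) (auto simp: height_def)
  have Cc: "\<exists>s\<in>?X. \<exists>t\<in>?X. \<exists>p. shortest_path G s p t \<and> u \<in> set p" if uc: "u = CL c" "c < L" for c
  proof -
    obtain j l where "j < q" "l < K" "cb c j" "ct c l" "sat j (f j) l" using sat[OF uc(2)] by blast
    with uc in_X fP show ?thesis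
      by (intro covered_by_height[of j "[B j, CL c, T l]" "A j (f j)"]) (auto simp: height_def)
  qed
  \<comment> \<open>Some literal position exists; a path through it covers \<open>Z\<close> and
    \<open>SZ\<close>.\<close>
  have 0: "0 < q" using q_ge_2 by simp
  then obtain l where l: "l < K" using ex_lit P_pos by blast
  show "\<exists>s\<in>?X. \<exists>t\<in>?X. \<exists>p. shortest_path G s p t \<and> u \<in> set p"
  proof (cases u)
    case (Y e) then show ?thesis using Ya[of 0 0] 0 P_pos by (cases e) auto
  next
    case (YP e) then show ?thesis using Ya[of 0 0] 0 P_pos by (cases e) auto
  qed (use u Ya Qj Tl[OF _ l] Tl Hj Cc in auto)
qed

theorem geodetic_iff_assignment:
  "(\<exists>X. geodetic_set G X \<and> card X \<le> 2 * q + 3) \<longleftrightarrow>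
   (\<exists>f. (\<forall>j<q. f j < P) \<and> (\<forall>c<L. \<exists>j<q. \<exists>l<K. cb c j \<and> ct c l \<and> sat j (f j) l))"
proof
  assume "\<exists>f. (\<forall>j<q. f j < P) \<and> (\<forall>c<L. \<exists>j<q. \<exists>l<K. cb c j \<and> ct c l \<and> sat j (f j) l)"
  then obtain f where f: "\<And>j. j < q \<Longrightarrow> f j < P"
    "\<And>c. c < L \<Longrightarrow> \<exists>j<q. \<exists>l<K. cb c j \<and> ct c l \<and> sat j (f j) l" by blast
  have "card (forced \<union> (\<lambda>j. A j (f j)) ` {..<q}) \<le> 2 * q + 3"
    using card_Un_le[of forced "(\<lambda>j. A j (f j)) ` {..<q}"] card_image_le[of "{..<q}" "\<lambda>j. A j (f j)"]
    by (simp add: card_forced)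
  with assignment_imp_geodetic[OF f]
  show "\<exists>X. geodetic_set G X \<and> card X \<le> 2 * q + 3" by blast
qed (use geodetic_imp_assignment in blast)

end

section \<open>The adjacency relation as a formula\<close>

abbreviation holds :: "nat \<Rightarrow> (nat \<Rightarrow> nat) \<Rightarrow> aexp \<Rightarrow> (nat \<Rightarrow> nat) \<Rightarrow> bool" where
  "holds M w e \<rho> \<equiv> 0 < aval M w e \<rho>"

definition Less :: "aexp \<Rightarrow> aexp \<Rightarrow> aexp" where "Less a b = Minus b a"
definition And :: "aexp \<Rightarrow> aexp \<Rightarrow> aexp" where "And a b = If a b (N 0)"
definition Or :: "aexp \<Rightarrow> aexp \<Rightarrow> aexp" where "Or a b = If a (N 1) b"
definition Eq :: "aexp \<Rightarrow> aexp \<Rightarrow> aexp" where "Eq a b = If (Less a b) (N 0) (If (Less b a) (N 0) (N 1))"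
definition Neq :: "aexp \<Rightarrow> aexp \<Rightarrow> aexp" where "Neq a b = Or (Less a b) (Less b a)"
definition Disj :: "aexp list \<Rightarrow> aexp" where "Disj es = foldr Or es (N 0)"
text \<open>The iteration stays at the first witness, so its value is below the bound iff there is one.\<close>
definition Search :: "nat \<Rightarrow> aexp \<Rightarrow> aexp" where
  "Search x e = Iter x Bound (N 0) (If e (V x) (Plus (V x) (N 1)))"
definition Ex :: "nat \<Rightarrow> aexp \<Rightarrow> aexp \<Rightarrow> aexp" where
  "Ex x b e = Less (Search x (And (Less (V x) b) e)) Bound"
text \<open>A product by iterated addition, since the machine has no multiplication. The number of
  rounds is capped, so the value is the true product only if the first factor is at most the
  bound.\<close>

definition Times :: "aexp \<Rightarrow> nat \<Rightarrow> aexp" where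
  "Times a x = Iter 30 a (N 0) (Plus (V 30) (V x))"
definition Shift :: "aexp \<Rightarrow> aexp \<Rightarrow> aexp" where
  "Shift a b = Iter 30 b a (Plus (V 30) (V 30))"

lemma holds_simps [simp]:
  "holds M w (Less a b) \<rho> \<longleftrightarrow> aval M w a \<rho> < aval M w b \<rho>"
  "holds M w (And a b) \<rho> \<longleftrightarrow> holds M w a \<rho> \<and> holds M w b \<rho>"
  "holds M w (Or a b) \<rho> \<longleftrightarrow> holds M w a \<rho> \<or> holds M w b \<rho>"
  "holds M w (Eq a b) \<rho> \<longleftrightarrow> aval M w a \<rho> = aval M w b \<rho>"
  "holds M w (Neq a b) \<rho> \<longleftrightarrow> aval M w a \<rho> \<noteq> aval M w b \<rho>"
  by (auto simp: Less_def And_def Or_def Eq_def Neq_def)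

lemma holds_Disj [simp]:
  "holds M w (Disj []) \<rho> \<longleftrightarrow> False"
  "holds M w (Disj (e # es)) \<rho> \<longleftrightarrow> holds M w e \<rho> \<or> holds M w (Disj es) \<rho>"
  by (simp_all add: Disj_def)

lemma funpow_search:
  fixes P :: "nat \<Rightarrow> bool" and M :: nat
  defines "z \<equiv> ((\<lambda>y. if P y then y else y + 1) ^^ M) 0"
  shows "z \<le> M \<and> (\<forall>k<z. \<not> P k) \<and> (z < M \<longrightarrow> P z)"
  unfolding z_def
proof (induction M)
  case (Suc M)
  then show ?case by (auto simp: less_Suc_eq)
qed simp

lemma aval_Search:
  fixes M w x e \<rho>
  defines "z \<equiv> aval M w (Search x e) \<rho>"
  shows "z \<le> M" "k < z \<Longrightarrow> \<not> holds M w e (\<rho>(x := k))" "z < M \<Longrightarrow> holds M w e (\<rho>(x := z))"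
proof -
  have "z = ((\<lambda>y. if holds M w e (\<rho>(x := y)) then y else y + 1) ^^ M) 0"
    unfolding z_def Search_def by (simp add: if_distrib cong: if_cong)
  with funpow_search[of M "\<lambda>y. holds M w e (\<rho>(x := y))"]
  show "z \<le> M" "k < z \<Longrightarrow> \<not> holds M w e (\<rho>(x := k))" "z < M \<Longrightarrow> holds M w e (\<rho>(x := z))" by simp_all
qed

lemma holds_Ex [simp]:
  "holds M w (Ex x b e) \<rho> \<longleftrightarrow>
   (\<exists>k<M. k < aval M w b (\<rho>(x := k)) \<and> holds M w e (\<rho>(x := k)))"
proof -
  let ?e = "And (Less (V x) b) e"
  have "holds M w (Ex x b e) \<rho> \<longleftrightarrow> aval M w (Search x ?e) \<rho> < M" by (simp add: Ex_def)
  also have "\<dots> \<longleftrightarrow> (\<exists>k<M. holds M w ?e (\<rho>(x := k)))"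
    using aval_Search(2)[of _ M w x ?e \<rho>] aval_Search(3)[of M w x ?e \<rho>] by (metis leI order_less_le_trans)
  finally show ?thesis by simp
qed

lemma aval_Times [simp]:
  assumes "x \<noteq> 30"
  shows "aval M w (Times a x) \<rho> = min (aval M w a \<rho>) M * \<rho> x"
proof -
  have "((\<lambda>y. y + c) ^^ k) 0 = k * c" for c k :: nat by (induction k) auto
  then show ?thesis using assms by (simp add: Times_def)
qed

lemma aval_Shift [simp]: "aval M w (Shift a b) \<rho> = aval M w a \<rho> * 2 ^ min (aval M w b \<rho>) M"
proof -
  have "((\<lambda>y. y + y) ^^ k) z = z * 2 ^ k" for k z :: nat by (induction k) auto
  then show ?thesis by (simp add: Shift_def)
qed

text \<open>
  The variables 0 to 6 hold \<open>n\<close>, \<open>m\<close>, \<open>2 ^ m\<close>, \<open>3 * m\<close>, the number of vertices, and two vertices; 10 to 18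
  stand for \<open>d\<close>, \<open>i\<close>, \<open>p\<close>, \<open>s\<close>, \<open>r\<close>, \<open>j\<close>, \<open>a\<close>, \<open>l\<close>, \<open>c\<close>, and 30 is the accumulator of the iterations.
\<close>

definition BitE :: aexp where
  "BitE = Ex 19 Bound (Ex 20 Bound (And
     (Eq (V 16) (Plus (Shift (Plus (Plus (V 19) (V 19)) (V 13)) (V 12)) (V 20)))
     (Less (V 20) (Shift (N 1) (V 12)))))"

definition BlockLitE :: aexp where
  "BlockLitE = Ex 10 (N 3) (Ex 11 (V 1) (Ex 12 (V 1) (Ex 13 (N 2)
     (And (Eq (V 15) (Plus (Times (V 10) 1) (V 11)))
     (And (Eq (V 17) (Plus (Times (V 13) 3) (Plus (Times (V 10) 1) (V 12)))) BitE)))))"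

definition PosE :: aexp where
  "PosE = Iter 30 (V 18) (Plus (Plus (V 0) (Plus (V 0) (V 0))) (N 3))
     (Plus (Plus (V 30) (N 1)) (Plus (Inp (V 30)) (Inp (V 30))))"

definition OccursE :: aexp where
  "OccursE = And (Less (V 14) (Inp PosE)) (And (Less (Plus (Times (V 11) 1) (V 12)) (V 0))
     (Eq (Inp (Plus (Plus PosE (N 1)) (Plus (V 14) (V 14))))
       (Inp (Plus (Plus (Times (V 10) 0) (V 10)) (Plus (Times (V 11) 1) (V 12))))))"

definition ClauseBlockE :: aexp where
  "ClauseBlockE = Ex 10 (N 3) (Ex 11 (V 1) (Ex 12 (V 1) (Ex 14 (N 3)
     (And (Eq (V 15) (Plus (Times (V 10) 1) (V 11))) OccursE))))"

definition ClauseLitE :: aexp where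
  "ClauseLitE = Ex 10 (N 3) (Ex 11 (V 1) (Ex 12 (V 1) (Ex 14 (N 3) (Ex 13 (N 2)
     (And OccursE (And (Eq (V 13) (Inp (Plus (Plus PosE (N 2)) (Plus (V 14) (V 14)))))
     (Eq (V 17) (Plus (Times (V 13) 3) (Plus (Times (V 10) 1) (V 12))))))))))"

text \<open>The numbering of the vertices: six single ones, then intervals of length
  \<open>q\<close>, which is kept in variable 3. The literal positions fill the intervals 5 and 6,
  because \<open>K = 2 * q\<close>, so the assignments begin at offset 7.\<close>

definition off :: "nat \<Rightarrow> aexp \<Rightarrow> aexp" where
  "off k e = (Plus (V 3) ^^ k) (Plus (N 6) e)"

lemma aval_off [simp]: "aval M w (off k e) \<rho> = 6 + k * \<rho> 3 + aval M w e \<rho>"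
  by (induction k) (simp_all add: off_def)

definition ArcE :: "nat \<Rightarrow> nat \<Rightarrow> aexp" where
  "ArcE x y = Disj
    [And (Eq (V x) (N 0)) (Eq (V y) (N 1)),
     And (Eq (V x) (N 2)) (Eq (V y) (N 4)),
     And (Eq (V x) (N 3)) (Eq (V y) (N 5)),
     Ex 15 (V 3) (And (Eq (V x) (off 0 (V 15))) (Disj
       [Eq (V y) (N 0), Eq (V y) (off 1 (V 15)), Eq (V y) (off 2 (V 15)), Eq (V y) (off 4 (V 15)),
        Ex 11 (V 3) (And (Neq (V 11) (V 15)) (Eq (V y) (off 0 (V 11))))])),
     Ex 15 (V 3) (And (Eq (V x) (off 4 (V 15))) (Disj [Eq (V y) (N 0), Eq (V y) (off 3 (V 15))])),
     Ex 17 (Plus (V 3) (V 3)) (And (Eq (V x) (off 5 (V 17))) (Eq (V y) (N 0))),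
     Ex 15 (V 3) (Ex 16 (V 2) (And (Eq (V x) (off 7 (Plus (Times (V 15) 2) (V 16)))) (Disj
       [Eq (V y) (N 2), Eq (V y) (N 3), Eq (V y) (off 3 (V 15)),
        Ex 11 (V 3) (And (Neq (V 11) (V 15)) (Eq (V y) (off 2 (V 11)))),
        Ex 17 (Plus (V 3) (V 3)) (And (Eq (V y) (off 5 (V 17))) BlockLitE)]))),
     Ex 18 (Inp (Plus (Plus (V 0) (Plus (V 0) (V 0))) (N 2)))
       (And (Eq (V x) (off 7 (Plus (Times (V 3) 2) (V 18)))) (Disj
       [Eq (V y) (N 0),
        Ex 15 (V 3) (And (Eq (V y) (off 0 (V 15))) ClauseBlockE),
        Ex 17 (Plus (V 3) (V 3)) (And (Eq (V y) (off 5 (V 17))) ClauseLitE)]))]"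

definition AdjE :: aexp where
  "AdjE = If (Or (ArcE 5 6) (ArcE 6 5)) (N 1) (N 0)"

lemma ex_bound: "b \<le> M \<Longrightarrow> (\<exists>k<M. k < b \<and> P k) \<longleftrightarrow> (\<exists>k<b. P k)" for b M :: nat
  by (meson order_less_le_trans)

text \<open>A description of bit \<open>p\<close> without division: \<open>e\<close> holds the bits
  above it and \<open>g\<close> those below. Both are at most \<open>a\<close>, so they are found
  below the bound.\<close>

lemma bit_of_iff:
  assumes "s < 2" "a < M"
  shows "(\<exists>e<M. \<exists>g<M. a = (e + e + s) * 2 ^ p + g \<and> g < 2 ^ p) \<longleftrightarrow> bit_of a p = s"
proof
  assume "\<exists>e<M. \<exists>g<M. a = (e + e + s) * 2 ^ p + g \<and> g < 2 ^ p"
  then obtain e g where "a = (e + e + s) * 2 ^ p + g" "g < 2 ^ p" by auto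
  then have "a div 2 ^ p = e + e + s" by simp
  then show "bit_of a p = s" using assms(1) by (simp add: bit_of_def mult_2[symmetric])
next
  assume "bit_of a p = s"
  then have "a div 2 ^ p = a div 2 ^ p div 2 + a div 2 ^ p div 2 + s"
    using div_mult_mod_eq[of "a div 2 ^ p" 2] by (simp add: bit_of_def)
  then have "a = (a div 2 ^ p div 2 + a div 2 ^ p div 2 + s) * 2 ^ p + a mod 2 ^ p"
    by (metis div_mult_mod_eq)
  moreover have "a div 2 ^ p div 2 < M" "a mod 2 ^ p < M"
    using assms(2) by (meson div_le_dividend mod_less_eq_dividend order_le_less_trans)+
  ultimately show "\<exists>e<M. \<exists>g<M. a = (e + e + s) * 2 ^ p + g \<and> g < 2 ^ p" by (metis mod_less_divisor pos2 zero_less_power)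
qed

text \<open>\<open>M\<close> is at least the number of vertices, hence at least every quantifier
  range and every iteration count in the formulas for adjacency, so no cap takes effect.\<close>

locale formulas =
  fixes M n m L :: nat and w :: "nat \<Rightarrow> nat"
  assumes M: "6 + 7 * (3 * m) + 3 * m * 2 ^ m + L \<le> M"
    and L: "w (3 * n + 2) = L"
begin

definition env :: "(nat \<Rightarrow> nat) \<Rightarrow> bool" where
  "env \<rho> \<longleftrightarrow> \<rho> 0 = n \<and> \<rho> 1 = m \<and> \<rho> 2 = 2 ^ m \<and> \<rho> 3 = 3 * m"

lemma env_upd [simp]: "10 \<le> x \<Longrightarrow> env (\<rho>(x := y)) \<longleftrightarrow> env \<rho>"
  by (auto simp: env_def)

lemma bounds: "3 \<le> M" "2 \<le> M" "m \<le> M" "3 * m \<le> M" "2 * (3 * m) \<le> M" "L \<le> M"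
  using M by simp_all

lemma holds_BitE:
  assumes "\<rho> 13 < 2" "\<rho> 16 < M" "\<rho> 12 \<le> M"
  shows "holds M w BitE \<rho> \<longleftrightarrow> bit_of (\<rho> 16) (\<rho> 12) = \<rho> 13"
proof -
  have "holds M w BitE \<rho> \<longleftrightarrow>
    (\<exists>e<M. \<exists>g<M. \<rho> 16 = (e + e + \<rho> 13) * 2 ^ \<rho> 12 + g \<and> g < 2 ^ \<rho> 12)"
    using assms(3) by (auto simp: BitE_def min_absorb1)
  with bit_of_iff[OF assms(1,2)] show ?thesis by simp
qed

lemma holds_BlockLitE:
  assumes "env \<rho>" "\<rho> 16 < M"
  shows "holds M w BlockLitE \<rho> \<longleftrightarrow> block_lit m (\<rho> 15) (\<rho> 16) (\<rho> 17)"
proof -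
  have "holds M w BlockLitE \<rho> \<longleftrightarrow> (\<exists>d<M. d < 3 \<and> (\<exists>i<M. i < m \<and> (\<exists>p<M. p < m \<and> (\<exists>s<M. s < 2 \<and>
    (\<rho> 15 = d * m + i \<and> \<rho> 17 = s * (3 * m) + (d * m + p) \<and> bit_of (\<rho> 16) p = s)))))"
    using assms bounds by (auto simp: BlockLitE_def holds_BitE env_def min_def cong: conj_cong)
  then show ?thesis by (simp only: ex_bound bounds block_lit_def)
qed

lemma aval_PosE:
  assumes "env \<rho>" "\<rho> 18 < L"
  shows "aval M w PosE \<rho> = clause_pos w n (\<rho> 18)"
  using assms bounds
  by (simp add: PosE_def clause_pos_def env_def min_absorb1 mult_2 numeral_3_eq_3 add.assoc)

lemma holds_OccursE:
  assumes "env \<rho>" "\<rho> 18 < L" "\<rho> 10 < 3" "\<rho> 11 < m"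
  shows "holds M w OccursE \<rho> \<longleftrightarrow> occurs w n m (\<rho> 18) (\<rho> 14) (\<rho> 10) (\<rho> 11) (\<rho> 12)"
  using assms bounds
  by (simp add: OccursE_def occurs_def aval_PosE env_def min_absorb1 mult_2 algebra_simps)

lemma holds_ClauseBlockE:
  assumes "env \<rho>" "\<rho> 18 < L"
  shows "holds M w ClauseBlockE \<rho> \<longleftrightarrow> clause_block w n m (\<rho> 18) (\<rho> 15)"
proof -
  have "holds M w ClauseBlockE \<rho> \<longleftrightarrow> (\<exists>d<M. d < 3 \<and> (\<exists>i<M. i < m \<and> (\<exists>p<M. p < m \<and> (\<exists>r<M. r < 3 \<and>
    (\<rho> 15 = d * m + i \<and> occurs w n m (\<rho> 18) r d i p)))))"
    using assms bounds by (auto simp: ClauseBlockE_def holds_OccursE env_def min_def cong: conj_cong)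
  then show ?thesis by (simp only: ex_bound bounds clause_block_def)
qed

lemma holds_ClauseLitE:
  assumes "env \<rho>" "\<rho> 18 < L"
  shows "holds M w ClauseLitE \<rho> \<longleftrightarrow> clause_lit w n m (\<rho> 18) (\<rho> 17)"
proof -
  have "holds M w ClauseLitE \<rho> \<longleftrightarrow> (\<exists>d<M. d < 3 \<and> (\<exists>i<M. i < m \<and> (\<exists>p<M. p < m \<and> (\<exists>r<M. r < 3 \<and> (\<exists>s<M. s < 2 \<and>
    (occurs w n m (\<rho> 18) r d i p \<and> s = w (clause_pos w n (\<rho> 18) + 2 + 2 * r) \<and> \<rho> 17 = s * (3 * m) + (d * m + p)))))))"
    using assms bounds
    by (auto simp: ClauseLitE_def holds_OccursE aval_PosE env_def min_def mult_2 cong: conj_cong)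
  then show ?thesis by (simp only: ex_bound bounds clause_lit_def)
qed

end

section \<open>Numbering of the vertices\<close>

primrec num :: "nat \<Rightarrow> nat \<Rightarrow> vertex \<Rightarrow> nat" where
  "num q P Z = 0"
| "num q P SZ = 1"
| "num q P (Y e) = (if e then 3 else 2)"
| "num q P (YP e) = (if e then 5 else 4)"
| "num q P (B j) = 6 + 0 * q + j"
| "num q P (S j) = 6 + 1 * q + j"
| "num q P (Q j) = 6 + 2 * q + j"
| "num q P (H j) = 6 + 3 * q + j"
| "num q P (D j) = 6 + 4 * q + j"
| "num q P (T l) = 6 + 5 * q + l"
| "num q P (A j a) = 6 + 7 * q + (j * P + a)"
| "num q P (CL c) = 6 + 7 * q + (q * P + c)"

context gadget
begin

lemma num_inj:
  assumes K: "K = 2 * q" and uv: "valid u" "valid v" and eq: "num q P u = num q P v"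
  shows "u = v"
proof -
  have less: "j * P + a < q * P" if "j < q" "a < P" for j a
    using that by (rule mixed_radix_less)
  have inj: "j = j' \<and> a = a'" if "j * P + a = j' * P + a'" "a < P" "a' < P" for j a j' a'
    using that by (rule mixed_radix_unique)
  show ?thesis
  proof (cases u)
    case (A j a)
    with uv less have ja: "j * P + a < q * P" by simp
    show ?thesis
    proof (cases v)
      case (A j' a')
      with \<open>u = A j a\<close> uv eq have "j * P + a = j' * P + a'" "a < P" "a' < P" by simp_all
      with inj[of j a j' a'] A \<open>u = A j a\<close> show ?thesis by simp
    qed (use A ja uv eq K[symmetric] in \<open>simp_all split: if_splits\<close>)
  next
    case (CL c)
    then show ?thesis
    proof (cases v)
      case (A j a)
      with uv less have "j * P + a < q * P" by simp
      with A CL eq show ?thesis by simp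
    qed (use CL uv eq K[symmetric] in \<open>simp_all split: if_splits\<close>)
  qed (use uv eq K[symmetric] in \<open>cases v; simp split: if_splits\<close>)+
qed

lemma num_image:
  assumes K: "K = 2 * q"
  shows "num q P ` Collect valid = {..<6 + 7 * q + (q * P + L)}"
proof
  have less: "j * P + a < q * P" if "j < q" "a < P" for j a
    using that by (rule mixed_radix_less)
  have "num q P v < 6 + 7 * q + (q * P + L)" if "valid v" for v
  proof (cases v)
    case (A j a)
    with less[of j a] that show ?thesis by simp
  qed (use that K[symmetric] in simp_all)
  then show "num q P ` Collect valid \<subseteq> {..<6 + 7 * q + (q * P + L)}" by auto
  show "{..<6 + 7 * q + (q * P + L)} \<subseteq> num q P ` Collect valid"
  proof
    fix x assume "x \<in> {..<6 + 7 * q + (q * P + L)}"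
    then have x: "x < 6 + 7 * q + (q * P + L)" by simp
    have I: "x \<in> num q P ` Collect valid" if "valid v" "num q P v = x" for v using that by auto
    have "x < 6 \<Longrightarrow> x = 0 \<or> x = 1 \<or> x = 2 \<or> x = 3 \<or> x = 4 \<or> x = 5" by linarith
    then consider "x = 0" | "x = 1" | "x = 2" | "x = 3" | "x = 4" | "x = 5"
      | "\<not> x < 6" "x < 6 + q" | "\<not> x < 6 + q" "x < 6 + 2 * q" | "\<not> x < 6 + 2 * q" "x < 6 + 3 * q"
      | "\<not> x < 6 + 3 * q" "x < 6 + 4 * q" | "\<not> x < 6 + 4 * q" "x < 6 + 5 * q"
      | "\<not> x < 6 + 5 * q" "x < 6 + 7 * q" | "\<not> x < 6 + 7 * q" "x < 6 + 7 * q + q * P"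
      | "\<not> x < 6 + 7 * q + q * P" by blast
    then show "x \<in> num q P ` Collect valid"
    proof cases
      case 1 then show ?thesis by (intro I[of Z]) auto
    next
      case 2 then show ?thesis by (intro I[of SZ]) auto
    next
      case 3 then show ?thesis by (intro I[of "Y False"]) auto
    next
      case 4 then show ?thesis by (intro I[of "Y True"]) auto
    next
      case 5 then show ?thesis by (intro I[of "YP False"]) auto
    next
      case 6 then show ?thesis by (intro I[of "YP True"]) auto
    next
      case 7 then show ?thesis by (intro I[of "B (x - 6)"]) auto
    next
      case 8 then show ?thesis by (intro I[of "S (x - 6 - q)"]) auto
    next
      case 9 then show ?thesis by (intro I[of "Q (x - 6 - 2 * q)"]) auto
    next
      case 10 then show ?thesis by (intro I[of "H (x - 6 - 3 * q)"]) auto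
    next
      case 11 then show ?thesis by (intro I[of "D (x - 6 - 4 * q)"]) auto
    next
      case 12 then show ?thesis using K[symmetric] by (intro I[of "T (x - 6 - 5 * q)"]) simp_all
    next
      case 13
      define y where "y = x - 6 - 7 * q"
      have y: "y < q * P" "x = 6 + 7 * q + y" using 13 by (auto simp: y_def)
      then show ?thesis using P_pos
        by (intro I[of "A (y div P) (y mod P)"]) (auto simp: less_mult_imp_div_less)
    next
      case 14 then show ?thesis using x by (intro I[of "CL (x - 6 - 7 * q - q * P)"]) auto
    qed
  qed
qed

text \<open>An intermediate form between \<open>arc\<close> and \<open>ArcE\<close>: it speaks of
  vertex numbers, with explicitly bounded quantifiers, and follows \<open>ArcE\<close> disjunct by
  disjunct.\<close>

definition num_arc :: "nat \<Rightarrow> nat \<Rightarrow> bool" where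
  "num_arc x y \<longleftrightarrow> (let nu = num q P in
     x = nu Z \<and> y = nu SZ \<or> x = nu (Y False) \<and> y = nu (YP False) \<or> x = nu (Y True) \<and> y = nu (YP True) \<or>
     (\<exists>j<q. x = nu (B j) \<and> (y = nu Z \<or> y = nu (S j) \<or> y = nu (Q j) \<or> y = nu (D j) \<or>
        (\<exists>i<q. i \<noteq> j \<and> y = nu (B i)))) \<or>
     (\<exists>j<q. x = nu (D j) \<and> (y = nu Z \<or> y = nu (H j))) \<or>
     (\<exists>l<K. x = nu (T l) \<and> y = nu Z) \<or>
     (\<exists>j<q. \<exists>a<P. x = nu (A j a) \<and> (y = nu (Y False) \<or> y = nu (Y True) \<or> y = nu (H j) \<or>
        (\<exists>i<q. i \<noteq> j \<and> y = nu (Q i)) \<or> (\<exists>l<K. y = nu (T l) \<and> sat j a l))) \<or>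
     (\<exists>c<L. x = nu (CL c) \<and> (y = nu Z \<or> (\<exists>j<q. y = nu (B j) \<and> cb c j) \<or> (\<exists>l<K. y = nu (T l) \<and> ct c l))))"

lemma num_arc_iff:
  assumes K: "K = 2 * q" and uv: "valid u" "valid v"
  shows "num_arc (num q P u) (num q P v) \<longleftrightarrow> arc u v"
proof -
  have eq: "num q P u = num q P v \<longleftrightarrow> u = v" if "valid u" "valid v" for u v
    using num_inj[OF K that] by auto
  have eqs: "valid u \<Longrightarrow> num q P u = num q P Z \<longleftrightarrow> u = Z"
    "valid u \<Longrightarrow> num q P u = num q P SZ \<longleftrightarrow> u = SZ"
    "valid u \<Longrightarrow> num q P u = num q P (Y e) \<longleftrightarrow> u = Y e"
    "valid u \<Longrightarrow> num q P u = num q P (YP e) \<longleftrightarrow> u = YP e"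
    "valid u \<Longrightarrow> j < q \<Longrightarrow> num q P u = num q P (B j) \<longleftrightarrow> u = B j"
    "valid u \<Longrightarrow> j < q \<Longrightarrow> num q P u = num q P (S j) \<longleftrightarrow> u = S j"
    "valid u \<Longrightarrow> j < q \<Longrightarrow> num q P u = num q P (Q j) \<longleftrightarrow> u = Q j"
    "valid u \<Longrightarrow> j < q \<Longrightarrow> num q P u = num q P (H j) \<longleftrightarrow> u = H j"
    "valid u \<Longrightarrow> j < q \<Longrightarrow> num q P u = num q P (D j) \<longleftrightarrow> u = D j"
    "valid u \<Longrightarrow> l < K \<Longrightarrow> num q P u = num q P (T l) \<longleftrightarrow> u = T l"
    "valid u \<Longrightarrow> j < q \<Longrightarrow> a < P \<Longrightarrow> num q P u = num q P (A j a) \<longleftrightarrow> u = A j a"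
    "valid u \<Longrightarrow> c < L \<Longrightarrow> num q P u = num q P (CL c) \<longleftrightarrow> u = CL c" for u e j l a c
    by (rule eq; simp)+
  have "num_arc (num q P u) (num q P v) \<longleftrightarrow>
     u = Z \<and> v = SZ \<or> u = Y False \<and> v = YP False \<or> u = Y True \<and> v = YP True \<or>
     (\<exists>j<q. u = B j \<and> (v = Z \<or> v = S j \<or> v = Q j \<or> v = D j \<or> (\<exists>i<q. i \<noteq> j \<and> v = B i))) \<or>
     (\<exists>j<q. u = D j \<and> (v = Z \<or> v = H j)) \<or>
     (\<exists>l<K. u = T l \<and> v = Z) \<or>
     (\<exists>j<q. \<exists>a<P. u = A j a \<and> (v = Y False \<or> v = Y True \<or> v = H j \<or>
        (\<exists>i<q. i \<noteq> j \<and> v = Q i) \<or> (\<exists>l<K. v = T l \<and> sat j a l))) \<or>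
     (\<exists>c<L. u = CL c \<and> (v = Z \<or> (\<exists>j<q. v = B j \<and> cb c j) \<or> (\<exists>l<K. v = T l \<and> ct c l)))"
    using uv by (simp add: num_arc_def Let_def eqs del: num.simps cong: conj_cong)
  also have "\<dots> \<longleftrightarrow> arc u v"
    using uv by (cases u) auto
  finally show ?thesis .
qed

lemma parcs_map_graph_iff:
  assumes K: "K = 2 * q" and less: "x < 6 + 7 * q + (q * P + L)" "y < 6 + 7 * q + (q * P + L)"
  shows "(x, y) \<in> parcs (map_graph (num q P) G) \<longleftrightarrow> num_arc x y \<or> num_arc y x"
proof -
  have "x \<in> num q P ` Collect valid" "y \<in> num q P ` Collect valid"
    unfolding num_image[OF K] using less by simp_all
  then obtain u v where u: "valid u" "x = num q P u" and v: "valid v" "y = num q P v" by blast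
  have "(x, y) \<in> parcs (map_graph (num q P) G) \<longleftrightarrow> adj u v"
  proof
    assume "(x, y) \<in> parcs (map_graph (num q P) G)"
    then obtain u' v' where "(u', v') \<in> parcs G" "x = num q P u'" "y = num q P v'"
      by (auto simp del: parcs_G)
    moreover from this have "u' = u" "v' = v"
      using u v by (auto intro!: num_inj[OF K])
    ultimately show "adj u v" by simp
  next
    assume "adj u v"
    then have "(u, v) \<in> parcs G" using u v by simp
    then show "(x, y) \<in> parcs (map_graph (num q P) G)" using u v by force
  qed
  then show ?thesis using u v by (simp add: num_arc_iff[OF K] adj_def)
qed

end

context formulas
begin

lemma holds_ArcE:
  assumes m: "0 < m" and env: "env \<rho>" and xy: "x \<in> {5, 6}" "y \<in> {5, 6}"
  shows "holds M w (ArcE x y) \<rho> \<longleftrightarrow>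
    gadget.num_arc (3 * m) (2 ^ m) (2 * (3 * m)) L (block_lit m) (clause_block w n m) (clause_lit w n m) (\<rho> x) (\<rho> y)"
proof -
  interpret gadget "3 * m" "2 ^ m" "2 * (3 * m)" L "block_lit m" "clause_block w n m" "clause_lit w n m"
    using m block_lit_ex_lit block_lit_ex_assignment by unfold_locales auto
  have "(2::nat) ^ m \<le> 3 * m * 2 ^ m" using m by simp
  then have pow: "2 ^ m \<le> M" using M by linarith
  have L': "w (3 * n + 2) = L" by (rule L)
  have x: "x \<noteq> 11" "x \<noteq> 15" "x \<noteq> 16" "x \<noteq> 17" "x \<noteq> 18" and y: "y \<noteq> 11" "y \<noteq> 15" "y \<noteq> 16" "y \<noteq> 17" "y \<noteq> 18"
    using xy by auto
  have env': "\<rho> 0 = n" "\<rho> 1 = m" "\<rho> 2 = 2 ^ m" "\<rho> 3 = 3 * m" using env by (auto simp: env_def)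
  have sum3: "n + (n + n) = 3 * n" and sum2: "3 * m + 3 * m = 2 * (3 * m)" by simp_all
  \<comment> \<open>Products such as \<open>0 * (3 * m)\<close> are left as they are, so that they
    match the equations of \<open>num\<close>; the bound \<open>M\<close> on each quantifier is then
    removed by \<open>ex_bound\<close>.\<close>
  have "holds M w (ArcE x y) \<rho> \<longleftrightarrow>
     \<rho> x = 0 \<and> \<rho> y = 1 \<or> \<rho> x = 2 \<and> \<rho> y = 4 \<or> \<rho> x = 3 \<and> \<rho> y = 5 \<or>
     (\<exists>j<M. j < 3 * m \<and> (\<rho> x = 6 + 0 * (3 * m) + j \<and> (\<rho> y = 0 \<or> \<rho> y = 6 + 1 * (3 * m) + j \<or>
        \<rho> y = 6 + 2 * (3 * m) + j \<or> \<rho> y = 6 + 4 * (3 * m) + j \<or>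
        (\<exists>i<M. i < 3 * m \<and> (i \<noteq> j \<and> \<rho> y = 6 + 0 * (3 * m) + i))))) \<or>
     (\<exists>j<M. j < 3 * m \<and> (\<rho> x = 6 + 4 * (3 * m) + j \<and> (\<rho> y = 0 \<or> \<rho> y = 6 + 3 * (3 * m) + j))) \<or>
     (\<exists>l<M. l < 2 * (3 * m) \<and> (\<rho> x = 6 + 5 * (3 * m) + l \<and> \<rho> y = 0)) \<or>
     (\<exists>j<M. j < 3 * m \<and> (\<exists>a<M. a < 2 ^ m \<and> (\<rho> x = 6 + 7 * (3 * m) + (j * 2 ^ m + a) \<and>
        (\<rho> y = 2 \<or> \<rho> y = 3 \<or> \<rho> y = 6 + 3 * (3 * m) + j \<or>
        (\<exists>i<M. i < 3 * m \<and> (i \<noteq> j \<and> \<rho> y = 6 + 2 * (3 * m) + i)) \<or>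
        (\<exists>l<M. l < 2 * (3 * m) \<and> (\<rho> y = 6 + 5 * (3 * m) + l \<and> block_lit m j a l)))))) \<or>
     (\<exists>c<M. c < L \<and> (\<rho> x = 6 + 7 * (3 * m) + (3 * m * 2 ^ m + c) \<and> (\<rho> y = 0 \<or>
        (\<exists>j<M. j < 3 * m \<and> (\<rho> y = 6 + 0 * (3 * m) + j \<and> clause_block w n m c j)) \<or>
        (\<exists>l<M. l < 2 * (3 * m) \<and> (\<rho> y = 6 + 5 * (3 * m) + l \<and> clause_lit w n m c l)))))"
    using x y env env' bounds
    by (simp add: ArcE_def sum3 sum2 L' holds_BlockLitE holds_ClauseBlockE holds_ClauseLitE min_absorb1
        del: add_2_eq_Suc' add_2_eq_Suc cong: conj_cong)
  also have "\<dots> \<longleftrightarrow> num_arc (\<rho> x) (\<rho> y)"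
    by (simp only: ex_bound bounds pow num_arc_def Let_def num.simps if_True if_False)
  finally show ?thesis .
qed

lemma aval_AdjE:
  assumes m: "0 < m" and env: "env \<rho>" and xy: "\<rho> 5 = x" "\<rho> 6 = y"
    and less: "x < 6 + 7 * (3 * m) + (3 * m * 2 ^ m + L)" "y < 6 + 7 * (3 * m) + (3 * m * 2 ^ m + L)"
  shows "aval M w AdjE \<rho> =
    (if (x, y) \<in> parcs (map_graph (num (3 * m) (2 ^ m))
       (gadget.G (3 * m) (2 ^ m) (2 * (3 * m)) L (block_lit m) (clause_block w n m) (clause_lit w n m)))
     then 1 else 0)"
proof -
  interpret gadget "3 * m" "2 ^ m" "2 * (3 * m)" L "block_lit m" "clause_block w n m" "clause_lit w n m"
    using m block_lit_ex_lit block_lit_ex_assignment by unfold_locales auto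
  show ?thesis
    unfolding parcs_map_graph_iff[OF refl less] AdjE_def
    using holds_ArcE[OF m env, of 5 6] holds_ArcE[OF m env, of 6 5] xy by simp
qed

end

section \<open>The reduction program\<close>

lemma cost_mono: "M \<le> M' \<Longrightarrow> cost M e \<le> cost M' e"
  by (induction e) (auto intro!: add_mono mult_mono)

definition Assign :: "nat \<Rightarrow> aexp \<Rightarrow> com" where
  "Assign x e = Seq (compile 3 e) (Move (vreg x) (treg 3))"

definition SetBound :: "aexp \<Rightarrow> com" where
  "SetBound e = Seq (compile 3 e) (Move (treg 2) (treg 3))"

definition Output :: "nat \<Rightarrow> aexp \<Rightarrow> com" where
  "Output t e = Seq (compile t e) (Write (treg t))"

lemma ok_Assign:
  assumes "std M R"
    and "\<And>R'. std M R' \<Longrightarrow> vars R' = (vars R)(x := aval M (input R) e (vars R)) \<Longrightarrow> input R' = input R \<Longrightarrow>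
      post (R', inp, out)"
  shows "ok (Assign x e) (R, inp, out) (cost M e + 1) post"
  unfolding Assign_def
proof (rule ok_Seq, rule compile_correct[OF _ assms(1)])
  fix R' assume R': "unchanged 3 R R'" "R' (treg 3) = aval M (input R) e (vars R)"
  have "std M R'" using unchanged_std[OF R'(1)] assms(1) by simp
  moreover from this have "R' (treg 0) = 0" by (simp add: std_def)
  ultimately show "ok (Move (vreg x) (treg 3)) (R', inp, out) 1 post"
    using R' unchanged_vars[OF R'(1)] unchanged_input[OF R'(1)] by (intro ok_Add assms(2)) auto
qed simp

lemma ok_SetBound:
  assumes "std M R"
    and "\<And>R'. std (aval M (input R) e (vars R)) R' \<Longrightarrow> vars R' = vars R \<Longrightarrow> input R' = input R \<Longrightarrow>
      post (R', inp, out)"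
  shows "ok (SetBound e) (R, inp, out) (cost M e + 1) post"
  unfolding SetBound_def
proof (rule ok_Seq, rule compile_correct[OF _ assms(1)])
  fix R' assume R': "unchanged 3 R R'" "R' (treg 3) = aval M (input R) e (vars R)"
  have "std M R'" using unchanged_std[OF R'(1)] assms(1) by simp
  then have "std (aval M (input R) e (vars R)) (R'(treg 2 := R' (treg 3) + R' (treg 0)))"
    using R' by (simp add: std_def)
  then show "ok (Move (treg 2) (treg 3)) (R', inp, out) 1 post"
    using unchanged_vars[OF R'(1)] unchanged_input[OF R'(1)] by (intro ok_Add assms(2)) auto
qed simp

lemma ok_Output:
  assumes "3 \<le> t" "std M R"
    and "\<And>R'. unchanged t R R' \<Longrightarrow> std M R' \<Longrightarrow> vars R' = vars R \<Longrightarrow> input R' = input R \<Longrightarrow>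
      post (R', inp, out @ [aval M (input R) e (vars R)])"
  shows "ok (Output t e) (R, inp, out) (cost M e + 1) post"
  unfolding Output_def
proof (rule ok_Seq, rule compile_correct[OF assms(1,2)])
  fix R' assume R': "unchanged t R R'" "R' (treg t) = aval M (input R) e (vars R)"
  have "std M R'" using unchanged_std[OF R'(1)] assms(1,2) by simp
  then show "ok (Write (treg t)) (R', inp, out) 1 post"
    unfolding R'(2)[symmetric]
    using R' unchanged_vars[OF R'(1)] unchanged_input[OF R'(1)]
    by (intro ok_Write) (auto intro: assms(3))
qed

definition ReadInput :: com where
  "ReadInput = For (treg 3) (treg 2) (treg 4) (seqs [Read (treg 5), Add (treg 6) (treg 3) (treg 3),
     Add (treg 6) (treg 6) (treg 3), Add (treg 6) (treg 6) (treg 1), Add (treg 6) (treg 6) (treg 1),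
     Store (treg 6) (treg 5)])"

definition stream :: "nat list \<Rightarrow> nat \<Rightarrow> nat" where
  "stream v i = (if i < length v then v ! i else 0)"

lemma ok_ReadInput:
  assumes std: "std M R" and zero: "input R = (\<lambda>_. 0)" and len: "length inp \<le> M"
    and post: "\<And>R' inp'. std M R' \<Longrightarrow> vars R' = vars R \<Longrightarrow> input R' = stream inp \<Longrightarrow> post (R', inp', out)"
  shows "ok ReadInput (R, inp, out) (M * 9 + 3) post"
proof -
  define I where "I k s \<longleftrightarrow> (case s of (R', inp', out') \<Rightarrow> std M R' \<and> vars R' = vars R \<and> out' = out \<and>
     inp' = drop k inp \<and> input R' = (\<lambda>i. if i < k then stream inp i else 0))" for k s
  have I: "I k (R', inp', out') \<longleftrightarrow> std M R' \<and> vars R' = vars R \<and> out' = out \<and>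
     inp' = drop k inp \<and> input R' = (\<lambda>i. if i < k then stream inp i else 0)" for k R' inp' out'
    by (simp add: I_def)
  have "ok ReadInput (R, inp, out) (M * (6 + 3) + 3)
    (\<lambda>(R', inp', out'). R' (treg 2) = M \<and> R' (treg 1) = 1 \<and> I M (R', inp', out'))"
    unfolding ReadInput_def
  proof (rule ok_For)
    show "I 0 (R(treg 3 := 0), inp, out)" using std zero by (simp add: I)
    show "I k (R'(treg 4 := y), inp', out')" if "I k (R', inp', out')" for k R' inp' out' y
      using that by (simp add: I)
    fix k R' inp' out'
    assume k: "k < M" and R': "R' (treg 3) = k" "R' (treg 2) = M" "R' (treg 1) = 1" and inv: "I k (R', inp', out')"
    have hd: "(if inp' = [] then 0 else hd inp') = stream inp k"
      using inv by (auto simp: I stream_def hd_drop_conv_nth)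
    have tl: "tl inp' = drop (Suc k) inp" using inv by (simp add: I drop_Suc drop_tl)
    have idx: "Suc (Suc (k + k + k)) = wreg k" by (simp add: wreg_def)
    let ?R = "R'(treg 5 := stream inp k, treg 6 := wreg k, wreg k := stream inp k)"
    have "std M ?R" using inv by (auto simp: I std_def)
    moreover have "vars ?R = vars R" using inv by (auto simp: I vars_def fun_eq_iff)
    moreover have "input ?R = (\<lambda>i. if i < Suc k then stream inp i else 0)"
      using inv by (auto simp: I input_def fun_eq_iff less_Suc_eq)
    ultimately have "I (Suc k) (?R(treg 3 := Suc k), drop (Suc k) inp, out')"
      using inv by (simp add: I)
    then have "ok (seqs [Read (treg 5), Add (treg 6) (treg 3) (treg 3),
     Add (treg 6) (treg 6) (treg 3), Add (treg 6) (treg 6) (treg 1), Add (treg 6) (treg 6) (treg 1),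
     Store (treg 6) (treg 5)]) (R', inp', out') (1 + (1 + (1 + (1 + (1 + 1))))) (\<lambda>(R', inp', out').
        R' (treg 3) = k \<and> R' (treg 2) = M \<and> R' (treg 1) = 1 \<and> I (Suc k) (R'(treg 3 := Suc k), inp', out'))"
      unfolding seqs.simps
      by (intro ok_Seq ok_Read ok_Add ok_Store) (use R' in \<open>simp add: hd tl idx\<close>)
    then show "ok (seqs [Read (treg 5), Add (treg 6) (treg 3) (treg 3),
     Add (treg 6) (treg 6) (treg 3), Add (treg 6) (treg 6) (treg 1), Add (treg 6) (treg 6) (treg 1),
     Store (treg 6) (treg 5)]) (R', inp', out') 6 (\<lambda>(R', inp', out').
        R' (treg 3) = k \<and> R' (treg 2) = M \<and> R' (treg 1) = 1 \<and> I (Suc k) (R'(treg 3 := Suc k), inp', out'))"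
      by (rule ok_le) simp
  qed (use std in \<open>simp_all add: std_def\<close>)
  then show ?thesis
  proof (rule ok_mono)
    fix s assume "case s of (R', inp', out') \<Rightarrow> R' (treg 2) = M \<and> R' (treg 1) = 1 \<and> I M (R', inp', out')"
    then obtain R' inp' where s: "s = (R', inp', out)" and inv: "I M (R', inp', out)"
      by (auto simp: I)
    have "input R' = stream inp" using inv len by (auto simp: I stream_def fun_eq_iff)
    with inv show "post s" unfolding s by (intro post) (simp_all add: I)
  qed simp
qed

text \<open>The two loops own the scratch registers \<open>treg 3\<close> and \<open>treg 4\<close>;
  expressions are evaluated above them.\<close>

definition OutputMatrix :: com where
  "OutputMatrix = For (vreg 5) (vreg 4) (treg 3) (For (vreg 6) (vreg 4) (treg 4) (Output 5 AdjE))"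

lemma ok_OutputMatrix:
  assumes std: "std M R" and K: "vars R 4 = K"
    and adj: "\<And>\<rho> x y. x < K \<Longrightarrow> y < K \<Longrightarrow> (\<And>z. z < 5 \<Longrightarrow> \<rho> z = vars R z) \<Longrightarrow> \<rho> 5 = x \<Longrightarrow> \<rho> 6 = y \<Longrightarrow>
      aval M (input R) AdjE \<rho> = f x y"
    and post: "\<And>R'. post (R', inp, out @ concat (map (\<lambda>x. map (f x) [0..<K]) [0..<K]))"
  shows "ok OutputMatrix (R, inp, out) (K * (K * (cost M AdjE + 1 + 3) + 3 + 3) + 3) post"
proof -
  define J where "J R' \<longleftrightarrow> std M R' \<and> input R' = input R \<and> (\<forall>z<5. vars R' z = vars R z)" for R'
  define I where "I k s \<longleftrightarrow> (case s of (R', inp', out') \<Rightarrow> J R' \<and> inp' = inp \<and>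
     out' = out @ concat (map (\<lambda>x. map (f x) [0..<K]) [0..<k]))" for k s
  have I: "I k (R', inp', out') \<longleftrightarrow> J R' \<and> inp' = inp \<and>
     out' = out @ concat (map (\<lambda>x. map (f x) [0..<K]) [0..<k])" for k R' inp' out'
    by (simp add: I_def)
  have J_upd [simp]: "J (R'(vreg 5 := y)) \<longleftrightarrow> J R'" "J (R'(vreg 6 := y)) \<longleftrightarrow> J R'"
    "J (R'(treg 3 := y)) \<longleftrightarrow> J R'" "J (R'(treg 4 := y)) \<longleftrightarrow> J R'" for R' y
    by (auto simp: J_def)
  have reg: "R (vreg 4) = K" "R (treg 1) = 1" using K std by (auto simp: vars_def std_def)
  have JK: "R' (vreg 4) = K" "R' (treg 1) = 1" if "J R'" for R'
    using that reg by (auto simp: J_def vars_def std_def)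
  have "ok OutputMatrix (R, inp, out) (K * (K * (cost M AdjE + 1 + 3) + 3 + 3) + 3)
    (\<lambda>(R', inp', out'). R' (vreg 4) = K \<and> R' (treg 1) = 1 \<and> I K (R', inp', out'))"
    unfolding OutputMatrix_def
  proof (rule ok_For)
    show "I 0 (R(vreg 5 := 0), inp, out)" using std by (simp add: I J_def)
    show "I k (R'(treg 3 := y), inp', out')" if "I k (R', inp', out')" for k R' inp' out' y
      using that by (simp add: I)
    fix x R1 inp1 out1
    assume x: "x < K" and R1: "R1 (vreg 5) = x" "R1 (vreg 4) = K" "R1 (treg 1) = 1" and inv: "I x (R1, inp1, out1)"
    define I' where "I' k s \<longleftrightarrow> (case s of (R', inp', out') \<Rightarrow> J R' \<and> inp' = inp1 \<and> vars R' 5 = x \<and>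
       out' = out1 @ map (f x) [0..<k])" for k s
    have I': "I' k (R', inp', out') \<longleftrightarrow> J R' \<and> inp' = inp1 \<and> vars R' 5 = x \<and>
       out' = out1 @ map (f x) [0..<k]" for k R' inp' out'
      by (simp add: I'_def)
    have "ok (For (vreg 6) (vreg 4) (treg 4) (Output 5 AdjE)) (R1, inp1, out1) (K * (cost M AdjE + 1 + 3) + 3)
      (\<lambda>(R', inp', out'). R' (vreg 4) = K \<and> R' (treg 1) = 1 \<and> I' K (R', inp', out'))"
    proof (rule ok_For)
      show "I' 0 (R1(vreg 6 := 0), inp1, out1)" using inv R1 by (simp add: I I' vars_def)
      show "I' k (R'(treg 4 := y), inp', out')" if "I' k (R', inp', out')" for k R' inp' out' y
        using that by (simp add: I')
      fix y R2 inp2 out2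
      assume y: "y < K" and R2: "R2 (vreg 6) = y" "R2 (vreg 4) = K" "R2 (treg 1) = 1" and inv': "I' y (R2, inp2, out2)"
      have J2: "J R2" using inv' by (simp add: I')
      have val: "aval M (input R2) AdjE (vars R2) = f x y"
        using adj[OF x y, of "vars R2"] J2 inv' R2 by (simp add: J_def I') (simp add: vars_def)
      show "ok (Output 5 AdjE) (R2, inp2, out2) (cost M AdjE + 1) (\<lambda>(R', inp', out').
        R' (vreg 6) = y \<and> R' (vreg 4) = K \<and> R' (treg 1) = 1 \<and> I' (Suc y) (R'(vreg 6 := Suc y), inp', out'))"
      proof (rule ok_Output)
        show "std M R2" using J2 by (simp add: J_def)
        fix R3 assume R3: "unchanged 5 R2 R3" "std M R3" "vars R3 = vars R2" "input R3 = input R2"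
        have "J R3" using J2 R3 by (simp add: J_def)
        moreover have "R3 (vreg 6) = y" using R3(1) R2 by (simp add: unchanged_def)
        ultimately show "case (R3, inp2, out2 @ [aval M (input R2) AdjE (vars R2)]) of (R', inp', out') \<Rightarrow>
          R' (vreg 6) = y \<and> R' (vreg 4) = K \<and> R' (treg 1) = 1 \<and> I' (Suc y) (R'(vreg 6 := Suc y), inp', out')"
          using inv' JK R3(3) by (simp add: I' val)
      qed simp
    qed (use R1 in simp_all)
    then show "ok (For (vreg 6) (vreg 4) (treg 4) (Output 5 AdjE)) (R1, inp1, out1) (K * (cost M AdjE + 1 + 3) + 3)
      (\<lambda>(R', inp', out'). R' (vreg 5) = x \<and> R' (vreg 4) = K \<and> R' (treg 1) = 1 \<and>
         I (Suc x) (R'(vreg 5 := Suc x), inp', out'))"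
      by (rule ok_mono) (use inv in \<open>auto simp: I I' vars_def\<close>)
  qed (use reg in simp_all)
  then show ?thesis
    by (rule ok_mono) (use post in \<open>auto simp: I\<close>)
qed

text \<open>
  The bound is first \<open>32 * n + 64\<close>, which suffices to compute \<open>m\<close> and then the final bound \<open>2 ^ (20 * m)\<close>.
  The latter exceeds the length of the input, so \<open>ReadInput\<close> need not detect its end.
\<close>

definition SqrtE :: aexp where
  "SqrtE = Plus (N 1) (Search 31 (Less (V 0) (Plus (Times (V 31) 31) (N 1))))"
definition ExpE :: aexp where "ExpE = Shift (N 1) (V 1)"
definition BlocksE :: aexp where "BlocksE = Plus (V 1) (Plus (V 1) (V 1))"
definition BoundE :: aexp where "BoundE = Shift (N 1) (Times (N 20) 1)"
definition SizeE :: aexp where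
  "SizeE = off 7 (Plus (Times (V 3) 2) (Inp (Plus (Plus (V 0) (Plus (V 0) (V 0))) (N 2))))"
definition KE :: aexp where "KE = Plus (Plus (V 3) (V 3)) (N 3)"

text \<open>Doubling \<open>n + 2\<close> five times yields the preliminary bound
  \<open>32 * n + 64\<close>. \<open>treg 0\<close> is never set, as registers start at 0.\<close>

definition program :: com where
  "program = seqs [Const (treg 1) 1, Read (vreg 0), Const (treg 2) 2, Add (treg 2) (treg 2) (vreg 0),
     Add (treg 2) (treg 2) (treg 2), Add (treg 2) (treg 2) (treg 2), Add (treg 2) (treg 2) (treg 2),
     Add (treg 2) (treg 2) (treg 2), Add (treg 2) (treg 2) (treg 2),
     Assign 1 SqrtE, Assign 2 ExpE, Assign 3 BlocksE, SetBound BoundE, ReadInput,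
     Assign 4 SizeE, Output 3 KE, Write (vreg 4), OutputMatrix]"

text \<open>The square root of \<open>n\<close> rounded up, plus 1 so that it is positive for
  \<open>n = 0\<close> as well; the graph then has at least three blocks.\<close>

definition block_size :: "nat \<Rightarrow> nat" where
  "block_size n = 1 + (LEAST x. n \<le> x * x)"

lemma block_size_square: "n \<le> block_size n * block_size n"
proof -
  have "n \<le> (LEAST x. n \<le> x * x) * (LEAST x. n \<le> x * x)"
    by (rule LeastI[of "\<lambda>x. n \<le> x * x" n]) simp
  then show ?thesis by (simp add: block_size_def)
qed

lemma block_size_pos: "0 < block_size n" by (simp add: block_size_def)

lemma block_size_le: "block_size n \<le> n + 1"
proof -
  have "(LEAST x. n \<le> x * x) \<le> n" by (rule Least_le) simp
  then show ?thesis by (simp add: block_size_def)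
qed

lemma block_size_sqrt: "real (block_size n) \<le> sqrt (real n) + 2"
proof (cases "(LEAST x. n \<le> x * x) = 0")
  case True
  then show ?thesis by (simp add: block_size_def)
next
  case False
  let ?z = "LEAST x. n \<le> x * x"
  have "\<not> n \<le> (?z - 1) * (?z - 1)"
    using not_less_Least[of "?z - 1" "\<lambda>x. n \<le> x * x"] False by simp
  then have "real ((?z - 1) * (?z - 1)) \<le> real n" by (simp only: of_nat_le_iff)
  then have "(real ?z - 1)\<^sup>2 \<le> real n" using False by (simp add: power2_eq_square of_nat_diff)
  then have "real ?z - 1 \<le> sqrt (real n)" by (rule real_le_rsqrt)
  then show ?thesis by (simp add: block_size_def)
qed

text \<open>The search succeeds at \<open>n\<close> at the latest, because
  \<open>n \<le> n * n\<close>, and \<open>n\<close> is below the bound.\<close>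

lemma aval_SqrtE:
  assumes "\<rho> 0 = n" "n < M"
  shows "aval M w SqrtE \<rho> = block_size n"
proof -
  let ?e = "Less (V 0) (Plus (Times (V 31) 31) (N 1))"
  let ?z = "aval M w (Search 31 ?e) \<rho>"
  have e: "holds M w ?e (\<rho>(31 := k)) \<longleftrightarrow> n \<le> k * k" if "k \<le> M" for k
    using assms(1) that by (simp add: less_Suc_eq_le)
  have zM: "?z \<le> M" by (rule aval_Search)
  have below: "\<not> n \<le> k * k" if "k < ?z" for k
    using aval_Search(2)[OF that] e[of k] that zM by simp
  have "?z \<le> n" using below[of n] by (cases "n < ?z") auto
  then have "n \<le> ?z * ?z" using aval_Search(3)[of M w 31 ?e \<rho>] e[OF zM] assms(2) by simp
  with below have "?z = (LEAST x. n \<le> x * x)"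
    by (intro Least_equality[symmetric]) (auto simp: not_less[symmetric])
  then show ?thesis by (simp add: SqrtE_def block_size_def)
qed

text \<open>The 9 counts the instructions that set up the preliminary bound. All costs are charged
  at the final bound, including those incurred under the smaller preliminary one.\<close>

definition run_time :: "nat \<Rightarrow> nat" where
  "run_time M = 9 + (cost M SqrtE + cost M ExpE + cost M BlocksE + cost M BoundE + 4) + (M * 9 + 3)
     + (cost M SizeE + cost M KE + 3) + (M * (M * (cost M AdjE + 4) + 6) + 3)"

lemma program_correct:
  fixes n :: nat and v :: "nat list"
  defines "m \<equiv> block_size n" and "L \<equiv> stream v (3 * n + 2)"
  defines "M \<equiv> 2 ^ (20 * m)" and "K \<equiv> 6 + 7 * (3 * m) + (3 * m * 2 ^ m + L)"
  assumes n: "32 * n + 64 \<le> M" and v: "length v \<le> M" and K: "K \<le> M"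
  shows "ok program (\<lambda>_. 0, n # v, []) (run_time M) (\<lambda>(R, inp, out).
    out = (2 * (3 * m) + 3) # K # concat (map (\<lambda>x. map (\<lambda>y. if (x, y) \<in> parcs (map_graph (num (3 * m) (2 ^ m))
       (gadget.G (3 * m) (2 ^ m) (2 * (3 * m)) L (block_lit m)
         (clause_block (stream v) n m) (clause_lit (stream v) n m))) then 1 else 0) [0..<K]) [0..<K]))"
proof -
  interpret formulas M n m L "stream v"
    using K by unfold_locales (simp_all add: K_def L_def)
  let ?M0 = "32 * n + 64"
  have m: "0 < m" "m \<le> n + 1" using block_size_pos block_size_le by (simp_all add: m_def)
  let ?Q = "\<lambda>(R, inp, out).
    out = (2 * (3 * m) + 3) # K # concat (map (\<lambda>x. map (\<lambda>y. if (x, y) \<in> parcs (map_graph (num (3 * m) (2 ^ m))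
       (gadget.G (3 * m) (2 ^ m) (2 * (3 * m)) L (block_lit m)
         (clause_block (stream v) n m) (clause_lit (stream v) n m))) then 1 else 0) [0..<K]) [0..<K])"
  \<comment> \<open>The commands \<open>?c2\<close> to \<open>?c5\<close> are suffixes of the
    program, and the time bounds are nested exactly as \<open>ok_Seq\<close> produces them; the
    suffixes are verified from the last one backwards.\<close>
  let ?T = "1 + (1 + (1 + (1 + (1 + (1 + (1 + (1 + (1 + ((cost ?M0 SqrtE + 1) + ((cost ?M0 ExpE + 1) + ((cost ?M0 BlocksE + 1) + ((cost ?M0 BoundE + 1) + ((M * 9 + 3) + ((cost M SizeE + 1) + ((cost M KE + 1) + (1 + ((K * (K * (cost M AdjE + 1 + 3) + 3 + 3) + 3))))))))))))))))))"
  let ?T5 = "(cost M SizeE + 1) + ((cost M KE + 1) + (1 + ((K * (K * (cost M AdjE + 1 + 3) + 3 + 3) + 3))))"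
  let ?T4 = "(M * 9 + 3) + ((cost M SizeE + 1) + ((cost M KE + 1) + (1 + ((K * (K * (cost M AdjE + 1 + 3) + 3 + 3) + 3)))))"
  let ?T3 = "(cost ?M0 BoundE + 1) + ((M * 9 + 3) + ((cost M SizeE + 1) + ((cost M KE + 1) + (1 + ((K * (K * (cost M AdjE + 1 + 3) + 3 + 3) + 3))))))"
  let ?T2 = "(cost ?M0 SqrtE + 1) + ((cost ?M0 ExpE + 1) + ((cost ?M0 BlocksE + 1) + ((cost ?M0 BoundE + 1) + ((M * 9 + 3) + ((cost M SizeE + 1) + ((cost M KE + 1) + (1 + ((K * (K * (cost M AdjE + 1 + 3) + 3 + 3) + 3)))))))))"
  let ?c5 = "Seq (Assign 4 SizeE) (Seq (Output 3 KE) (Seq (Write (vreg 4)) OutputMatrix))"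
  let ?c4 = "Seq ReadInput ?c5"
  let ?c3 = "Seq (SetBound BoundE) ?c4"
  let ?c2 = "Seq (Assign 1 SqrtE) (Seq (Assign 2 ExpE) (Seq (Assign 3 BlocksE) ?c3))"
  have c5: "ok ?c5 (R, inp, []) ?T5 ?Q" if std: "std M R" and e: "env (vars R)" and i: "input R = stream v" for R inp
  proof (rule ok_Seq, rule ok_Assign[OF std])
    fix R1 assume R1: "std M R1" "vars R1 = (vars R)(4 := aval M (input R) SizeE (vars R))" "input R1 = input R"
    have "aval M (input R) SizeE (vars R) = K"
      using e i L bounds by (simp add: SizeE_def env_def K_def min_absorb1 numeral_3_eq_3 mult_2 add.assoc)
    with R1 e have e1: "env (vars R1)" "vars R1 4 = K" by (simp_all add: env_def)
    show "ok (Seq (Output 3 KE) (Seq (Write (vreg 4)) OutputMatrix)) (R1, inp, []) ((cost M KE + 1) + (1 + ((K * (K * (cost M AdjE + 1 + 3) + 3 + 3) + 3)))) ?Q"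
    proof (rule ok_Seq, rule ok_Output[OF _ R1(1)])
      fix R2 assume R2: "std M R2" "vars R2 = vars R1" "input R2 = input R1"
      have KE: "aval M (input R1) KE (vars R1) = 2 * (3 * m) + 3"
        using e1 by (simp add: KE_def env_def)
      have "vars R2 4 = K" using e1 R2 by simp
      then have K2: "R2 (vreg 4) = K" by (simp only: vars_def)
      show "ok (Seq (Write (vreg 4)) OutputMatrix) (R2, inp, [] @ [aval M (input R1) KE (vars R1)]) (1 + ((K * (K * (cost M AdjE + 1 + 3) + 3 + 3) + 3))) ?Q"
        unfolding KE
      proof (rule ok_Seq, rule ok_Write, rule ok_OutputMatrix[OF R2(1)])
        show "vars R2 4 = K" using e1 R2 by simp
        fix \<rho> x y assume "x < K" "y < K" "\<And>z. z < 5 \<Longrightarrow> \<rho> z = vars R2 z" "\<rho> 5 = x" "\<rho> 6 = y"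
        moreover from this have "env \<rho>" using e1 R2 by (simp add: env_def)
        moreover have "input R2 = stream v" using R2 R1 i by simp
        ultimately show "aval M (input R2) AdjE \<rho> = (if (x, y) \<in> parcs (map_graph (num (3 * m) (2 ^ m))
          (gadget.G (3 * m) (2 ^ m) (2 * (3 * m)) L (block_lit m)
         (clause_block (stream v) n m) (clause_lit (stream v) n m))) then 1 else 0)"
          using aval_AdjE[OF m(1), of \<rho> x y] by (simp only: K_def)
      qed (simp add: K2)
    qed simp
  qed
  have c4: "ok ?c4 (R, v, []) ?T4 ?Q" if "std M R" "env (vars R)" "input R = (\<lambda>_. 0)" for R
    using that v by (intro ok_Seq ok_ReadInput c5) simp_all
  have c3: "ok ?c3 (R, v, []) ?T3 ?Q" if "std ?M0 R" "env (vars R)" "input R = (\<lambda>_. 0)" for R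
  proof (rule ok_Seq, rule ok_SetBound[OF that(1)])
    \<comment> \<open>Neither the product nor the shift is capped: \<open>m \<le> n + 1\<close>
      gives \<open>20 * m \<le> 32 * n + 64\<close>.\<close>
    have "aval ?M0 (input R) BoundE (vars R) = M"
      using that(2) m by (simp add: BoundE_def env_def M_def min_absorb1)
    then show "ok ?c4 (R', v, []) ?T4 ?Q" if "std (aval ?M0 (input R) BoundE (vars R)) R'"
      "vars R' = vars R" "input R' = input R" for R'
      using that \<open>env (vars R)\<close> \<open>input R = (\<lambda>_. 0)\<close> by (intro c4) simp_all
  qed
  have c2: "ok ?c2 (R, v, []) ?T2 ?Q" if std: "std ?M0 R" and R: "vars R 0 = n" "input R = (\<lambda>_. 0)" for R
  proof (rule ok_Seq, rule ok_Assign[OF std])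
    fix R1 assume R1: "std ?M0 R1" "vars R1 = (vars R)(1 := aval ?M0 (input R) SqrtE (vars R))" "input R1 = input R"
    have s1: "aval ?M0 (input R) SqrtE (vars R) = m" unfolding m_def by (rule aval_SqrtE) (simp_all add: R)
    show "ok (Seq (Assign 2 ExpE) (Seq (Assign 3 BlocksE) ?c3)) (R1, v, [])
      ((cost ?M0 ExpE + 1) + ((cost ?M0 BlocksE + 1) + ?T3)) ?Q"
    proof (rule ok_Seq, rule ok_Assign[OF R1(1)], rule ok_Seq, rule ok_Assign, assumption)
      fix R2 R3 assume R2: "vars R2 = (vars R1)(2 := aval ?M0 (input R1) ExpE (vars R1))" "input R2 = input R1"
        and R3: "std ?M0 R3" "vars R3 = (vars R2)(3 := aval ?M0 (input R2) BlocksE (vars R2))" "input R3 = input R2"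
      have "env (vars R3)"
        using R R1 R2 R3 s1 m by (simp add: env_def ExpE_def BlocksE_def min_absorb1)
      then show "ok ?c3 (R3, v, []) ?T3 ?Q" using R3 R2 R1 R by (intro c3) simp_all
    qed
  qed
  have "ok program (\<lambda>_. 0, n # v, []) ?T ?Q"
    unfolding program_def seqs.simps
    by (rule ok_Seq, rule ok_Const, rule ok_Seq, rule ok_Read, rule ok_Seq, rule ok_Const,
        (rule ok_Seq, rule ok_Add)+, unfold list.sel, rule c2) (auto simp: std_def vars_def input_def)
  moreover have "?T \<le> run_time M"
  proof -
    have c: "cost ?M0 e \<le> cost M e" for e using n by (rule cost_mono)
    have "K * (K * (cost M AdjE + 1 + 3) + 3 + 3) \<le> M * (M * (cost M AdjE + 4) + 6)"
    proof -
      have "K * (cost M AdjE + 4) \<le> M * (cost M AdjE + 4)" using K by (rule mult_right_mono) simp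
      then have "K * (K * (cost M AdjE + 4) + 6) \<le> M * (M * (cost M AdjE + 4) + 6)"
        using K by (intro mult_mono) simp_all
      then show ?thesis by (simp add: add.assoc add.commute)
    qed
    then show ?thesis unfolding run_time_def
      using c[of SqrtE] c[of ExpE] c[of BlocksE] c[of BoundE]
      by linarith
  qed
  ultimately show ?thesis by (rule ok_le)
qed

section \<open>Estimates and conclusion\<close>

lemma polynomial_run_time: "polynomial run_time"
  unfolding run_time_def
  by (intro polynomial_add polynomial_const polynomial_times polynomial_cost)

text \<open>The origin of the exponent 20. With \<open>x = 2 ^ m\<close> one has
  \<open>n \<le> x ^ 2\<close>, so \<open>L\<close> is at most
  \<open>(7 * x ^ 2) ^ 3 = 343 * x ^ 6\<close>, which is below \<open>x ^ 15\<close> since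
  \<open>343 \<le> 2 ^ 9\<close>. A further factor \<open>x ^ 5\<close>, at least 32, absorbs the
  remaining constants.\<close>

lemma bound_estimates:
  fixes m n L :: nat
  assumes m: "0 < m" and n: "n \<le> m * m" and L: "L \<le> (6 * n + 1) ^ 3"
  shows "32 * n + 64 \<le> 2 ^ (20 * m)" "3 * n + 3 + 7 * L \<le> 2 ^ (20 * m)"
    "6 + 7 * (3 * m) + 3 * m * 2 ^ m + L \<le> 2 ^ (20 * m)"
proof -
  define x :: nat where "x = 2 ^ m"
  have mx: "m \<le> x" unfolding x_def by (rule less_imp_le) (rule less_exp)
  have x2: "2 \<le> x" unfolding x_def using m by (cases m) auto
  have nx: "n \<le> x ^ 2" using n mult_mono[OF mx mx] by (simp add: power2_eq_square)
  have inc: "x ^ k \<le> x ^ 15" if "k \<le> 15" for k using x2 that by (intro power_increasing) auto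
  have "6 * n + 1 \<le> 7 * x ^ 2" using nx x2 one_le_power[of x 2] by linarith
  then have "(6 * n + 1) ^ 3 \<le> (7 * x ^ 2) ^ 3" by (rule power_mono) simp
  also have "\<dots> = 343 * x ^ 6" by (simp add: power_mult_distrib flip: power_mult)
  also have "\<dots> \<le> 2 ^ 9 * x ^ 6" by simp
  also have "\<dots> \<le> x ^ 9 * x ^ 6" using power_mono[OF x2, of 9] by (intro mult_right_mono) auto
  also have "\<dots> = x ^ 15" by (simp flip: power_add)
  finally have L': "L \<le> x ^ 15" using L by simp
  have "32 * x ^ 15 \<le> x ^ 5 * x ^ 15" using power_mono[OF x2, of 5] by (intro mult_right_mono) auto
  also have "\<dots> = x ^ 20" by (simp flip: power_add)
  also have "\<dots> = 2 ^ (20 * m)" by (simp add: x_def mult.commute flip: power_mult)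
  finally have big: "32 * x ^ 15 \<le> 2 ^ (20 * m)" .
  have x1: "1 \<le> x ^ 15" "x \<le> x ^ 15" "x ^ 2 \<le> x ^ 15" "16 * x ^ 2 \<le> x ^ 15"
  proof -
    have "16 * x ^ 2 \<le> x ^ 4 * x ^ 2" using power_mono[OF x2, of 4] by (intro mult_right_mono) auto
    also have "\<dots> \<le> x ^ 15" using inc[of 6] by (simp flip: power_add)
    finally show "16 * x ^ 2 \<le> x ^ 15" .
  qed (use inc[of 0] inc[of 1] inc[of 2] in simp_all)
  have "4 \<le> x ^ 2" using power_mono[OF x2, of 2] by simp
  then show "32 * n + 64 \<le> 2 ^ (20 * m)" using nx x1 big by linarith
  show "3 * n + 3 + 7 * L \<le> 2 ^ (20 * m)" using nx L' x1 big by linarith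
  have "3 * m * 2 ^ m \<le> 3 * x ^ 2"
    using mx by (simp add: power2_eq_square flip: x_def)
  then show "6 + 7 * (3 * m) + 3 * m * 2 ^ m + L \<le> 2 ^ (20 * m)"
    using mx L' x1 big by linarith
qed

lemma linear_sqrt_bigo:
  fixes a b :: real
  shows "(\<lambda>N::nat. a * sqrt (real N) + b) \<in> O(\<lambda>N. sqrt (real N))"
proof (rule bigoI)
  show "\<forall>\<^sub>F N in sequentially. norm (a * sqrt (real N) + b) \<le> (\<bar>a\<bar> + \<bar>b\<bar>) * norm (sqrt (real N))"
  proof (rule eventually_sequentiallyI)
    fix N :: nat assume "1 \<le> N"
    then have "1 \<le> sqrt (real N)" by simp
    then have "\<bar>b\<bar> * 1 \<le> \<bar>b\<bar> * sqrt (real N)" by (intro mult_left_mono) auto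
    moreover have "\<bar>a * sqrt (real N) + b\<bar> \<le> \<bar>a\<bar> * sqrt (real N) + \<bar>b\<bar>"
      using abs_triangle_ineq[of "a * sqrt (real N)" b] by (simp add: abs_mult)
    ultimately show "norm (a * sqrt (real N) + b) \<le> (\<bar>a\<bar> + \<bar>b\<bar>) * norm (sqrt (real N))"
      by (simp add: algebra_simps)
  qed
qed

lemma reduction_correct:
  assumes psat: "three_partitioned_3sat \<psi>" and enc: "encodes_psat w \<psi>"
  defines "n \<equiv> card (part_alpha \<psi>)"
  defines "m \<equiv> block_size n"
  shows "\<exists>G k out t. computes_in_time program w t out \<and> t \<le> run_time (2 ^ (20 * m)) \<and>
    encodes_geodetic out G k \<and> pair_graph G \<and> k > 0 \<and>
    (satisfiable \<psi> \<longleftrightarrow> (\<exists>S. geodetic_set G S \<and> card S \<le> k)) \<and>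
    vertex_cover_number G + k \<le> 21 * m + 6 \<and> card (pverts G) \<le> 2 ^ (20 * m)"
proof -
  from enc obtain xs ys zs Cs where lists:
    "distinct xs" "set xs = part_alpha \<psi>" "distinct ys" "set ys = part_beta \<psi>"
    "distinct zs" "set zs = part_gamma \<psi>"
    and Cs: "\<forall>C\<in>set Cs. distinct C" "distinct (map set Cs)" "set (map set Cs) = clauses \<psi>"
    and w: "w = encode_list (\<lambda>x. [x]) xs @ encode_list (\<lambda>x. [x]) ys @ encode_list (\<lambda>x. [x]) zs
          @ encode_list (encode_list encode_literal) Cs"
    unfolding encodes_psat_def by blast
  define v where "v = xs @ encode_list (\<lambda>x. [x]) ys @ encode_list (\<lambda>x. [x]) zs @ encode_list encode_clause Cs"
  have n: "n = length xs" using lists distinct_card[of xs] by (simp add: n_def)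
  have w_eq: "w = n # v" unfolding w v_def n encode_clause_def by (simp add: encode_list_def)
  have m: "n \<le> m * m" "0 < m" unfolding m_def by (rule block_size_square, rule block_size_pos)
  interpret instance_word \<psi> xs ys zs Cs "stream v" n m
    using psat lists Cs m by unfold_locales (auto simp: n_def stream_def v_def Let_def fun_eq_iff)
  define L where "L = length Cs"
  have L: "stream v (3 * n + 2) = L" unfolding L_def by (rule w_length)
  let ?M = "2 ^ (20 * m) :: nat"
  have est: "32 * n + 64 \<le> ?M" "3 * n + 3 + 7 * L \<le> ?M" "6 + 7 * (3 * m) + (3 * m * 2 ^ m + L) \<le> ?M"
    using bound_estimates[OF m(2,1), of L] length_Cs_le by (simp_all add: L_def add.assoc)
  have len: "length v \<le> ?M" using length_input_le est(2) by (simp add: v_def L_def)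
  interpret gadget "3 * m" "2 ^ m" "2 * (3 * m)" L "block_lit m"
    "clause_block (stream v) n m" "clause_lit (stream v) n m"
    using m block_lit_ex_lit block_lit_ex_assignment by unfold_locales auto
  let ?G = "map_graph (num (3 * m) (2 ^ m)) G" and ?k = "2 * (3 * m) + 3"
  let ?K = "6 + 7 * (3 * m) + (3 * m * 2 ^ m + L)"
  let ?out = "?k # ?K # concat (map (\<lambda>x. map (\<lambda>y. if (x, y) \<in> parcs ?G then 1 else 0) [0..<?K]) [0..<?K])"
  have pverts: "pverts G = Collect valid" by (simp only: G_def pair_pre_digraph.simps)
  have verts: "pverts ?G = {..<?K}" by (simp only: map_graph_simps pverts num_image[OF refl])
  have inj: "inj_on (num (3 * m) (2 ^ m)) (pverts G)"
    unfolding pverts by (rule inj_onI) (rule num_inj[OF refl], simp_all only: mem_Collect_eq)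
  have wf: "pair_wf_digraph G" using pair_graph_G
    by (simp add: pair_graph_def pair_digraph_def pair_fin_digraph_def)
  have "ok program (\<lambda>_. 0, n # v, []) (run_time ?M) (\<lambda>(R, inp, out). out = ?out)"
    using program_correct[of n v] est len by (simp only: L m_def[symmetric])
  then obtain t out where "computes_in_time program w t out" "t \<le> run_time ?M" "out = ?out"
    unfolding ok_def computes_in_time_def w_eq by fast
  moreover have "encodes_geodetic ?out ?G ?k"
    unfolding encodes_geodetic_def Let_def verts by simp
  moreover have "pair_graph ?G" by (rule pair_graph_map_graph[OF pair_graph_G inj])
  moreover have "satisfiable \<psi> \<longleftrightarrow> (\<exists>S. geodetic_set ?G S \<and> card S \<le> ?k)"
    by (rule trans[OF satisfiable_iff_assignment[folded L_def]
          trans[OF geodetic_iff_assignment[symmetric] geodetic_number_map_graph[OF pair_graph_G inj, symmetric]]])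
  \<comment> \<open>With \<open>q = 3 * m\<close> and \<open>K = 6 * m\<close> the cover has at most
    \<open>15 * m + 3\<close> vertices, and \<open>?k\<close> is \<open>6 * m + 3\<close>.\<close>
  moreover have "vertex_cover_number ?G + ?k \<le> 21 * m + 6"
  proof -
    have "vertex_cover_number ?G \<le> card (num (3 * m) (2 ^ m) ` cover)"
      by (rule vertex_cover_number_le, rule vertex_cover_map_graph[OF wf inj vertex_cover_cover])
    also have "\<dots> \<le> card cover"
      by (rule card_image_le) (unfold cover_def, intro finite_UnI finite_imageI finite_lessThan; simp)
    finally show ?thesis using card_cover by linarith
  qed
  moreover have "card (pverts ?G) \<le> ?M" unfolding verts using est(3) by simp
  ultimately show ?thesis by (intro exI[of _ ?G] exI[of _ ?k] exI[of _ ?out] exI[of _ t]) simp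
qed

theorem theorem4:
  shows "\<exists>(prog :: com) (f :: nat \<Rightarrow> real) (g :: nat \<Rightarrow> real) (h :: nat \<Rightarrow> real).
    f \<in> O(\<lambda>N. sqrt (real N)) \<and> g \<in> O(\<lambda>N. sqrt (real N)) \<and> h \<in> O(\<lambda>N. sqrt (real N)) \<and>
    (\<forall>(\<psi> :: nat psat) (w :: nat list).
       three_partitioned_3sat \<psi> \<and> encodes_psat w \<psi> \<longrightarrow>
       (let N = card (variables \<psi>) in
        \<exists>(G :: nat pair_pre_digraph) (k :: nat) (out :: nat list) (t :: nat).
          computes_in_time prog w t out \<and> real t \<le> 2 powr f N \<and>
          encodes_geodetic out G k \<and> pair_graph G \<and> k > 0 \<and>
          (satisfiable \<psi> \<longleftrightarrow> (\<exists>S. geodetic_set G S \<and> card S \<le> k)) \<and>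
          real (vertex_cover_number G + k) \<le> g N \<and>
          real (card (pverts G)) \<le> 2 powr h N))"
proof -
  obtain C d where Cd: "\<And>M. run_time M \<le> C * (M + 1) ^ d"
    using polynomial_run_time unfolding polynomial_def by blast
  \<comment> \<open>All three come from inserting \<open>m \<le> sqrt N + 2\<close>: into
    \<open>(20 * m + 1) * d\<close> plus the logarithm of \<open>C + 1\<close>, into
    \<open>21 * m + 6\<close>, and into \<open>20 * m\<close>. Using \<open>C + 1\<close> instead of
    \<open>C\<close> keeps the argument of the logarithm positive.\<close>
  define f where "f N = real d * 20 * sqrt (real N) + (log 2 (real C + 1) + real d * 41)" for N :: nat
  define g where "g N = 21 * sqrt (real N) + 48" for N :: nat
  define h where "h N = 20 * sqrt (real N) + 40" for N :: nat
  have fgh: "f \<in> O(\<lambda>N. sqrt (real N))" "g \<in> O(\<lambda>N. sqrt (real N))" "h \<in> O(\<lambda>N. sqrt (real N))"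
    unfolding f_def g_def h_def by (rule linear_sqrt_bigo)+
  have main: "\<exists>(G :: nat pair_pre_digraph) k out t.
      computes_in_time program w t out \<and> real t \<le> 2 powr f N \<and>
      encodes_geodetic out G k \<and> pair_graph G \<and> k > 0 \<and>
      (satisfiable \<psi> \<longleftrightarrow> (\<exists>S. geodetic_set G S \<and> card S \<le> k)) \<and>
      real (vertex_cover_number G + k) \<le> g N \<and> real (card (pverts G)) \<le> 2 powr h N"
    if psat: "three_partitioned_3sat \<psi>" and enc: "encodes_psat w \<psi>" and N: "N = card (variables \<psi>)"
    for \<psi> w N
  proof -
    define m where "m = block_size (card (part_alpha \<psi>))"
    have "card (part_alpha \<psi>) \<le> N"
      unfolding N using psat by (intro card_mono) (auto simp: three_partitioned_3sat_def variables_def)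
    then have m: "real m \<le> sqrt (real N) + 2"
      using block_size_sqrt[of "card (part_alpha \<psi>)"] real_sqrt_le_mono[of "real (card (part_alpha \<psi>))" "real N"]
      unfolding m_def by linarith
    obtain G k out t where red: "computes_in_time program w t out" "t \<le> run_time (2 ^ (20 * m))"
      "encodes_geodetic out G k" "pair_graph G" "k > 0"
      "satisfiable \<psi> \<longleftrightarrow> (\<exists>S. geodetic_set G S \<and> card S \<le> k)"
      "vertex_cover_number G + k \<le> 21 * m + 6" "card (pverts G) \<le> 2 ^ (20 * m)"
      using reduction_correct[OF psat enc] unfolding m_def by blast
    have "real t \<le> 2 powr f N"
    proof -
      have "t \<le> C * (2 ^ (20 * m) + 1) ^ d" using red(2) Cd order_trans by blast
      also have "\<dots> \<le> (C + 1) * (2 ^ (20 * m + 1)) ^ d" by (intro mult_mono power_mono) auto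
      finally have "real t \<le> real ((C + 1) * (2 ^ (20 * m + 1)) ^ d)" by (simp only: of_nat_le_iff)
      also have "\<dots> = (real C + 1) * 2 ^ ((20 * m + 1) * d)"
        by (simp only: of_nat_mult of_nat_power of_nat_add of_nat_1 of_nat_numeral power_mult)
      also have "\<dots> = 2 powr (log 2 (real C + 1)) * 2 powr (real ((20 * m + 1) * d))"
        by (subst powr_realpow) simp_all
      also have "\<dots> = 2 powr (log 2 (real C + 1) + real ((20 * m + 1) * d))"
        by (simp add: powr_add)
      also have "\<dots> \<le> 2 powr f N"
      proof (rule powr_mono)
        have "(20 * real m + 1) * real d \<le> (20 * (sqrt (real N) + 2) + 1) * real d"
          using m by (intro mult_right_mono) auto
        then show "log 2 (real C + 1) + real ((20 * m + 1) * d) \<le> f N"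
          by (simp add: f_def algebra_simps)
      qed simp
      finally show ?thesis .
    qed
    moreover have "real (vertex_cover_number G + k) \<le> g N"
    proof -
      have "real (vertex_cover_number G + k) \<le> real (21 * m + 6)" using red(7) by (simp only: of_nat_le_iff)
      then show ?thesis using m by (simp add: g_def)
    qed
    moreover have "real (card (pverts G)) \<le> 2 powr h N"
    proof -
      have "real (card (pverts G)) \<le> real (2 ^ (20 * m))" using red(8) by (simp only: of_nat_le_iff)
      also have "\<dots> = 2 powr (real (20 * m))" by (simp add: powr_realpow del: of_nat_mult)
      also have "\<dots> \<le> 2 powr h N" using m by (intro powr_mono) (simp_all add: h_def)
      finally show ?thesis .
    qed
    ultimately show ?thesis
      using red by (intro exI[of _ G] exI[of _ k] exI[of _ out] exI[of _ t] conjI)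
  qed
  show ?thesis
    unfolding Let_def
    by (rule exI[of _ program], rule exI[of _ f], rule exI[of _ g], rule exI[of _ h],
        intro conjI fgh allI impI, elim conjE, rule main[OF _ _ refl])
qed

end
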